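(* In the recommender-system model, assume that (i) the gains from trade under no information sharing are sufficiently large, (ii) the consumers' fundamentals have a joint Gaussian distribution, and (iii) each consumer $i$ perfectly observes $(w_i,\ell_i)$. Then the intermediary's optimal policy collects anonymized data on the vertical component $w_i$ and complete data on the horizontal component $\ell_i$.
   Context: There are many consumers $i=1,\dots,N$, one producer with constant marginal cost normalized to zero, and one data intermediary. Consumer $i$ has willingness to pay $w_i$ (vertical component), with mean $\mu$, and ideal location or product characteristic $\ell_i$ (horizontal component). The producer offers consumer $i$ a unit price $p_i$ and a product of characteristic $k_i$, which he can set freely; buying quantity $q_i$ gives her utility $\big(w_i-(k_i-\ell_i)^2-p_i\big)q_i-\tfrac12q_i^2$, and gives the producer profit $p_iq_i$. The fundamentals are the vectors $w=(w_1,\dots,w_N)$ and $\ell=(\ell_1,\dots,\ell_N)$; both the willingness to pay and the locations of different consumers are potentially correlated, and the distribution of fundamentals is symmetric across consumers. "Gains from trade under no information sharing are sufficiently large" means that the mean willingness to pay $\mu$ is large enough relative to the dispersion of the locations. Given his information $Y$, the producer chooses $(p_i,k_i)$ for each $i$ to maximize expected profit, and each consumer chooses her quantity optimally. Let $\Pi_i(Y)$ and $U_i(Y)$ be the resulting ex ante expected profit from, and utility of, consumer $i$; $\varnothing$ denotes no information. The intermediary's data inflow policy $X$ specifies, separately for the willingness-to-pay data $w$ and the location data $\ell$, whether they are collected complete (with consumers' identities) or anonymized (with the consumers' indices randomly permuted, so without identifying information). $X_{-i}$ denotes the same policy applied to consumers $j\neq i$ only. In equilibrium all collected data are transmitted to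 the producer, who pays $m_0(X)=\sum_i(\Pi_i(X)-\Pi_i(\varnothing))$; consumer $i$ is paid $m_i(X)=U_i(X_{-i})-U_i(X)$. An optimal policy maximizes the intermediary's profit $m_0(X)-\sum_i m_i(X)$.
   Formalization: Quantities are nonnegative (else the producer's problem is unbounded); "sufficiently large" allows a threshold for the mean depending on the whole distribution, not only the dispersion of locations; uniqueness of the optimal policy is claimed only for nondegenerate covariance. *)

theory Defs
  imports "HOL-Probability.Probability" "HOL-Combinatorics.Permutations"
begin

text \<open>
  Consumers are the elements of a finite type \<open>'n\<close>. The fundamentals are a pair \<open>(w, \<ell>)\<close> of
  vectors, and their distribution is a Borel measure on \<open>real ^ 'n \<times> real ^ 'n\<close>.
\<close>

type_synonym 'n fundamentals = "(real ^ 'n) \<times> (real ^ 'n)"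
type_synonym consumer_type = "real \<times> real"  \<comment> \<open>\<open>(w\<^sub>i, \<ell>\<^sub>i)\<close>\<close>
type_synonym offer = "real \<times> real"  \<comment> \<open>price and product characteristic \<open>(p\<^sub>i, k\<^sub>i)\<close>\<close>
type_synonym belief = "consumer_type measure"


subsection \<open>Distribution of the fundamentals\<close>

definition std_gaussian :: "'a::euclidean_space measure" where
  "std_gaussian = density lborel (\<lambda>z. ennreal (\<Prod>b\<in>Basis. std_normal_density (z \<bullet> b)))"

text \<open>Affine images of a standard Gaussian vector; singular covariance matrices are included.\<close>

definition gaussian :: "'a::euclidean_space measure \<Rightarrow> bool" where
  "gaussian F \<longleftrightarrow> (\<exists>(m :: 'a) (A :: 'a \<Rightarrow> 'a). linear A \<and> F = distr std_gaussian borel (\<lambda>z. m + A z))"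

definition nondegenerate :: "'a::euclidean_space measure \<Rightarrow> bool" where
  "nondegenerate F \<longleftrightarrow> (\<forall>v. v \<noteq> 0 \<longrightarrow> 0 < prob_space.variance F (\<lambda>x. v \<bullet> x))"

definition symmetric_consumers :: "'n::finite fundamentals measure \<Rightarrow> bool" where
  "symmetric_consumers F \<longleftrightarrow>
     (\<forall>\<delta>. \<delta> permutes UNIV \<longrightarrow> distr F borel (\<lambda>(w, l). (\<chi> j. w $ \<delta> j, \<chi> j. l $ \<delta> j)) = F)"

text \<open>Adds \<open>\<mu>\<close> to every consumer's willingness to pay.\<close>

definition shift_wtp :: "real \<Rightarrow> 'n::finite fundamentals measure \<Rightarrow> 'n fundamentals measure" where
  "shift_wtp \<mu> F = distr F borel (\<lambda>(w, l). (\<chi> j. \<mu> + w $ j, l))"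


subsection \<open>Consumer demand and the producer's problem\<close>

fun utility :: "offer \<Rightarrow> consumer_type \<Rightarrow> real \<Rightarrow> real" where
  "utility (p, k) (w, l) q = (w - (k - l)\<^sup>2 - p) * q - q\<^sup>2 / 2"

text \<open>
  A consumer observes her own \<open>(w\<^sub>i, \<ell>\<^sub>i)\<close>, so she maximizes realized utility. Quantities are
  nonnegative: with negative quantities allowed, a negative price and a remote characteristic
  would give the producer unbounded profit and his problem would never have a solution.
\<close>

definition demand :: "offer \<Rightarrow> consumer_type \<Rightarrow> real" where
  "demand a t = arg_max (utility a t) (\<lambda>q. 0 \<le> q)"

lemma demand_eq: "demand (p, k) (w, l) = max 0 (w - (k - l)\<^sup>2 - p)"
proof -
  define c where "c = w - (k - l)\<^sup>2 - p"
  have u: "utility (p, k) (w, l) q = (c\<^sup>2 - (q - c)\<^sup>2) / 2" for q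
    unfolding utility.simps c_def[symmetric] by (simp add: power2_eq_square field_simps)
  have less: "utility (p, k) (w, l) q < utility (p, k) (w, l) (max 0 c)"
    if "0 \<le> q" "q \<noteq> max 0 c" for q
  proof (cases "0 \<le> c")
    case True
    then show ?thesis using that by (simp add: u del: utility.simps)
  next
    case False
    then have "\<bar>c\<bar> < \<bar>q - c\<bar>" using that by auto
    then have "c\<^sup>2 < (q - c)\<^sup>2" by (simp add: abs_le_square_iff less_le_not_le)
    then show ?thesis using False by (simp add: u del: utility.simps)
  qed
  then have le: "utility (p, k) (w, l) q \<le> utility (p, k) (w, l) (max 0 c)" if "0 \<le> q" for q
    using that by (cases "q = max 0 c") (auto intro: less_imp_le)
  have "is_arg_max (utility (p, k) (w, l)) (\<lambda>q. 0 \<le> q) (demand (p, k) (w, l))"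
    unfolding demand_def arg_max_def
    by (rule someI[of _ "max 0 c"]) (use le in \<open>auto simp: is_arg_max_linorder\<close>)
  then have "demand (p, k) (w, l) = max 0 c"
    using less[of "demand (p, k) (w, l)"] by (auto simp: is_arg_max_def)
  then show ?thesis by (simp add: c_def)
qed

definition offer_profit :: "offer \<Rightarrow> consumer_type \<Rightarrow> real" where
  "offer_profit a t = fst a * demand a t"

definition offer_utility :: "offer \<Rightarrow> consumer_type \<Rightarrow> real" where
  "offer_utility a t = utility a t (demand a t)"

text \<open>
  The producer's behaviour is a rule \<open>r\<close> from beliefs about \<open>(w\<^sub>i, \<ell>\<^sub>i)\<close> to profit-maximizing
  offers. If several offers are optimal, \<open>r\<close> breaks the tie arbitrarily, but as a function of the
  belief only. Beliefs with infinite second moment of \<open>w\<^sub>i\<close> (for which an optimum may fail to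
  exist) are exempted.
\<close>

definition optimal_rule :: "(belief \<Rightarrow> offer) \<Rightarrow> bool" where
  "optimal_rule r \<longleftrightarrow> r \<in> prob_algebra borel \<rightarrow>\<^sub>M borel \<and>
     (\<forall>\<beta> \<in> space (prob_algebra borel). integrable \<beta> (\<lambda>t. (fst t)\<^sup>2) \<longrightarrow>
        is_arg_max (\<lambda>a. \<integral>t. offer_profit a t \<partial>\<beta>) (\<lambda>_. True) (r \<beta>))"


subsection \<open>Data and information\<close>

datatype collection = Complete | Anonymized

type_synonym policy = "collection \<times> collection"  \<comment> \<open>for \<open>w\<close> and for \<open>\<ell>\<close>\<close>

text \<open>
  The data collected from the set \<open>S\<close> of consumers; the entries outside \<open>S\<close> are uninformative
  zeros, so \<open>S = UNIV - {i}\<close> describes \<open>X\<^sub>-\<^sub>i\<close> and \<open>S = {}\<close> describes no information.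
\<close>

definition dataset :: "collection \<Rightarrow> 'n set \<Rightarrow> ('n \<Rightarrow> 'n) \<Rightarrow> real ^ 'n \<Rightarrow> real ^ 'n::finite" where
  "dataset c S \<delta> x =
     (\<chi> j. if j \<in> S then (case c of Complete \<Rightarrow> x $ j | Anonymized \<Rightarrow> x $ \<delta> j) else 0)"

text \<open>
  Law of the index permutations used for \<open>w\<close> and for \<open>\<ell>\<close>. The flag says whether, when both
  components are anonymized, the two data sets are shuffled with the same permutation or with
  independent ones.
\<close>

definition permutation_law :: "bool \<Rightarrow> 'n::finite set \<Rightarrow> (('n \<Rightarrow> 'n) \<times> ('n \<Rightarrow> 'n)) pmf" where
  "permutation_law linked S =
     (let u = pmf_of_set {\<delta>. \<delta> permutes S}
      in if linked then map_pmf (\<lambda>\<delta>. (\<delta>, \<delta>)) u else pair_pmf u u)"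

type_synonym 'n state = "'n fundamentals \<times> (('n \<Rightarrow> 'n) \<times> ('n \<Rightarrow> 'n))"

definition state_law ::
    "bool \<Rightarrow> 'n::finite fundamentals measure \<Rightarrow> 'n set \<Rightarrow> 'n state measure" where
  "state_law linked F S = F \<Otimes>\<^sub>M measure_pmf (permutation_law linked S)"

fun signal :: "policy \<Rightarrow> 'n::finite set \<Rightarrow> 'n state \<Rightarrow> 'n fundamentals" where
  "signal (cw, cl) S ((w, l), (\<delta>w, \<delta>l)) = (dataset cw S \<delta>w w, dataset cl S \<delta>l l)"

fun ctype :: "'n::finite \<Rightarrow> 'n state \<Rightarrow> consumer_type" where
  "ctype i ((w, l), _) = (w $ i, l $ i)"

text \<open>\<open>\<kappa>\<close> is a regular conditional distribution of \<open>Z\<close> given \<open>Y\<close>.\<close>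

definition posterior ::
    "'a measure \<Rightarrow> ('a \<Rightarrow> 'y::topological_space) \<Rightarrow> ('a \<Rightarrow> consumer_type) \<Rightarrow> ('y \<Rightarrow> belief) \<Rightarrow> bool"
  where
  "posterior M Y Z \<kappa> \<longleftrightarrow> \<kappa> \<in> borel \<rightarrow>\<^sub>M prob_algebra borel \<and>
     (\<forall>A\<in>sets borel. \<forall>B\<in>sets borel.
        emeasure M {\<omega>\<in>space M. Y \<omega> \<in> A \<and> Z \<omega> \<in> B} =
          (\<integral>\<^sup>+y\<in>A. emeasure (\<kappa> y) B \<partial>distr M borel Y))"

type_synonym 'n belief_system = "policy \<Rightarrow> 'n set \<Rightarrow> 'n \<Rightarrow> 'n fundamentals \<Rightarrow> belief"

definition producer_optimal ::
    "bool \<Rightarrow> 'n::finite fundamentals measure \<Rightarrow> (belief \<Rightarrow> offer) \<Rightarrow> 'n belief_system \<Rightarrow> bool" where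
  "producer_optimal linked F r \<kappa> \<longleftrightarrow> optimal_rule r \<and>
     (\<forall>X S i. posterior (state_law linked F S) (signal X S) (ctype i) (\<kappa> X S i))"


subsection \<open>Payoffs of the producer, the consumers and the intermediary\<close>

context
  fixes linked :: bool and F :: "'n::finite fundamentals measure"
    and r :: "belief \<Rightarrow> offer" and \<kappa> :: "'n belief_system"
begin

definition producer_profit :: "policy \<Rightarrow> 'n set \<Rightarrow> 'n \<Rightarrow> real" where
  "producer_profit X S i =
     (\<integral>\<omega>. offer_profit (r (\<kappa> X S i (signal X S \<omega>))) (ctype i \<omega>) \<partial>state_law linked F S)"

definition consumer_utility :: "policy \<Rightarrow> 'n set \<Rightarrow> 'n \<Rightarrow> real" where
  "consumer_utility X S i =
     (\<integral>\<omega>. offer_utility (r (\<kappa> X S i (signal X S \<omega>))) (ctype i \<omega>) \<partial>state_law linked F S)"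

definition producer_payment :: "policy \<Rightarrow> real" where
  "producer_payment X = (\<Sum>i\<in>UNIV. producer_profit X UNIV i - producer_profit X {} i)"

definition consumer_payment :: "policy \<Rightarrow> 'n \<Rightarrow> real" where
  "consumer_payment X i = consumer_utility X (UNIV - {i}) i - consumer_utility X UNIV i"

definition intermediary_profit :: "policy \<Rightarrow> real" where
  "intermediary_profit X = producer_payment X - (\<Sum>i\<in>UNIV. consumer_payment X i)"

definition optimal_policy :: "policy \<Rightarrow> bool" where
  "optimal_policy X \<longleftrightarrow> is_arg_max intermediary_profit (\<lambda>_. True) X"

end

end

theory Submission
  imports Defs
begin

text \<open>
  The payoffs \<open>\<Pi>\<^sub>i(\<emptyset>)\<close> and \<open>U\<^sub>i(X\<^sub>-\<^sub>i)\<close> do not depend on the policy \<open>X\<close>: for symmetric Gaussian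
  fundamentals, the conditional law of \<open>(w\<^sub>i, \<ell>\<^sub>i)\<close> given the data of the others is a function of the
  sums of these data, which no anonymization can hide. Hence an optimal policy maximizes the sum of
  \<open>\<Pi>\<^sub>i(X) + U\<^sub>i(X)\<close> over the consumers.

  With full data every posterior is supported in the range of the data. Except on an event where
  some datum is of order \<open>\<mu>\<close>, demand is therefore interior and the producer offers \<open>k\<^sub>i = E \<ell>\<^sub>i\<close>,
  \<open>p\<^sub>i = (E w\<^sub>i - Var \<ell>\<^sub>i) / 2\<close>. Writing \<open>w\<^sub>i = \<mu> + x\<^sub>i\<close>, this gives
  \<open>\<Pi>\<^sub>i(X) + U\<^sub>i(X) = 3\<mu>\<^sup>2/8 - (3\<mu>/4) E[Var \<ell>\<^sub>i] + const + o(1)\<close>, so for large \<open>\<mu>\<close> locations must be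
  revealed whenever this reduces \<open>E[Var \<ell>\<^sub>i]\<close> below its anonymized value. With \<open>Var \<ell>\<^sub>i = 0\<close> the
  constant is \<open>3/8 E[x\<^sub>i\<^sup>2] + E[Var x\<^sub>i]/8\<close>, so willingness to pay should be anonymized. In the
  degenerate cases in which anonymization hides nothing the posteriors coincide and the policies tie
  exactly; for a nondegenerate Gaussian law, identifying a component from anonymized data would force
  that component to be equal across consumers.
\<close>

section \<open>Standard Gaussian measures\<close>

text \<open>The threshold for \<mu> must be chosen before the rule \<open>r\<close> and the belief
  system. Two devices remove the dependence on them. Posteriors at mean \<mu> are translates of
  posteriors at mean 0, so one belief system, fixed in the locale \<open>market\<close>, represents
  all of them up to null sets. And \<open>spread\<close>, one plus the squared norm of the
  fundamentals, is unchanged by permutations: the producer can compute it from the data, it bounds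
  the support of his belief, and its integrable square dominates the error for every optimal rule at
  once. The factor 3/8 arises as follows. If A is the realized value net of mismatch and p the
  price, then at positive demand profit plus utility is p (A - p) + (A - p)^2 / 2 = (A^2 - p^2) / 2;
  with A near \<mu> and p near \<mu> / 2 the leading term is 3 \<mu>^2 / 8. The covariance may be
  singular, so conditioning avoids densities and inverse matrices: the residual of a projection of
  the underlying standard Gaussian vector is resampled.\<close>

lemma distr_lborel_linear_isometry:
  fixes T :: "'a::euclidean_space \<Rightarrow> 'a"
  assumes "linear T" and norm_T: "\<And>x. norm (T x) = norm x"
  shows "distr lborel borel T = lborel"
proof -
  define \<mu> where "\<mu> = distr lborel borel T"
  have T_borel[measurable]: "T \<in> borel_measurable borel"
    using \<open>linear T\<close> by (intro borel_measurable_continuous_onI linear_continuous_on linear_conv_bounded_linear[THEN iffD1])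
  have sets_\<mu>[measurable_cong]: "sets \<mu> = sets borel" by (simp add: \<mu>_def)
  have "inj T"
    using norm_T \<open>linear T\<close> by (simp add: linear_injective_0) (metis norm_eq_zero)
  then have "surj T" using \<open>linear T\<close> by (simp add: linear_injective_imp_surjective)
  have transl_lborel: "distr lborel borel (\<lambda>x. x + a) = lborel" for a :: 'a
    using lborel_distr_plus[of a] by (simp add: add.commute[of _ a])
  \<comment> \<open>Since T is onto, translating the image by a amounts to translating the argument
    by a preimage of a.\<close>
  have transl_\<mu>: "(\<integral>\<^sup>+x. f (x + a) \<partial>\<mu>) = (\<integral>\<^sup>+x. f x \<partial>\<mu>)"
    if [measurable]: "f \<in> borel_measurable borel" for f and a :: 'a
  proof -
    obtain b where b: "T b = a" using \<open>surj T\<close> by (metis surjD)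
    have "(\<integral>\<^sup>+x. f (x + a) \<partial>\<mu>) = (\<integral>\<^sup>+x. f (T (x + b)) \<partial>lborel)"
      using linear_add[OF \<open>linear T\<close>] by (simp add: \<mu>_def nn_integral_distr b)
    also have "\<dots> = (\<integral>\<^sup>+x. f (T x) \<partial>distr lborel borel (\<lambda>x. x + b))"
      by (subst nn_integral_distr) simp_all
    finally show ?thesis by (simp add: transl_lborel \<mu>_def nn_integral_distr)
  qed
  have transl: "(\<integral>\<^sup>+x. f (x + a) \<partial>lborel) = (\<integral>\<^sup>+x. f x \<partial>lborel)"
    if [measurable]: "f \<in> borel_measurable borel" for f and a :: 'a
  proof -
    have "(\<integral>\<^sup>+x. f x \<partial>distr lborel borel (\<lambda>x. x + a)) = (\<integral>\<^sup>+x. f (x + a) \<partial>lborel)"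
      by (subst nn_integral_distr) simp_all
    then show ?thesis by (simp add: transl_lborel)
  qed
  \<comment> \<open>The unit ball is the reference set: it is symmetric under negation, has finite
    nonzero volume, and is its own preimage under T.\<close>
  define B where "B = cball (0::'a) 1"
  have B_borel[measurable]: "B \<in> sets borel" by (simp add: B_def)
  have B_uminus: "- x \<in> B \<longleftrightarrow> x \<in> B" for x by (simp add: B_def)
  have \<mu>_ball: "emeasure \<mu> (cball 0 r) = emeasure lborel (cball (0::'a) r)" for r
  proof -
    have "T -` cball 0 r = cball 0 r" using norm_T by auto
    then show ?thesis by (simp add: \<mu>_def emeasure_distr)
  qed
  interpret \<mu>: sigma_finite_measure \<mu>
  proof
    show "\<exists>A. countable A \<and> A \<subseteq> sets \<mu> \<and> \<Union> A = space \<mu> \<and> (\<forall>a\<in>A. emeasure \<mu> a \<noteq> \<infinity>)"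
    proof (intro exI[of _ "range (\<lambda>n::nat. cball 0 (real n))"] conjI ballI)
      show "\<Union> (range (\<lambda>n::nat. cball 0 (real n))) = space \<mu>"
        using real_arch_simple by (auto simp: \<mu>_def)
    qed (auto simp: sets_\<mu> \<mu>_ball top_unique dest: emeasure_lborel_cball_finite[THEN less_imp_neq, unfolded infinity_ennreal_def, THEN notE])
  qed
  interpret pair_sigma_finite \<mu> lborel ..
  \<comment> \<open>Uniqueness of translation-invariant measures by Fubini: translating x by y,
    exchanging the integrals and translating back moves the integration of A from
    \<open>\<mu>\<close> to \<open>lborel\<close>. The reflection that this causes in B is absorbed
    by the symmetry of B.\<close>
  have "lborel = \<mu>"
  proof (rule measure_eqI)
    fix A :: "'a set" assume "A \<in> sets lborel"
    then have [measurable]: "A \<in> sets borel" by simp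
    have "emeasure \<mu> A * emeasure lborel B = (\<integral>\<^sup>+y. \<integral>\<^sup>+x. indicator A x * indicator B y \<partial>\<mu> \<partial>lborel)"
      by (simp add: nn_integral_multc nn_integral_cmult_indicator sets_\<mu>)
    also have "\<dots> = (\<integral>\<^sup>+y. \<integral>\<^sup>+x. indicator A (x + y) * indicator B y \<partial>\<mu> \<partial>lborel)"
      by (subst transl_\<mu>[where f = "\<lambda>x. indicator A x * indicator B y" for y]) measurable
    also have "\<dots> = (\<integral>\<^sup>+x. \<integral>\<^sup>+y. indicator A (x + y) * indicator B y \<partial>lborel \<partial>\<mu>)"
      by (rule Fubini') measurable
    also have "\<dots> = (\<integral>\<^sup>+x. \<integral>\<^sup>+y. indicator A y * indicator B (y - x) \<partial>lborel \<partial>\<mu>)"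
    proof (rule nn_integral_cong)
      fix x
      have "(\<lambda>y. indicator A y * indicator B (y - x) :: ennreal) \<in> borel_measurable borel" by measurable
      from transl[OF this, of x]
      show "(\<integral>\<^sup>+y. indicator A (x + y) * indicator B y \<partial>lborel)
          = (\<integral>\<^sup>+y. indicator A y * indicator B (y - x) \<partial>lborel)"
        by (simp add: add.commute[of _ x])
    qed
    also have "\<dots> = (\<integral>\<^sup>+y. \<integral>\<^sup>+x. indicator A y * indicator B (y - x) \<partial>\<mu> \<partial>lborel)"
      by (rule Fubini'[symmetric]) measurable
    also have "\<dots> = (\<integral>\<^sup>+y. \<integral>\<^sup>+x. indicator A y * indicator B (- x) \<partial>\<mu> \<partial>lborel)"
    proof (rule nn_integral_cong)
      fix y
      have "(\<lambda>x. indicator A y * indicator B (y - x) :: ennreal) \<in> borel_measurable borel" by measurable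
      from transl_\<mu>[OF this, of y]
      show "(\<integral>\<^sup>+x. indicator A y * indicator B (y - x) \<partial>\<mu>)
          = (\<integral>\<^sup>+x. indicator A y * indicator B (- x) \<partial>\<mu>)"
        by simp
    qed
    also have "\<dots> = (\<integral>\<^sup>+y. \<integral>\<^sup>+x. indicator A y * indicator B x \<partial>\<mu> \<partial>lborel)"
      by (intro nn_integral_cong) (simp add: indicator_def B_uminus)
    also have "\<dots> = emeasure lborel A * emeasure lborel B"
      by (simp add: nn_integral_multc nn_integral_cmult_indicator sets_\<mu> \<mu>_ball[of 1, folded B_def])
    finally have eq: "emeasure \<mu> A * emeasure lborel B = emeasure lborel A * emeasure lborel B" .
    have "emeasure lborel B \<noteq> \<infinity>" using emeasure_lborel_cball_finite[of "0::'a" 1] by (simp add: B_def)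
    moreover have "emeasure lborel B \<noteq> 0"
    proof
      assume "emeasure lborel B = 0"
      then have "emeasure lborel (ball (0::'a) 1) = 0"
        by (metis B_def ball_subset_cball emeasure_mono le_zero_eq sets_lborel borel_closed closed_cball)
      then show False using open_not_negligible[of "ball (0::'a) 1"]
        by (auto simp: negligible_iff_null_sets null_sets_def)
    qed
    ultimately show "emeasure lborel A = emeasure \<mu> A"
      using eq by (metis ennreal_mult_cancel_left infinity_ennreal_def mult.commute)
  qed (simp add: \<mu>_def)
  then show ?thesis unfolding \<mu>_def by (rule sym)
qed

text \<open>The squares of the coordinates add up in the exponent, so the density is a function of
  the norm alone. This is the source of all invariance under linear isometries.\<close>

lemma std_gaussian_eq:
  "(std_gaussian :: 'a::euclidean_space measure) =
     density lborel (\<lambda>z. ennreal ((1 / sqrt (2 * pi)) ^ DIM('a) * exp (- (norm z)\<^sup>2 / 2)))"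
proof -
  have "(\<Prod>b\<in>Basis. std_normal_density (z \<bullet> b)) = (1 / sqrt (2 * pi)) ^ DIM('a) * exp (- (norm z)\<^sup>2 / 2)"
    for z :: 'a
  proof -
    have "(\<Sum>b\<in>Basis. - ((z \<bullet> b)\<^sup>2) / 2) = - (norm z)\<^sup>2 / 2"
      unfolding power2_norm_eq_inner euclidean_inner[of z z]
      by (simp add: sum_divide_distrib[symmetric] sum_negf power2_eq_square)
    then show ?thesis
      unfolding std_normal_density_def prod.distrib prod_constant
      by (subst exp_sum[symmetric]) (simp_all add: power2_eq_square)
  qed
  then show ?thesis by (simp add: std_gaussian_def)
qed

lemma sets_std_gaussian[simp, measurable_cong]: "sets std_gaussian = sets borel"
  by (simp add: std_gaussian_def)

lemma space_std_gaussian[simp]: "space std_gaussian = UNIV"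
  by (simp add: std_gaussian_def)

lemma prob_space_std_gaussian: "prob_space (std_gaussian :: 'a::euclidean_space measure)"
proof
  have "(\<integral>\<^sup>+x. ennreal (std_normal_density x) \<partial>lborel) = 1"
    by (subst nn_integral_eq_integral) (auto intro: normal_density_nonneg)
  then have "(\<integral>\<^sup>+z. (\<Prod>b\<in>Basis. ennreal (std_normal_density ((z::'a) \<bullet> b))) \<partial>lborel) = 1"
    by (subst nn_integral_lborel_prod) auto
  then show "emeasure (std_gaussian :: 'a measure) (space std_gaussian) = 1"
    by (simp add: std_gaussian_def emeasure_density prod_ennreal[symmetric] normal_density_nonneg del: prod_ennreal)
qed

interpretation std_gaussian: prob_space "std_gaussian :: 'a::euclidean_space measure"
  by (rule prob_space_std_gaussian)

lemma distr_std_gaussian_linear_isometry: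
  fixes T :: "'a::euclidean_space \<Rightarrow> 'a"
  assumes "linear T" "\<And>x. norm (T x) = norm x"
  shows "distr std_gaussian borel T = std_gaussian"
proof -
  have [measurable]: "T \<in> borel_measurable borel"
    using \<open>linear T\<close> by (intro borel_measurable_continuous_onI linear_continuous_on linear_conv_bounded_linear[THEN iffD1])
  let ?g = "\<lambda>z::'a. ennreal ((1 / sqrt (2 * pi)) ^ DIM('a) * exp (- (norm z)\<^sup>2 / 2))"
  have "std_gaussian = density (distr lborel borel T) ?g"
    by (simp add: std_gaussian_eq distr_lborel_linear_isometry assms)
  also have "\<dots> = distr (density lborel (\<lambda>x. ?g (T x))) borel T"
    by (rule density_distr) simp_all
  also have "density lborel (\<lambda>x. ?g (T x)) = std_gaussian"
    by (simp add: std_gaussian_eq assms)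
  finally show ?thesis by simp
qed

text \<open>Squared norms add in a product space. Isometries of the product may therefore mix two
  independent copies.\<close>

lemma std_gaussian_pair:
  "std_gaussian \<Otimes>\<^sub>M std_gaussian = (std_gaussian :: ('a::euclidean_space \<times> 'b::euclidean_space) measure)"
proof -
  let ?c = "1 / sqrt (2 * pi)"
  let ?f = "\<lambda>z::'a. ennreal (?c ^ DIM('a) * exp (- (norm z)\<^sup>2 / 2))"
  let ?g = "\<lambda>z::'b. ennreal (?c ^ DIM('b) * exp (- (norm z)\<^sup>2 / 2))"
  have "std_gaussian \<Otimes>\<^sub>M std_gaussian = density (lborel \<Otimes>\<^sub>M lborel) (\<lambda>(x, y). ?f x * ?g y)"
    unfolding std_gaussian_eq
    using std_gaussian.sigma_finite_measure_axioms[where 'a='b, unfolded std_gaussian_eq]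
    by (intro pair_measure_density) (simp_all add: lborel.sigma_finite_measure_axioms)
  also have "(\<lambda>(x, y). ?f x * ?g y) =
      (\<lambda>z. ennreal (?c ^ DIM('a \<times> 'b) * exp (- (norm z)\<^sup>2 / 2)))"
  proof
    fix z :: "'a \<times> 'b"
    have "exp (- (norm z)\<^sup>2 / 2) = exp (- (norm (fst z))\<^sup>2 / 2) * exp (- (norm (snd z))\<^sup>2 / 2)"
      by (simp add: norm_prod_def exp_add[symmetric] add_divide_distrib)
    then show "(case z of (x, y) \<Rightarrow> ?f x * ?g y) = ennreal (?c ^ DIM('a \<times> 'b) * exp (- (norm z)\<^sup>2 / 2))"
      unfolding split_def by (subst ennreal_mult[symmetric]) (simp_all add: power_add)
  qed
  also have "density (lborel \<Otimes>\<^sub>M lborel) \<dots> = std_gaussian"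
    by (simp add: lborel_prod std_gaussian_eq)
  finally show ?thesis .
qed

lemma AE_std_gaussian_iff:
  "(AE z in std_gaussian. P z) \<longleftrightarrow> (AE z in (lborel :: 'a::euclidean_space measure). P z)"
  unfolding std_gaussian_eq by (subst AE_density) (simp_all add: power_one_over)

text \<open>Profits are quadratic in a bound that is itself quadratic in the data, hence the fourth
  moment. The norm is dominated by the product of the factors
  \<open>1 + (z \<bullet> b)\<^sup>2\<close>, whose integral splits into one-dimensional normal
  moments.\<close>

lemma integrable_std_gaussian_norm:
  "integrable std_gaussian (\<lambda>z::'a::euclidean_space. (1 + (norm z)\<^sup>2)\<^sup>2)"
proof (rule integrableI_nonneg)
  have one_le_prod: "1 + (norm z)\<^sup>2 \<le> (\<Prod>b\<in>Basis. 1 + (z \<bullet> b)\<^sup>2)" for z :: 'a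
  proof -
    have "1 + (\<Sum>b\<in>B. (z \<bullet> b)\<^sup>2) \<le> (\<Prod>b\<in>B. 1 + (z \<bullet> b)\<^sup>2)" if "finite B" for B
      using that
    proof induction
      case (insert b B)
      have "1 + (\<Sum>b\<in>insert b B. (z \<bullet> b)\<^sup>2) \<le> (1 + (z \<bullet> b)\<^sup>2) * (1 + (\<Sum>b\<in>B. (z \<bullet> b)\<^sup>2))"
        using insert by (simp add: algebra_simps sum_nonneg)
      also have "\<dots> \<le> (1 + (z \<bullet> b)\<^sup>2) * (\<Prod>b\<in>B. 1 + (z \<bullet> b)\<^sup>2)"
        using insert.IH by (intro mult_left_mono) auto
      finally show ?case using insert by simp
    qed simp
    from this[of Basis] show ?thesis
      unfolding power2_norm_eq_inner euclidean_inner[of z z] by (simp add: power2_eq_square)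
  qed
  have fin: "(\<integral>\<^sup>+x. ennreal (std_normal_density x * (1 + x\<^sup>2)\<^sup>2) \<partial>lborel) < \<infinity>"
  proof -
    have "integrable lborel (\<lambda>x. std_normal_density x * x ^ 0 + 2 * (std_normal_density x * x ^ 2)
        + std_normal_density x * x ^ 4)"
      by (intro Bochner_Integration.integrable_add integrable_std_normal_moment integrable_mult_right)
    also have "(\<lambda>x. std_normal_density x * x ^ 0 + 2 * (std_normal_density x * x ^ 2)
        + std_normal_density x * x ^ 4) = (\<lambda>x. std_normal_density x * (1 + x\<^sup>2)\<^sup>2)"
      by (auto simp: fun_eq_iff algebra_simps power2_eq_square power4_eq_xxxx)
    finally show ?thesis
      by (subst nn_integral_eq_integral) (auto intro!: mult_nonneg_nonneg normal_density_nonneg)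
  qed
  have "(\<integral>\<^sup>+z. ennreal ((1 + (norm z)\<^sup>2)\<^sup>2) \<partial>(std_gaussian :: 'a measure))
    = (\<integral>\<^sup>+z. ennreal (\<Prod>b\<in>Basis. std_normal_density (z \<bullet> b)) * ennreal ((1 + (norm z)\<^sup>2)\<^sup>2) \<partial>(lborel :: 'a measure))"
    unfolding std_gaussian_def by (subst nn_integral_density) auto
  also have "\<dots> \<le> (\<integral>\<^sup>+z. (\<Prod>b\<in>Basis. ennreal (std_normal_density (z \<bullet> b) * (1 + (z \<bullet> b)\<^sup>2)\<^sup>2)) \<partial>(lborel :: 'a measure))"
  proof (intro nn_integral_mono)
    fix z :: 'a
    have "(1 + (norm z)\<^sup>2)\<^sup>2 \<le> (\<Prod>b\<in>Basis. 1 + (z \<bullet> b)\<^sup>2)\<^sup>2"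
      by (intro power_mono one_le_prod) simp
    also have "\<dots> = (\<Prod>b\<in>Basis. (1 + (z \<bullet> b)\<^sup>2)\<^sup>2)" by (simp add: prod_power_distrib)
    finally show "ennreal (\<Prod>b\<in>Basis. std_normal_density (z \<bullet> b)) * ennreal ((1 + (norm z)\<^sup>2)\<^sup>2)
        \<le> (\<Prod>b\<in>Basis. ennreal (std_normal_density (z \<bullet> b) * (1 + (z \<bullet> b)\<^sup>2)\<^sup>2))"
      by (subst ennreal_mult[symmetric])
         (auto simp: prod_ennreal prod.distrib prod_nonneg intro!: ennreal_leI mult_left_mono)
  qed
  also have "\<dots> < \<infinity>"
    using fin by (subst nn_integral_lborel_prod) (auto simp: less_top[symmetric] power_eq_top_ennreal)
  finally show "(\<integral>\<^sup>+z. ennreal ((1 + (norm z)\<^sup>2)\<^sup>2) \<partial>(std_gaussian :: 'a measure)) < \<infinity>" .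
qed auto

lemma integrable_std_gaussian_bound:
  fixes f :: "'a::euclidean_space \<Rightarrow> real"
  assumes [measurable]: "f \<in> borel_measurable borel" and "\<And>z. \<bar>f z\<bar> \<le> C * (1 + (norm z)\<^sup>2)\<^sup>2"
  shows "integrable std_gaussian f"
  by (rule Bochner_Integration.integrable_bound[OF integrable_mult_right[OF integrable_std_gaussian_norm, of C]])
     (use assms in \<open>auto intro!: order.trans[OF assms(2)]\<close>)

lemma integrable_std_gaussian_inner:
  "integrable std_gaussian (\<lambda>z. a \<bullet> z)" "integrable std_gaussian (\<lambda>z. (a \<bullet> z) * (b \<bullet> z))"
  for a b :: "'a::euclidean_space"
proof -
  have "norm z \<le> (1 + (norm z)\<^sup>2)\<^sup>2" for z :: 'a
  proof -
    have "norm z \<le> 1 + (norm z)\<^sup>2"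
      using zero_le_power2[of "norm z - 1"] by (simp add: power2_diff) (use norm_ge_zero[of z] in linarith)
    also have "\<dots> \<le> (1 + (norm z)\<^sup>2)\<^sup>2" by (rule self_le_power) simp_all
    finally show ?thesis .
  qed
  then have "\<bar>a \<bullet> z\<bar> \<le> norm a * (1 + (norm z)\<^sup>2)\<^sup>2" for z
    by (meson Cauchy_Schwarz_ineq2 mult_left_mono norm_ge_zero order_trans)
  then show "integrable std_gaussian (\<lambda>z. a \<bullet> z)"
    by (intro integrable_std_gaussian_bound) auto
  have "\<bar>(a \<bullet> z) * (b \<bullet> z)\<bar> \<le> norm a * norm b * (1 + (norm z)\<^sup>2)\<^sup>2" for z
  proof -
    have "\<bar>(a \<bullet> z) * (b \<bullet> z)\<bar> \<le> (norm a * norm z) * (norm b * norm z)"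
      unfolding abs_mult by (intro mult_mono Cauchy_Schwarz_ineq2) auto
    also have "\<dots> = norm a * norm b * (norm z)\<^sup>2" by (simp add: power2_eq_square)
    also have "\<dots> \<le> norm a * norm b * (1 + (norm z)\<^sup>2)\<^sup>2"
      by (intro mult_left_mono) (auto simp: power2_eq_square algebra_simps)
    finally show ?thesis .
  qed
  then show "integrable std_gaussian (\<lambda>z. (a \<bullet> z) * (b \<bullet> z))"
    by (intro integrable_std_gaussian_bound) auto
qed

text \<open>Invariance under isometries makes the second moment of \<open>a \<bullet> z\<close> a
  function of the norm of a; a basis vector determines this function, and polarization gives the
  mixed moments.\<close>

lemma integral_std_gaussian_inner:
  fixes a b :: "'a::euclidean_space"
  shows "(\<integral>z. (a \<bullet> z) * (b \<bullet> z) \<partial>std_gaussian) = a \<bullet> b"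
proof -
  define q where "q = (\<lambda>a::'a. \<integral>z. (a \<bullet> z)\<^sup>2 \<partial>std_gaussian)"
  have int_sq: "integrable std_gaussian (\<lambda>z. (a \<bullet> z)\<^sup>2)" for a :: 'a
    using integrable_std_gaussian_inner(2)[of a a] by (simp add: power2_eq_square)
  have q_norm: "q x = q y" if "norm x = norm y" for x y
  proof (cases "x = y")
    case False
    define u where "u = x - y"
    \<comment> \<open>Householder reflection in the hyperplane orthogonal to u; it exchanges x and y
      because their norms agree.\<close>
    define T where "T = (\<lambda>z. z - (2 * (z \<bullet> u) / (u \<bullet> u)) *\<^sub>R u)"
    have uu: "u \<bullet> u \<noteq> 0" using False by (simp add: u_def)
    have "x \<bullet> x = y \<bullet> y" using that by (simp add: norm_eq)
    then have uu2: "u \<bullet> u = 2 * (x \<bullet> u)" by (simp add: u_def inner_diff inner_commute)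
    have lin: "linear T"
      by (rule linearI)
         (simp_all add: T_def inner_add_left distrib_left add_divide_distrib scaleR_add_left scaleR_diff_right)
    have ort: "norm (T z) = norm z" for z
    proof -
      define c where "c = 2 * (z \<bullet> u) / (u \<bullet> u)"
      have c: "c * (u \<bullet> u) = 2 * (z \<bullet> u)" using uu by (simp add: c_def)
      have "T z \<bullet> T z = z \<bullet> z - 2 * c * (z \<bullet> u) + c * (c * (u \<bullet> u))"
        unfolding T_def c_def[symmetric] by (simp add: inner_diff inner_commute[of u z] algebra_simps)
      also have "\<dots> = z \<bullet> z" unfolding c by simp
      finally show ?thesis by (simp add: norm_eq)
    qed
    have Tx: "x \<bullet> T z = y \<bullet> z" for z
    proof -
      have "x \<bullet> T z = x \<bullet> z - (z \<bullet> u) * (2 * (x \<bullet> u) / (u \<bullet> u))"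
        by (simp add: T_def inner_diff_right)
      also have "\<dots> = y \<bullet> z" using uu unfolding uu2[symmetric]
        by (simp add: u_def inner_diff_right inner_commute)
      finally show ?thesis .
    qed
    have [measurable]: "T \<in> borel_measurable borel" unfolding T_def by measurable
    have "q x = (\<integral>z. (x \<bullet> z)\<^sup>2 \<partial>distr std_gaussian borel T)"
      by (simp add: q_def distr_std_gaussian_linear_isometry[OF lin ort])
    also have "\<dots> = q y" by (subst integral_distr) (simp_all add: Tx q_def)
    finally show ?thesis .
  qed simp
  have q_Basis: "q e = 1" if e: "e \<in> Basis" for e
  proof -
    \<comment> \<open>The coordinate along e carries the second moment, every other coordinate only
      the total mass; both equal 1.\<close>
    define f where "f = (\<lambda>b x. std_normal_density x * (if b = e then x\<^sup>2 else 1))"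
    have one: "(\<integral>\<^sup>+x. ennreal (f b x) \<partial>lborel) = 1" for b
    proof (subst nn_integral_eq_integral)
      show "integrable lborel (f b)"
        using integrable_std_normal_moment[of 2] by (cases "b = e") (simp_all add: f_def)
      show "AE x in lborel. 0 \<le> f b x"
        by (simp add: f_def mult_nonneg_nonneg normal_density_nonneg)
      show "ennreal (integral\<^sup>L lborel (f b)) = 1"
        using integral_std_normal_moment_even[of 1] by (cases "b = e") (simp_all add: f_def)
    qed
    have "(\<integral>\<^sup>+z. ennreal ((e \<bullet> z)\<^sup>2) \<partial>std_gaussian)
       = (\<integral>\<^sup>+z. ennreal (\<Prod>b\<in>Basis. std_normal_density (z \<bullet> b)) * ennreal ((e \<bullet> z)\<^sup>2) \<partial>lborel)"
      unfolding std_gaussian_def by (subst nn_integral_density) auto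
    also have "\<dots> = (\<integral>\<^sup>+z. (\<Prod>b\<in>Basis. ennreal (f b (z \<bullet> b))) \<partial>lborel)"
    proof (intro nn_integral_cong)
      fix z :: 'a
      have "(\<Prod>b\<in>Basis. (if b = e then (z \<bullet> b)\<^sup>2 else 1)) = (e \<bullet> z)\<^sup>2"
        using e by (simp add: inner_commute)
      then show "ennreal (\<Prod>b\<in>Basis. std_normal_density (z \<bullet> b)) * ennreal ((e \<bullet> z)\<^sup>2)
          = (\<Prod>b\<in>Basis. ennreal (f b (z \<bullet> b)))"
        by (simp add: prod_ennreal f_def prod.distrib normal_density_nonneg ennreal_mult[symmetric] prod_nonneg)
    qed
    also have "\<dots> = 1"
      by (subst nn_integral_lborel_prod)
         (simp_all add: one, simp_all add: f_def mult_nonneg_nonneg normal_density_nonneg)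
    finally show ?thesis
      using int_sq[of e] by (simp add: q_def nn_integral_eq_integral)
  qed
  have q: "q a = a \<bullet> a" for a
  proof -
    obtain e :: 'a where e: "e \<in> Basis" using nonempty_Basis by blast
    have "q a = q (norm a *\<^sub>R e)" using e by (intro q_norm) simp
    also have "\<dots> = (norm a)\<^sup>2 * q e" by (simp add: q_def power_mult_distrib)
    finally show ?thesis using q_Basis[OF e] by (simp add: power2_norm_eq_inner)
  qed
  have "(\<integral>z. (a \<bullet> z) * (b \<bullet> z) \<partial>std_gaussian)
      = (\<integral>z. (((a + b) \<bullet> z)\<^sup>2 - (a \<bullet> z)\<^sup>2 - (b \<bullet> z)\<^sup>2) / 2 \<partial>std_gaussian)"
    by (intro Bochner_Integration.integral_cong) (auto simp: inner_add_left power2_eq_square field_simps)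
  also have "\<dots> = (q (a + b) - q a - q b) / 2"
    by (simp add: q_def Bochner_Integration.integral_diff int_sq)
  also have "\<dots> = a \<bullet> b" by (simp add: q inner_add inner_commute)
  finally show ?thesis .
qed

lemma integral_std_gaussian_inner1: "(\<integral>z. a \<bullet> z \<partial>std_gaussian) = (0::real)" for a :: "'a::euclidean_space"
proof -
  have "(\<integral>z. a \<bullet> z \<partial>std_gaussian) = (\<integral>z. a \<bullet> z \<partial>distr std_gaussian borel uminus)"
    by (subst distr_std_gaussian_linear_isometry) (auto simp: linear_uminus linear_iff)
  also have "\<dots> = (\<integral>z. a \<bullet> (- z) \<partial>std_gaussian)" by (subst integral_distr) simp_all
  also have "\<dots> = - (\<integral>z. a \<bullet> z \<partial>std_gaussian)" by simp
  finally show ?thesis by simp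
qed

text \<open>
  For an orthogonal projection \<open>P\<close>, the vector \<open>P z + (z' - P z')\<close> is the first component of an
  isometry of the pair \<open>(z, z')\<close>; this replaces the independence of uncorrelated Gaussians.
\<close>

lemma distr_std_gaussian_resample:
  fixes P :: "'a::euclidean_space \<Rightarrow> 'a"
  assumes "linear P" and orth: "\<And>x y. P x \<bullet> (y - P y) = 0"
  shows "distr (std_gaussian \<Otimes>\<^sub>M std_gaussian) borel (\<lambda>(z, z'). P z + (z' - P z')) = std_gaussian"
proof -
  define T where "T = (\<lambda>(z, z'). (P z + (z' - P z'), P z' + (z - P z)))"
  note P_simps = linear_add[OF \<open>linear P\<close>] linear_scale[OF \<open>linear P\<close>]
  have [measurable]: "P \<in> borel_measurable borel"
    using \<open>linear P\<close> by (intro borel_measurable_continuous_onI linear_continuous_on linear_conv_bounded_linear[THEN iffD1])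
  have lin: "linear T"
    by (rule linearI) (auto simp: T_def P_simps algebra_simps)
  have pyth: "(norm (P x + (y - P y)))\<^sup>2 = (norm (P x))\<^sup>2 + (norm (y - P y))\<^sup>2" for x y
    by (rule norm_add_Pythagorean) (simp add: orthogonal_def orth)
  have ort: "norm (T u) = norm u" for u
  proof -
    obtain z z' where u: "u = (z, z')" by (cases u)
    have "(norm (T u))\<^sup>2 = (norm u)\<^sup>2"
      using pyth[of z z] pyth[of z' z'] by (simp add: u T_def norm_Pair pyth)
    then show ?thesis by simp
  qed
  have [measurable]: "T \<in> borel_measurable borel"
    using lin by (intro borel_measurable_continuous_onI linear_continuous_on linear_conv_bounded_linear[THEN iffD1])
  have "distr (std_gaussian \<Otimes>\<^sub>M std_gaussian) borel (\<lambda>(z, z'). P z + (z' - P z'))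
    = distr (std_gaussian :: ('a \<times> 'a) measure) borel (fst \<circ> T)"
    by (auto simp: std_gaussian_pair T_def split_def comp_def)
  also have "\<dots> = distr (distr std_gaussian borel T) borel fst"
    by (subst distr_distr) (simp_all add: borel_measurable_continuous_onI continuous_on_fst)
  also have "\<dots> = distr (std_gaussian \<Otimes>\<^sub>M (std_gaussian :: 'a measure)) std_gaussian fst"
    unfolding distr_std_gaussian_linear_isometry[OF lin ort] std_gaussian_pair
    by (rule distr_cong) simp_all
  also have "\<dots> = std_gaussian"
    by (rule std_gaussian.distr_pair_fst)
  finally show ?thesis .
qed

section \<open>Gaussian fundamentals\<close>

lemma borel_measurable_linear:
  fixes f :: "'a::euclidean_space \<Rightarrow> 'b::euclidean_space"
  shows "linear f \<Longrightarrow> f \<in> borel_measurable borel"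
  by (intro borel_measurable_continuous_onI linear_continuous_on linear_conv_bounded_linear[THEN iffD1])

lemma gaussianE:
  fixes F :: "'a::euclidean_space measure"
  assumes "gaussian F"
  obtains A :: "'a \<Rightarrow> 'a" and m :: 'a where "linear A" "F = distr std_gaussian borel (\<lambda>z. m + A z)"
    "(\<lambda>z. m + A z) \<in> borel_measurable borel"
proof -
  obtain m :: 'a and A :: "'a \<Rightarrow> 'a" where A: "linear A" "F = distr std_gaussian borel (\<lambda>z. m + A z)"
    using assms by (auto simp: gaussian_def)
  have "(\<lambda>z. m + A z) \<in> borel_measurable borel" using borel_measurable_linear[OF A(1)] by simp
  with A show ?thesis by (rule that)
qed

lemma sets_gaussian: "gaussian F \<Longrightarrow> sets F = sets borel"
  by (auto simp: gaussian_def)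

lemma prob_space_gaussian:
  assumes "gaussian (F :: 'a::euclidean_space measure)" shows "prob_space F"
  using assms by (rule gaussianE) (simp add: std_gaussian.prob_space_distr)

lemma integrable_gaussian_norm:
  assumes "gaussian (F :: 'a::euclidean_space measure)"
  shows "integrable F (\<lambda>x. (1 + (norm x)\<^sup>2)\<^sup>2)"
proof -
  obtain m A where A: "linear (A :: 'a \<Rightarrow> 'a)" and F: "F = distr std_gaussian borel (\<lambda>z. m + A z)"
    and [measurable]: "(\<lambda>z. m + A z) \<in> borel_measurable borel"
    by (rule gaussianE[OF assms(1)])
  obtain C where C: "0 < C" "norm (A z) \<le> norm z * C" for z
    using linear_bounded_pos[OF A] by (metis mult.commute)
  define c where "c = 2 + 2 * (norm m)\<^sup>2 + 2 * C\<^sup>2"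
  have bound: "1 + (norm (m + A z))\<^sup>2 \<le> c * (1 + (norm z)\<^sup>2)" for z
  proof -
    have "norm (m + A z) \<le> norm m + norm z * C"
      using C(2)[of z] norm_triangle_ineq[of m "A z"] by linarith
    then have "(norm (m + A z))\<^sup>2 \<le> (norm m + norm z * C)\<^sup>2" by (intro power_mono) auto
    also have "\<dots> \<le> 2 * (norm m)\<^sup>2 + 2 * (norm z * C)\<^sup>2"
      using sum_squares_bound[of "norm m" "norm z * C"] by (simp add: power2_sum)
    also have "\<dots> = 2 * (norm m)\<^sup>2 + 2 * C\<^sup>2 * (norm z)\<^sup>2" by (simp add: power_mult_distrib)
    also have "1 + \<dots> \<le> c * (1 + (norm z)\<^sup>2)"
      using zero_le_power2[of "norm z"] mult_nonneg_nonneg[of "(norm m)\<^sup>2" "(norm z)\<^sup>2"]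
      by (simp add: c_def algebra_simps)
    finally show ?thesis by simp
  qed
  have "integrable std_gaussian (\<lambda>z. (1 + (norm (m + A z))\<^sup>2)\<^sup>2)"
  proof (rule integrable_std_gaussian_bound)
    fix z
    have "(1 + (norm (m + A z))\<^sup>2)\<^sup>2 \<le> (c * (1 + (norm z)\<^sup>2))\<^sup>2"
      by (intro power_mono bound) simp
    then show "\<bar>(1 + (norm (m + A z))\<^sup>2)\<^sup>2\<bar> \<le> c\<^sup>2 * (1 + (norm z)\<^sup>2)\<^sup>2"
      by (simp add: power_mult_distrib)
  qed measurable
  then show ?thesis by (simp add: F integrable_distr_eq)
qed

section \<open>Null sets of nondegenerate Gaussian laws\<close>

lemma AE_lborel_iff_negligible:
  "(AE x in (lborel :: 'a::euclidean_space measure). P x) \<longleftrightarrow> negligible {x. \<not> P x}"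
proof
  assume "AE x in lborel. P x"
  then show "negligible {x. \<not> P x}"
    using completion.complete2[of "{x. \<not> P x}" _ lborel]
    by (auto simp: negligible_iff_null_sets eventually_ae_filter intro: null_sets_completionI)
next
  assume "negligible {x. \<not> P x}"
  then have "AE x in lebesgue. x \<notin> {x. \<not> P x}"
    by (intro AE_not_in) (simp add: negligible_iff_null_sets)
  then show "AE x in lborel. P x" by (simp add: AE_completion_iff)
qed

text \<open>Differentiable maps send negligible sets to negligible sets; this is applied to the map
  and to its inverse. Negligible sets admit predicates that are not measurable, and the later
  application involves an arbitrary function of the signal.\<close>

lemma AE_lborel_affine:
  fixes A :: "'a::euclidean_space \<Rightarrow> 'a"
  assumes A: "linear A" "inj A"
  shows "(AE z in lborel. P (m + A z)) \<longleftrightarrow> (AE x in lborel. P x)"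
proof -
  have *: "AE x in lborel. Q x" if "AE z in lborel. Q (b + B z)" "linear B" "inj B" for b and B :: "'a \<Rightarrow> 'a" and Q :: "'a \<Rightarrow> bool"
  proof -
    have "surj B" using that(2,3) by (simp add: linear_injective_imp_surjective)
    then have "\<exists>z. x = b + B z" for x by (metis add.commute diff_add_cancel surjD)
    then have "(+) b ` B ` {z. \<not> Q (b + B z)} = {x. \<not> Q x}" by fast
    moreover have "negligible ((+) b ` B ` {z. \<not> Q (b + B z)})"
      using that unfolding AE_lborel_iff_negligible
      by (intro negligible_translation negligible_differentiable_image_negligible linear_imp_differentiable_on) auto
    ultimately show ?thesis by (simp add: AE_lborel_iff_negligible)
  qed
  obtain A' where A': "linear A'" "A' \<circ> A = id" "A \<circ> A' = id"
    using A by (metis linear_injective_isomorphism comp_def fun_eq_iff id_apply)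
  have "inj A'" using A'(3) by (metis inj_on_id inj_on_imageI2)
  have A_A': "A (A' x) = x" for x using A'(3) by (metis comp_apply id_apply)
  have "AE z in lborel. P (m + A z)" if "AE x in lborel. P x"
    by (rule *[where b="- A' m" and B=A'])
       (use that A' \<open>inj A'\<close> in \<open>simp_all add: linear_add[OF A(1)] linear_diff[OF A(1)] A_A'\<close>)
  with *[OF _ A] show ?thesis by blast
qed

text \<open>A vector orthogonal to the range of the linear part would have variance zero, so
  nondegeneracy makes that part bijective. Affine bijections preserve the null sets of Lebesgue
  measure, which the standard Gaussian shares.\<close>

lemma AE_nondegenerate_gaussian_iff:
  fixes F :: "'a::euclidean_space measure"
  assumes "gaussian F" "nondegenerate F"
  shows "(AE x in F. P x) \<longleftrightarrow> (AE x in lborel. P x)"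
proof -
  obtain m A where A: "linear (A :: 'a \<Rightarrow> 'a)" and F: "F = distr std_gaussian borel (\<lambda>z. m + A z)"
    and aff_meas[measurable]: "(\<lambda>z. m + A z) \<in> borel_measurable borel"
    by (rule gaussianE[OF assms(1)])
  have aff_meas': "(\<lambda>z. m + A z) \<in> std_gaussian \<rightarrow>\<^sub>M borel" by simp
  have "surj A"
  proof (rule ccontr)
    assume "\<not> surj A"
    then have "span (range A) \<noteq> UNIV"
      using A by (metis linear_subspace_image span_eq_iff subspace_UNIV)
    then have "span (range A) \<subset> span UNIV" by auto
    then obtain v where v: "v \<noteq> 0" "\<And>y. y \<in> span (range A) \<Longrightarrow> orthogonal v y"
      using orthogonal_to_subspace_exists_gen[of "range A" UNIV] by blast
    then have "v \<bullet> A z = 0" for z by (auto simp: orthogonal_def span_base)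
    then have "integral\<^sup>L F (\<lambda>x. (v \<bullet> x - integral\<^sup>L F (\<lambda>x. v \<bullet> x))\<^sup>2) = 0"
      using std_gaussian.prob_space[where 'a='a] by (simp add: F integral_distr inner_add_right)
    then show False using assms(2) v(1) by (auto simp: nondegenerate_def)
  qed
  then have "inj A" using A by (simp add: linear_surjective_imp_injective)
  show ?thesis
  proof
    assume "AE x in F. P x"
    then have "AE z in std_gaussian. P (m + A z)"
      unfolding F by (rule AE_distrD[OF aff_meas'])
    then show "AE x in lborel. P x"
      using AE_lborel_affine[OF A \<open>inj A\<close>] by (simp add: AE_std_gaussian_iff)
  next
    assume "AE x in lborel. P x"
    \<comment> \<open>P may fail to be measurable, so its exceptional set is enlarged to a Borel
      null set before passing to the image measure.\<close>
    then obtain N where N: "{x. \<not> P x} \<subseteq> N" "N \<in> null_sets lborel"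
      by (auto simp: eventually_ae_filter)
    then have "AE x in lborel. x \<notin> N" by (intro AE_not_in)
    then have "AE z in std_gaussian. m + A z \<notin> N"
      using AE_lborel_affine[OF A \<open>inj A\<close>, of "\<lambda>x. x \<notin> N" m] by (simp add: AE_std_gaussian_iff)
    moreover have "{x. x \<notin> N} \<in> sets borel"
      using N(2) by (auto simp: null_sets_def Collect_neg_eq)
    ultimately have "AE x in F. x \<notin> N"
      unfolding F by (subst AE_distr_iff[OF aff_meas']) auto
    then show "AE x in F. P x" using N(1) by (auto elim!: AE_mp)
  qed
qed

text \<open>Relabeling only one of the two components may change the law of the fundamentals, even a
  symmetric one, but it keeps the null sets. This covers policies that anonymize a single
  component.\<close>

lemma AE_nondegenerate_gaussian_linear:
  fixes F :: "'a::euclidean_space measure"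
  assumes "gaussian F" "nondegenerate F" "linear T" "inj T"
  shows "(AE x in F. P (T x)) \<longleftrightarrow> (AE x in F. P x)"
  using AE_lborel_affine[OF assms(3,4), of P 0] by (simp add: AE_nondegenerate_gaussian_iff assms)

text \<open>Two permutations, because a policy may shuffle one component only, or both
  independently; \<open>symmetric_consumers\<close> speaks about equal ones.\<close>

definition relabel :: "('n \<Rightarrow> 'n) \<Rightarrow> ('n \<Rightarrow> 'n) \<Rightarrow> 'n::finite fundamentals \<Rightarrow> 'n fundamentals" where
  "relabel \<delta> \<epsilon> x = (\<chi> j. fst x $ \<delta> j, \<chi> j. snd x $ \<epsilon> j)"

lemma linear_relabel: "linear (relabel \<delta> \<epsilon>)"
  by (rule linearI) (simp_all add: relabel_def vec_eq_iff)

lemma relabel_measurable[measurable]: "relabel \<delta> \<epsilon> \<in> borel_measurable borel"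
  by (rule borel_measurable_linear[OF linear_relabel])

lemma inj_relabel:
  assumes "\<delta> permutes UNIV" "\<epsilon> permutes UNIV" shows "inj (relabel \<delta> \<epsilon>)"
proof (rule injI)
  fix x y assume "relabel \<delta> \<epsilon> x = relabel \<delta> \<epsilon> y"
  then have "fst x $ \<delta> j = fst y $ \<delta> j" "snd x $ \<epsilon> j = snd y $ \<epsilon> j" for j
    by (auto simp: relabel_def vec_eq_iff)
  with assms show "x = y"
    by (metis permutes_univ prod_eqI vec_eq_iff)
qed

lemma norm_relabel:
  assumes "\<delta> permutes UNIV" "\<epsilon> permutes UNIV" shows "norm (relabel \<delta> \<epsilon> x) = norm x"
proof -
  have "norm (\<chi> j. v $ \<sigma> j) = norm v" if "\<sigma> permutes UNIV" for v :: "real ^ 'a" and \<sigma>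
    using sum.permute[OF that, of "\<lambda>j. (v $ j)\<^sup>2"] by (simp add: norm_vec_def L2_set_def comp_def)
  with assms show ?thesis by (simp add: relabel_def norm_prod_def)
qed

lemma symmetric_consumers_relabel:
  "symmetric_consumers F \<Longrightarrow> \<delta> permutes UNIV \<Longrightarrow> distr F borel (relabel \<delta> \<delta>) = F"
  unfolding symmetric_consumers_def relabel_def split_def by auto

definition raise_wtp :: "real \<Rightarrow> 'n::finite fundamentals \<Rightarrow> 'n fundamentals" where
  "raise_wtp \<mu> x = (\<chi> j. \<mu> + fst x $ j, snd x)"

lemma shift_wtp_raise: "shift_wtp \<mu> F = distr F borel (raise_wtp \<mu>)"
  by (simp add: shift_wtp_def raise_wtp_def[abs_def] split_def)

lemma raise_wtp_eq: "raise_wtp \<mu> x = (\<chi> j. \<mu>, 0) + x"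
  by (simp add: raise_wtp_def plus_prod_def vec_eq_iff)

lemma raise_wtp_measurable[measurable]: "raise_wtp \<mu> \<in> borel_measurable borel"
  unfolding raise_wtp_eq[abs_def] by simp

lemma gaussian_shift_wtp:
  fixes F :: "'n::finite fundamentals measure"
  assumes "gaussian F" shows "gaussian (shift_wtp \<mu> F)"
proof -
  obtain m A where A: "linear (A :: 'n fundamentals \<Rightarrow> 'n fundamentals)" and F: "F = distr std_gaussian borel (\<lambda>z. m + A z)"
    and aff_meas[measurable]: "(\<lambda>z. m + A z) \<in> borel_measurable borel"
    by (rule gaussianE[OF assms(1)])
  have "shift_wtp \<mu> F = distr std_gaussian borel (\<lambda>z. ((\<chi> j. \<mu>, 0) + m) + A z)"
    unfolding shift_wtp_raise F by (subst distr_distr) (simp_all add: comp_def raise_wtp_eq add.assoc)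
  with A show ?thesis unfolding gaussian_def by blast
qed

lemma symmetric_consumers_shift_wtp:
  assumes "symmetric_consumers F" and "sets F = sets borel"
  shows "symmetric_consumers (shift_wtp \<mu> F)"
  unfolding symmetric_consumers_def
proof (intro allI impI)
  fix \<delta> :: "'a \<Rightarrow> 'a" assume \<delta>: "\<delta> permutes UNIV"
  note [measurable_cong] = assms(2)
  have "distr (shift_wtp \<mu> F) borel (relabel \<delta> \<delta>) = distr F borel (raise_wtp \<mu> \<circ> relabel \<delta> \<delta>)"
    unfolding shift_wtp_raise
    by (subst distr_distr) (simp_all add: comp_def raise_wtp_def relabel_def)
  also have "\<dots> = distr (distr F borel (relabel \<delta> \<delta>)) borel (raise_wtp \<mu>)"
    by (subst distr_distr) simp_all
  also have "\<dots> = shift_wtp \<mu> F"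
    by (simp add: symmetric_consumers_relabel[OF assms(1) \<delta>] shift_wtp_raise)
  finally show "distr (shift_wtp \<mu> F) borel (\<lambda>(w, l). (\<chi> j. w $ \<delta> j, \<chi> j. l $ \<delta> j)) = shift_wtp \<mu> F"
    by (simp add: relabel_def[abs_def] split_def)
qed

section \<open>Regression of one consumer on the others in a symmetric Gaussian law\<close>

definition coord :: "bool \<Rightarrow> 'n \<Rightarrow> 'n::finite fundamentals" where
  "coord b j = (if b then (axis j 1, 0) else (0, axis j 1))"

lemma inner_coord: "coord b j \<bullet> x = (if b then fst x $ j else snd x $ j)"
  by (simp add: coord_def inner_prod_def inner_axis')

text \<open>These inner products are the covariances of the coordinates of the fundamentals.
  Symmetry preserves first and second moments, and the products of the means cancel.\<close>

lemma symmetric_gaussian_gram: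
  fixes F :: "'n::finite fundamentals measure" and A :: "'n fundamentals \<Rightarrow> 'n fundamentals"
  assumes A: "linear A" and F: "F = distr std_gaussian borel (\<lambda>z. m + A z)"
    and sym: "symmetric_consumers F" and \<delta>: "\<delta> permutes UNIV"
  shows "adjoint A (coord b (\<delta> j)) \<bullet> adjoint A (coord c (\<delta> k)) =
    adjoint A (coord b j) \<bullet> adjoint A (coord c k)"
proof -
  have [measurable]: "A \<in> borel_measurable borel" using A by (rule borel_measurable_linear)
  have [measurable_cong]: "sets F = sets borel" by (simp add: F)
  have adj: "u \<bullet> A z = adjoint A u \<bullet> z" for u z
    using adjoint_works[OF A, of z u] by (simp add: inner_commute)
  have mean: "(\<integral>x. u \<bullet> x \<partial>F) = u \<bullet> m" for u
    using std_gaussian.prob_space[where 'a="'n fundamentals"]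
    by (simp add: F integral_distr inner_add_right adj integrable_std_gaussian_inner integral_std_gaussian_inner1)
  have cov: "(\<integral>x. (u \<bullet> x) * (v \<bullet> x) \<partial>F) = (u \<bullet> m) * (v \<bullet> m) + adjoint A u \<bullet> adjoint A v" for u v
    using std_gaussian.prob_space[where 'a="'n fundamentals"]
    by (simp add: F integral_distr inner_add_right adj distrib_left distrib_right
        integrable_std_gaussian_inner integral_std_gaussian_inner1 integral_std_gaussian_inner)
  have inv: "(\<integral>x. g (relabel \<delta> \<delta> x) \<partial>F) = (\<integral>x. g x \<partial>F)"
    if [measurable]: "g \<in> borel_measurable borel" for g :: "_ \<Rightarrow> real"
  proof -
    have "(\<integral>x. g x \<partial>distr F borel (relabel \<delta> \<delta>)) = (\<integral>x. g (relabel \<delta> \<delta> x) \<partial>F)"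
      by (subst integral_distr) simp_all
    then show ?thesis by (simp add: symmetric_consumers_relabel[OF sym \<delta>])
  qed
  have rel: "coord b j \<bullet> relabel \<delta> \<delta> x = coord b (\<delta> j) \<bullet> x" for b j x
    by (simp add: inner_coord relabel_def)
  have m: "coord b (\<delta> j) \<bullet> m = coord b j \<bullet> m" for b j
    using inv[of "\<lambda>x. coord b j \<bullet> x"] by (simp add: rel mean)
  show ?thesis
    using inv[of "\<lambda>x. (coord b j \<bullet> x) * (coord c k \<bullet> x)"] by (simp add: rel cov m)
qed

text \<open>
  Regression on the two sums: by symmetry the residual has the same covariance with every other
  consumer's \<open>w\<^sub>j\<close> (and \<open>\<ell>\<^sub>j\<close>), and these covariances add up to zero.
\<close>

lemma symmetric_gaussian_projection:
  fixes F :: "'n::finite fundamentals measure" and A :: "'n fundamentals \<Rightarrow> 'n fundamentals" and i :: 'n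
  assumes A: "linear A" and F: "F = distr std_gaussian borel (\<lambda>z. m + A z)"
    and sym: "symmetric_consumers F"
  obtains P \<alpha> \<beta> where "linear P" "\<forall>x y. P x \<bullet> (y - P y) = 0"
    "\<forall>b j y. j \<noteq> i \<longrightarrow> adjoint A (coord b j) \<bullet> P y = adjoint A (coord b j) \<bullet> y"
    "\<forall>b y. adjoint A (coord b i) \<bullet> P y =
        (\<Sum>j\<in>- {i}. \<alpha> b * (adjoint A (coord True j) \<bullet> y) + \<beta> b * (adjoint A (coord False j) \<bullet> y))"
proof -
  define a where "a b j = adjoint A (coord b j)" for b j
  \<comment> \<open>Inner products with these vectors are the centred data of the other consumers,
    so projecting on V is linear regression on these data.\<close>
  define V where "V = span {a b j |b j. j \<noteq> i}"
  have V: "subspace V" by (simp add: V_def)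
  obtain B where B: "B \<subseteq> V" "pairwise orthogonal B" "\<And>x. x \<in> B \<Longrightarrow> norm x = 1" "independent B" "span B = V"
    using orthonormal_basis_subspace[OF V] by metis
  have "finite B" using B(4) by (rule independent_imp_finite)
  define P where "P z = (\<Sum>v\<in>B. (z \<bullet> v) *\<^sub>R v)" for z
  have lin: "linear P"
    by (rule linearI) (simp_all add: P_def inner_add_left scaleR_add_left sum.distrib scaleR_sum_right)
  have res_B: "(y - P y) \<bullet> v = 0" if "v \<in> B" for y v
  proof -
    have "P y \<bullet> v = (\<Sum>u\<in>B. if u = v then y \<bullet> v else 0)"
      unfolding P_def inner_sum_left
    proof (rule sum.cong)
      fix u assume "u \<in> B"
      then show "(y \<bullet> u) *\<^sub>R u \<bullet> v = (if u = v then y \<bullet> v else 0)"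
        using B(2,3) that by (auto simp: pairwise_def orthogonal_def dot_square_norm)
    qed simp
    with \<open>finite B\<close> that show ?thesis by (simp add: inner_diff_left)
  qed
  have res: "(y - P y) \<bullet> v = 0" if "v \<in> V" for y v
    using that[folded B(5)] orthogonal_to_span[of v B "y - P y"] res_B by (simp add: orthogonal_def)
  have P_V: "P y \<in> V" for y
    unfolding P_def B(5)[symmetric] by (intro span_sum span_scale span_base)
  have orth: "P x \<bullet> (y - P y) = 0" for x y
    using res[OF P_V] by (simp add: inner_commute)
  have P_self: "P x \<bullet> y = x \<bullet> P y" for x y
    using orth[of x y] orth[of y x] by (simp add: inner_diff_right inner_commute)
  have P_id: "P v = v" if "v \<in> V" for v
  proof -
    have "v - P v \<in> V" using V that P_V by (rule subspace_diff)
    from res[OF this, of v] show ?thesis by simp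
  qed
  have a_V: "a b j \<in> V" if "j \<noteq> i" for b j using that by (auto simp: V_def intro: span_base)
  define s where "s b = (\<Sum>j\<in>- {i}. a b j)" for b
  have s_V: "s b \<in> V" for b unfolding s_def using a_V by (intro subspace_sum[OF V]) auto
  \<comment> \<open>Here z is the residual after projecting on the two sums only. Once it is
    orthogonal to all of V, regression on V reduces to the sums. The sums may be linearly dependent,
    so the coefficients are read off from membership in the span.\<close>
  have "\<exists>\<alpha> \<beta>. P (a b i) = \<alpha> *\<^sub>R s True + \<beta> *\<^sub>R s False" for b
  proof -
    obtain y z where y: "y \<in> span {s True, s False}" and z: "\<And>w. w \<in> span {s True, s False} \<Longrightarrow> orthogonal z w"
      and yz: "a b i = y + z"
      by (metis orthogonal_subspace_decomp_exists)
    obtain \<alpha> where "y - \<alpha> *\<^sub>R s True \<in> span {s False}"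
      using y unfolding span_insert by auto
    then obtain \<beta> where "y - \<alpha> *\<^sub>R s True = \<beta> *\<^sub>R s False"
      unfolding span_singleton by auto
    then have y_eq: "y = \<alpha> *\<^sub>R s True + \<beta> *\<^sub>R s False" by (simp add: diff_eq_eq add.commute)
    have zs: "z \<bullet> s c = 0" for c
      using z[of "s c"] by (cases c) (auto simp: orthogonal_def span_base)
    \<comment> \<open>Exchanging j and k fixes consumer i and merely reorders both sums, so it
      preserves every inner product from which those of z are built.\<close>
    have const: "z \<bullet> a c j = z \<bullet> a c k" if "j \<noteq> i" "k \<noteq> i" for c j k
    proof -
      define \<tau> where "\<tau> = Transposition.transpose j k"
      have \<tau>: "\<tau> permutes UNIV" "\<tau> i = i" "\<tau> j = k" using that by (auto simp: \<tau>_def permutes_swap_id)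
      have gram: "a b' (\<tau> j') \<bullet> a c' (\<tau> k') = a b' j' \<bullet> a c' k'" for b' c' j' k'
        unfolding a_def by (rule symmetric_gaussian_gram[OF A F sym \<tau>(1)])
      have perm: "\<tau> permutes (- {i})"
        using \<tau>(1,2) that by (auto simp: \<tau>_def intro: permutes_swap_id)
      have "s d \<bullet> a c (\<tau> j) = s d \<bullet> a c j" for d
      proof -
        have "s d = (\<Sum>k'\<in>- {i}. a d (\<tau> k'))"
          unfolding s_def using sum.permute[OF perm, of "a d"] by (simp add: comp_def)
        then have "s d \<bullet> a c (\<tau> j) = (\<Sum>k'\<in>- {i}. a d k' \<bullet> a c j)"
          by (simp add: inner_sum_left gram)
        then show ?thesis by (simp add: s_def inner_sum_left)
      qed
      moreover have "a b i \<bullet> a c (\<tau> j) = a b i \<bullet> a c j"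
        using gram[of b i c j] by (simp add: \<tau>(2))
      moreover have "z = a b i - (\<alpha> *\<^sub>R s True + \<beta> *\<^sub>R s False)" using yz y_eq by simp
      ultimately show ?thesis by (simp add: inner_diff_left inner_add_left \<tau>(3)[symmetric])
    qed
    have za: "z \<bullet> a c j = 0" if "j \<noteq> i" for c j
    proof -
      have "0 = (\<Sum>k\<in>- {i}. z \<bullet> a c k)" using zs[of c] by (simp add: s_def inner_sum_right)
      also have "\<dots> = (\<Sum>k\<in>- {i}. z \<bullet> a c j)" using that by (intro sum.cong refl const) simp_all
      also have "\<dots> = real (card (- {i})) * (z \<bullet> a c j)" by simp
      finally show ?thesis using that by (auto simp: card_eq_0_iff)
    qed
    have "orthogonal z v" if "v \<in> V" for v
      using that[unfolded V_def] by (rule orthogonal_to_span) (use za in \<open>auto simp: orthogonal_def\<close>)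
    then have "P z \<bullet> P z = 0" using P_self[of z "P z"] P_id[OF P_V] P_V by (simp add: orthogonal_def)
    then have "P z = 0" by simp
    moreover have "P y = y"
      unfolding y_eq by (intro P_id subspace_add[OF V] subspace_scale[OF V] s_V)
    ultimately show ?thesis using linear_add[OF lin, of y z] yz y_eq by auto
  qed
  then obtain \<alpha> \<beta> where \<alpha>\<beta>: "\<And>b. P (a b i) = \<alpha> b *\<^sub>R s True + \<beta> b *\<^sub>R s False" by metis
  show ?thesis
  proof (rule that[OF lin])
    show "\<forall>x y. P x \<bullet> (y - P y) = 0" using orth by blast
    show "\<forall>b j y. j \<noteq> i \<longrightarrow> adjoint A (coord b j) \<bullet> P y = adjoint A (coord b j) \<bullet> y"
      using P_self P_id[OF a_V] unfolding a_def by metis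
    have "adjoint A (coord b i) \<bullet> P y =
        (\<Sum>j\<in>- {i}. \<alpha> b * (adjoint A (coord True j) \<bullet> y) + \<beta> b * (adjoint A (coord False j) \<bullet> y))" for b y
      using P_self[of "a b i" y] \<alpha>\<beta>[of b]
      by (simp add: a_def s_def inner_add_left inner_sum_left sum.distrib sum_distrib_left)
    then show "\<forall>b y. adjoint A (coord b i) \<bullet> P y =
        (\<Sum>j\<in>- {i}. \<alpha> b * (adjoint A (coord True j) \<bullet> y) + \<beta> b * (adjoint A (coord False j) \<bullet> y))"
      by blast
  qed
qed

lemma borel_measurable_fst_snd[measurable]:
  "fst \<in> (borel :: ('a::second_countable_topology \<times> 'b::second_countable_topology) measure) \<rightarrow>\<^sub>M borel"
  "snd \<in> (borel :: ('a::second_countable_topology \<times> 'b::second_countable_topology) measure) \<rightarrow>\<^sub>M borel"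
  unfolding borel_prod[symmetric] by simp_all

text \<open>Replacing the residual of the projection by an independent copy keeps the law of the
  fundamentals, leaves the data of the others and hence g as they are, and redraws consumer i from
  \<open>K\<close> at the two sums. A test function g allows any signal built from the others' data
  to be inserted later.\<close>

lemma symmetric_gaussian_conditional:
  fixes F :: "'n::finite fundamentals measure" and i :: 'n
  assumes "gaussian F" and sym: "symmetric_consumers F"
  obtains K :: "real \<times> real \<Rightarrow> belief" where "K \<in> borel \<rightarrow>\<^sub>M prob_algebra borel"
    "\<forall>(g :: _ \<Rightarrow> ennreal) B. g \<in> borel_measurable borel \<longrightarrow>
      (\<forall>x y. (\<forall>j. j \<noteq> i \<longrightarrow> fst x $ j = fst y $ j \<and> snd x $ j = snd y $ j) \<longrightarrow> g x = g y) \<longrightarrow>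
      B \<in> sets borel \<longrightarrow>
      (\<integral>\<^sup>+x. g x * indicator B (fst x $ i, snd x $ i) \<partial>F) =
      (\<integral>\<^sup>+x. g x * emeasure (K (\<Sum>j\<in>- {i}. fst x $ j, \<Sum>j\<in>- {i}. snd x $ j)) B \<partial>F)"
proof -
  obtain m A where A: "linear (A :: 'n fundamentals \<Rightarrow> 'n fundamentals)"
    and F: "F = distr std_gaussian borel (\<lambda>z. m + A z)"
    and X_meas: "(\<lambda>z. m + A z) \<in> borel_measurable borel"
    by (rule gaussianE[OF assms(1)])
  define X where "X = (\<lambda>z. m + A z)"
  have [measurable]: "X \<in> borel_measurable borel" using X_meas by (simp add: X_def)
  have F: "F = distr std_gaussian borel X" by (simp add: F X_def)
  obtain P \<alpha> \<beta> where P: "linear P" and orth: "\<forall>x y. P x \<bullet> (y - P y) = 0"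
    and P_other: "\<forall>b j y. j \<noteq> i \<longrightarrow> adjoint A (coord b j) \<bullet> P y = adjoint A (coord b j) \<bullet> y"
    and P_i: "\<forall>b y. adjoint A (coord b i) \<bullet> P y =
        (\<Sum>j\<in>- {i}. \<alpha> b * (adjoint A (coord True j) \<bullet> y) + \<beta> b * (adjoint A (coord False j) \<bullet> y))"
    by (rule symmetric_gaussian_projection[OF A F[unfolded X_def] sym, of i])
  have [measurable]: "P \<in> borel_measurable borel" using P by (rule borel_measurable_linear)
  define S where "S b x = (\<Sum>j\<in>- {i}. coord b j \<bullet> x)" for b and x :: "'n fundamentals"
  have [measurable]: "S b \<in> borel_measurable borel" for b unfolding S_def[abs_def] by measurable
  \<comment> \<open>Regression value plus a fresh residual. The means of the sums are subtracted
    because the regression concerns the centred vector \<open>A z\<close>.\<close>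
  define h where "h b u z = coord b i \<bullet> m + (\<alpha> b * (fst u - S True m) + \<beta> b * (snd u - S False m))
      + adjoint A (coord b i) \<bullet> (z - P z)" for b u z
  define K where "K u = distr std_gaussian borel (\<lambda>z. (h True u z, h False u z))" for u
  have [measurable]: "(\<lambda>p. h b (fst p) (snd p)) \<in> borel \<rightarrow>\<^sub>M borel" for b
    unfolding h_def by measurable
  have h_meas[measurable]: "(\<lambda>z. (h True u z, h False u z)) \<in> borel \<rightarrow>\<^sub>M borel" for u
    unfolding h_def by measurable
  have hh: "(\<lambda>(u, z). (h True u z, h False u z)) \<in> borel \<Otimes>\<^sub>M borel \<rightarrow>\<^sub>M borel"
    unfolding borel_prod split_def by measurable
  have K_meas[measurable]: "K \<in> borel \<rightarrow>\<^sub>M prob_algebra borel"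
    unfolding K_def[abs_def]
  proof (rule measurable_distr_prob_space2)
    show "(\<lambda>u. std_gaussian) \<in> borel \<rightarrow>\<^sub>M prob_algebra borel"
      by (intro measurable_const) (simp add: space_prob_algebra prob_space_std_gaussian)
  qed (rule hh)
  have K_sub[measurable]: "K \<in> borel \<rightarrow>\<^sub>M subprob_algebra borel"
    by (rule measurable_prob_algebraD[OF K_meas])
  have inner_X: "u \<bullet> X z = u \<bullet> m + adjoint A u \<bullet> z" for u z
    using adjoint_works[OF A, of z u] by (simp add: X_def inner_add_right inner_commute)
  define \<Phi> where "\<Phi> = (\<lambda>(z, z'). P z + (z' - P z'))"
  have [measurable]: "\<Phi> \<in> borel_measurable borel" unfolding \<Phi>_def split_def by measurable
  have resample: "distr (std_gaussian \<Otimes>\<^sub>M std_gaussian) borel \<Phi> = std_gaussian"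
    unfolding \<Phi>_def by (rule distr_std_gaussian_resample[OF P orth[rule_format]])
  have a_res: "adjoint A (coord b j) \<bullet> (z' - P z') = 0" if "j \<noteq> i" for b j z'
    by (simp add: inner_diff_right P_other[rule_format, OF that])
  have other: "coord b j \<bullet> X (\<Phi> (z, z')) = coord b j \<bullet> X z" if "j \<noteq> i" for b j z z'
    using a_res[OF that] by (simp add: \<Phi>_def inner_X inner_add_right P_other[rule_format, OF that])
  have own: "coord b i \<bullet> X (\<Phi> (z, z')) = h b (S True (X z), S False (X z)) z'" for b z z'
  proof -
    have "S c (X z) - S c m = (\<Sum>j\<in>- {i}. adjoint A (coord c j) \<bullet> z)" for c
      by (simp add: S_def inner_X sum.distrib)
    then show ?thesis
      by (simp add: \<Phi>_def inner_X inner_add_right P_i[rule_format] h_def sum.distrib sum_distrib_left)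
  qed
  show ?thesis
  proof (rule that[OF K_meas], intro allI impI)
    fix g :: "'n fundamentals \<Rightarrow> ennreal" and B :: "(real \<times> real) set"
    assume [measurable]: "g \<in> borel_measurable borel" "B \<in> sets borel"
      and g: "\<forall>x y. (\<forall>j. j \<noteq> i \<longrightarrow> fst x $ j = fst y $ j \<and> snd x $ j = snd y $ j) \<longrightarrow> g x = g y"
    have S_eq: "(\<Sum>j\<in>- {i}. fst x $ j, \<Sum>j\<in>- {i}. snd x $ j) = (S True x, S False x)" for x
      by (simp add: S_def inner_coord)
    have i_eq: "(fst x $ i, snd x $ i) = (coord True i \<bullet> x, coord False i \<bullet> x)" for x
      by (simp add: inner_coord)
    have g_eq: "g (X (\<Phi> (z, z'))) = g (X z)" for z z'
      using other[of _ True z z'] other[of _ False z z'] by (intro g[rule_format]) (auto simp: inner_coord)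
    have "(\<integral>\<^sup>+x. g x * indicator B (fst x $ i, snd x $ i) \<partial>F)
        = (\<integral>\<^sup>+z. g (X z) * indicator B (coord True i \<bullet> X z, coord False i \<bullet> X z) \<partial>distr (std_gaussian \<Otimes>\<^sub>M std_gaussian) borel \<Phi>)"
      unfolding resample i_eq F by (subst nn_integral_distr) simp_all
    also have "\<dots> = (\<integral>\<^sup>+p. g (X (\<Phi> p)) * indicator B (coord True i \<bullet> X (\<Phi> p), coord False i \<bullet> X (\<Phi> p))
        \<partial>(std_gaussian \<Otimes>\<^sub>M std_gaussian))"
      by (subst nn_integral_distr) (simp_all add: std_gaussian_pair)
    also have "\<dots> = (\<integral>\<^sup>+z. \<integral>\<^sup>+z'. g (X (\<Phi> (z, z')))
        * indicator B (coord True i \<bullet> X (\<Phi> (z, z')), coord False i \<bullet> X (\<Phi> (z, z'))) \<partial>std_gaussian \<partial>std_gaussian)"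
      by (rule std_gaussian.nn_integral_fst[symmetric]) (simp add: std_gaussian_pair)
    also have "\<dots> = (\<integral>\<^sup>+z. g (X z) * emeasure (K (S True (X z), S False (X z))) B \<partial>std_gaussian)"
    proof (rule nn_integral_cong)
      fix z
      let ?u = "(S True (X z), S False (X z))"
      have "(\<integral>\<^sup>+z'. g (X z) * indicator B (h True ?u z', h False ?u z') \<partial>std_gaussian)
          = g (X z) * (\<integral>\<^sup>+z'. indicator B (h True ?u z', h False ?u z') \<partial>std_gaussian)"
        by (subst nn_integral_cmult) (use h_meas[of ?u] in simp_all)
      also have "(\<integral>\<^sup>+z'. indicator B (h True ?u z', h False ?u z') \<partial>std_gaussian) = (\<integral>\<^sup>+t. indicator B t \<partial>K ?u)"
        unfolding K_def by (subst nn_integral_distr) (use h_meas[of ?u] in simp_all)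
      also have "\<dots> = emeasure (K ?u) B" by (rule nn_integral_indicator) (simp add: K_def)
      finally show "(\<integral>\<^sup>+z'. g (X (\<Phi> (z, z')))
        * indicator B (coord True i \<bullet> X (\<Phi> (z, z')), coord False i \<bullet> X (\<Phi> (z, z'))) \<partial>std_gaussian)
        = g (X z) * emeasure (K ?u) B" by (simp add: own g_eq)
    qed
    also have "\<dots> = (\<integral>\<^sup>+x. g x * emeasure (K (S True x, S False x)) B \<partial>F)"
      unfolding F by (subst nn_integral_distr) simp_all
    finally show "(\<integral>\<^sup>+x. g x * indicator B (fst x $ i, snd x $ i) \<partial>F) =
      (\<integral>\<^sup>+x. g x * emeasure (K (\<Sum>j\<in>- {i}. fst x $ j, \<Sum>j\<in>- {i}. snd x $ j)) B \<partial>F)"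
      by (simp add: S_eq)
  qed
qed

section \<open>Posterior beliefs\<close>

text \<open>Countability lets a single null set serve all events when two kernels are compared.
  Finite intersections of a countable base remain countable, and the empty intersection contributes
  the whole space.\<close>

lemma ex_countable_Int_stable_borel_generator:
  obtains E :: "'a::second_countable_topology set set"
  where "countable E" "Int_stable E" "UNIV \<in> E" "sets borel = sigma_sets UNIV E"
proof -
  obtain B :: "'a set set" where B: "countable B" "topological_basis B"
    using ex_countable_basis by blast
  define E where "E = Inter ` {b. finite b \<and> b \<subseteq> B}"
  have "countable E" unfolding E_def by (intro countable_image countable_Collect_finite_subset B)
  moreover have "Int_stable E"
  proof (rule Int_stableI)
    fix x y assume "x \<in> E" "y \<in> E"
    then obtain a b where "finite a" "a \<subseteq> B" "x = \<Inter>a" "finite b" "b \<subseteq> B" "y = \<Inter>b"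
      by (auto simp: E_def)
    then show "x \<inter> y \<in> E" unfolding E_def by (intro image_eqI[of _ _ "a \<union> b"]) auto
  qed
  moreover have "UNIV \<in> E" unfolding E_def by (intro image_eqI[of _ _ "{}"]) auto
  moreover have "sets borel = sigma_sets UNIV E"
  proof
    have "b \<in> E" if "b \<in> B" for b using that unfolding E_def by (intro image_eqI[of _ _ "{b}"]) auto
    then have "B \<subseteq> E" by blast
    moreover have "sets borel = sigma_sets UNIV B"
      unfolding borel_eq_countable_basis[OF B] by (rule sets_measure_of) simp
    ultimately show "sets borel \<subseteq> sigma_sets UNIV E" by (simp add: sigma_sets_mono')
    have "open x" if "x \<in> E" for x
      using that topological_basis_open[OF B(2)] by (auto simp: E_def intro!: open_Inter)
    then show "sigma_sets UNIV E \<subseteq> sets borel"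
      by (metis borel_open sets.sigma_sets_subset space_borel subsetI)
  qed
  ultimately show ?thesis by (rule that)
qed

text \<open>For each event the two conditional probabilities have the same integral over every A,
  hence agree almost surely, and countably many events determine a measure. Since
  \<open>producer_optimal\<close> admits any version of each posterior, comparisons of belief
  systems rest on this.\<close>

lemma posterior_unique:
  assumes "prob_space M" and Y[measurable]: "Y \<in> M \<rightarrow>\<^sub>M borel"
    and "posterior M Y Z \<kappa>" "posterior M Y Z \<kappa>'"
  shows "AE \<omega> in M. \<kappa> (Y \<omega>) = \<kappa>' (Y \<omega>)"
proof -
  interpret prob_space M by fact
  interpret N: prob_space "distr M borel Y" by (rule prob_space_distr) fact
  note kernels = assms(3,4)[unfolded posterior_def, THEN conjunct1]
  note [measurable] = kernels[THEN measurable_prob_algebraD]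
  obtain E :: "consumer_type set set"
    where E: "countable E" "Int_stable E" "UNIV \<in> E" "sets borel = sigma_sets UNIV E"
    by (rule ex_countable_Int_stable_borel_generator)
  have "AE y in distr M borel Y. \<forall>B\<in>E. emeasure (\<kappa> y) B = emeasure (\<kappa>' y) B"
    unfolding AE_ball_countable[OF E(1)]
  proof
    fix B assume "B \<in> E"
    then have [measurable]: "B \<in> sets borel" unfolding E(4) by (rule sigma_sets.Basic)
    show "AE y in distr M borel Y. emeasure (\<kappa> y) B = emeasure (\<kappa>' y) B"
    proof (rule N.density_unique_finite_measure)
      fix A assume "A \<in> sets (distr M borel Y)"
      then have A: "A \<in> sets borel" by simp
      note post = assms(3,4)[unfolded posterior_def, THEN conjunct2, rule_format, OF A \<open>B \<in> sets borel\<close>]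
      show "(\<integral>\<^sup>+y. emeasure (\<kappa> y) B * indicator A y \<partial>distr M borel Y) =
          (\<integral>\<^sup>+y. emeasure (\<kappa>' y) B * indicator A y \<partial>distr M borel Y)"
        by (rule trans[OF post(1)[symmetric] post(2)])
    qed simp_all
  qed
  then have "AE y in distr M borel Y. \<kappa> y = \<kappa>' y"
  proof (rule AE_mp, intro AE_I2 impI)
    fix y assume eq: "\<forall>B\<in>E. emeasure (\<kappa> y) B = emeasure (\<kappa>' y) B"
    have \<kappa>: "sets (\<kappa> y) = sets borel" "prob_space (\<kappa> y)" "sets (\<kappa>' y) = sets borel"
      using kernels[THEN measurable_space, of y] by (auto simp: space_prob_algebra)
    show "\<kappa> y = \<kappa>' y"
    proof (rule measure_eqI_generator_eq[OF E(2)])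
      show "range (\<lambda>_. UNIV) \<subseteq> E" using E(3) by auto
      show "emeasure (\<kappa> y) UNIV \<noteq> \<infinity>"
        using prob_space.emeasure_space_1[OF \<kappa>(2)] sets_eq_imp_space_eq[OF \<kappa>(1)] by simp
    qed (use eq \<kappa> E(4) in auto)
  qed
  then show ?thesis by (rule AE_distrD[rotated]) simp
qed

lemma posterior_distr_pair:
  assumes "prob_space M" and Y[measurable]: "Y \<in> M \<rightarrow>\<^sub>M borel" and Z[measurable]: "Z \<in> M \<rightarrow>\<^sub>M borel"
    and post: "posterior M Y Z \<kappa>"
  shows "distr M (borel \<Otimes>\<^sub>M borel) (\<lambda>\<omega>. (Y \<omega>, Z \<omega>)) =
    distr M borel Y \<bind> (\<lambda>y. distr (\<kappa> y) (borel \<Otimes>\<^sub>M borel) (Pair y))"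
    and "(\<lambda>y. distr (\<kappa> y) (borel \<Otimes>\<^sub>M borel) (Pair y)) \<in> borel \<rightarrow>\<^sub>M subprob_algebra (borel \<Otimes>\<^sub>M borel)"
proof -
  interpret prob_space M by fact
  have \<kappa>[measurable]: "\<kappa> \<in> borel \<rightarrow>\<^sub>M prob_algebra borel" using post by (simp add: posterior_def)
  note [measurable] = \<kappa>[THEN measurable_prob_algebraD]
  have sets_\<kappa>: "sets (\<kappa> y) = sets borel" for y
    using measurable_space[OF \<kappa>, of y] by (simp add: space_prob_algebra)
  have [measurable]: "Pair y \<in> \<kappa> y \<rightarrow>\<^sub>M borel \<Otimes>\<^sub>M borel" for y
    unfolding measurable_cong_sets[OF sets_\<kappa> refl] by (rule measurable_Pair1') simp
  show kernel[measurable]: "(\<lambda>y. distr (\<kappa> y) (borel \<Otimes>\<^sub>M borel) (Pair y)) \<in> borel \<rightarrow>\<^sub>M subprob_algebra (borel \<Otimes>\<^sub>M borel)"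
    by (rule measurable_distr2[where M=borel]) simp_all
  let ?E = "{a \<times> b | a b. a \<in> sets borel \<and> b \<in> sets borel} :: ('b \<times> consumer_type) set set"
  show "distr M (borel \<Otimes>\<^sub>M borel) (\<lambda>\<omega>. (Y \<omega>, Z \<omega>)) =
    distr M borel Y \<bind> (\<lambda>y. distr (\<kappa> y) (borel \<Otimes>\<^sub>M borel) (Pair y))"
  proof (rule measure_eqI_generator_eq[where E="?E" and \<Omega>=UNIV and A="\<lambda>_. UNIV"])
    show "Int_stable ?E" by (rule Int_stable_pair_measure_generator)
    show "sets (distr M (borel \<Otimes>\<^sub>M borel) (\<lambda>\<omega>. (Y \<omega>, Z \<omega>))) = sigma_sets UNIV ?E"
      by (simp add: sets_pair_measure)
    show "sets (distr M borel Y \<bind> (\<lambda>y. distr (\<kappa> y) (borel \<Otimes>\<^sub>M borel) (Pair y))) = sigma_sets UNIV ?E"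
      by (subst sets_bind[where N="borel \<Otimes>\<^sub>M borel"]) (simp_all add: sets_pair_measure)
    show "range (\<lambda>_. UNIV) \<subseteq> ?E"
      by (auto intro!: exI[of _ UNIV])
    fix X assume "X \<in> ?E"
    then obtain A B where X: "X = A \<times> B" and [measurable]: "A \<in> sets borel" "B \<in> sets borel" by blast
    have "emeasure (distr M (borel \<Otimes>\<^sub>M borel) (\<lambda>\<omega>. (Y \<omega>, Z \<omega>))) X
        = emeasure M {\<omega>\<in>space M. Y \<omega> \<in> A \<and> Z \<omega> \<in> B}"
      by (subst emeasure_distr) (auto simp: X intro!: arg_cong2[where f=emeasure])
    also have "\<dots> = (\<integral>\<^sup>+y. emeasure (\<kappa> y) B * indicator A y \<partial>distr M borel Y)"
      using post by (simp add: posterior_def)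
    also have "\<dots> = (\<integral>\<^sup>+y. emeasure (distr (\<kappa> y) (borel \<Otimes>\<^sub>M borel) (Pair y)) X \<partial>distr M borel Y)"
    proof (rule nn_integral_cong)
      fix y
      have "Pair y -` X \<inter> space (\<kappa> y) = (if y \<in> A then B else {})"
        using sets_eq_imp_space_eq[OF sets_\<kappa>[of y]] by (auto simp: X)
      then show "emeasure (\<kappa> y) B * indicator A y = emeasure (distr (\<kappa> y) (borel \<Otimes>\<^sub>M borel) (Pair y)) X"
        by (subst emeasure_distr) (auto simp: X)
    qed
    also have "\<dots> = emeasure (distr M borel Y \<bind> (\<lambda>y. distr (\<kappa> y) (borel \<Otimes>\<^sub>M borel) (Pair y))) X"
      using kernel by (intro emeasure_bind[where N="borel \<Otimes>\<^sub>M borel", symmetric]) (simp_all add: X)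
    finally show "emeasure (distr M (borel \<Otimes>\<^sub>M borel) (\<lambda>\<omega>. (Y \<omega>, Z \<omega>))) X =
      emeasure (distr M borel Y \<bind> (\<lambda>y. distr (\<kappa> y) (borel \<Otimes>\<^sub>M borel) (Pair y))) X" .
  next
    have "prob_space (distr M (borel \<Otimes>\<^sub>M borel) (\<lambda>\<omega>. (Y \<omega>, Z \<omega>)))"
      by (rule prob_space_distr) simp
    from prob_space.emeasure_space_1[OF this]
    show "emeasure (distr M (borel \<Otimes>\<^sub>M borel) (\<lambda>\<omega>. (Y \<omega>, Z \<omega>))) UNIV \<noteq> \<infinity>"
      by (simp add: space_pair_measure)
  qed auto
qed

lemma posterior_nn_integral:
  assumes "prob_space M" and Y[measurable]: "Y \<in> M \<rightarrow>\<^sub>M borel" and Z[measurable]: "Z \<in> M \<rightarrow>\<^sub>M borel"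
    and post: "posterior M Y Z \<kappa>"
    and f[measurable]: "f \<in> borel_measurable (borel \<Otimes>\<^sub>M borel)"
  shows "(\<integral>\<^sup>+\<omega>. f (Y \<omega>, Z \<omega>) \<partial>M) = (\<integral>\<^sup>+\<omega>. \<integral>\<^sup>+t. f (Y \<omega>, t) \<partial>\<kappa> (Y \<omega>) \<partial>M)"
    and "(\<lambda>y. \<integral>\<^sup>+t. f (y, t) \<partial>\<kappa> y) \<in> borel_measurable borel"
proof -
  have \<kappa>[measurable]: "\<kappa> \<in> borel \<rightarrow>\<^sub>M prob_algebra borel" using post by (simp add: posterior_def)
  note [measurable] = \<kappa>[THEN measurable_prob_algebraD]
  have sets_\<kappa>: "sets (\<kappa> y) = sets borel" for y
    using measurable_space[OF \<kappa>, of y] by (simp add: space_prob_algebra)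
  have Pair_meas: "Pair y \<in> \<kappa> y \<rightarrow>\<^sub>M borel \<Otimes>\<^sub>M borel" for y
    unfolding measurable_cong_sets[OF sets_\<kappa> refl] by (rule measurable_Pair1') simp
  show [measurable]: "(\<lambda>y. \<integral>\<^sup>+t. f (y, t) \<partial>\<kappa> y) \<in> borel_measurable borel"
    by (rule nn_integral_measurable_subprob_algebra2[where N=borel]) simp_all
  have "(\<integral>\<^sup>+\<omega>. f (Y \<omega>, Z \<omega>) \<partial>M) = (\<integral>\<^sup>+p. f p \<partial>distr M (borel \<Otimes>\<^sub>M borel) (\<lambda>\<omega>. (Y \<omega>, Z \<omega>)))"
    by (subst nn_integral_distr) simp_all
  also have "\<dots> = (\<integral>\<^sup>+y. \<integral>\<^sup>+p. f p \<partial>distr (\<kappa> y) (borel \<Otimes>\<^sub>M borel) (Pair y) \<partial>distr M borel Y)"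
    unfolding posterior_distr_pair(1)[OF assms(1-4)]
    by (rule nn_integral_bind[OF f]) (simp add: posterior_distr_pair(2)[OF assms(1-4)])
  also have "\<dots> = (\<integral>\<^sup>+y. \<integral>\<^sup>+t. f (y, t) \<partial>\<kappa> y \<partial>distr M borel Y)"
    by (intro nn_integral_cong nn_integral_distr[OF Pair_meas]) simp
  also have "\<dots> = (\<integral>\<^sup>+\<omega>. \<integral>\<^sup>+t. f (Y \<omega>, t) \<partial>\<kappa> (Y \<omega>) \<partial>M)"
    by (subst nn_integral_distr) simp_all
  finally show "(\<integral>\<^sup>+\<omega>. f (Y \<omega>, Z \<omega>) \<partial>M) = (\<integral>\<^sup>+\<omega>. \<integral>\<^sup>+t. f (Y \<omega>, t) \<partial>\<kappa> (Y \<omega>) \<partial>M)" .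
qed

text \<open>Used in both directions: bounds on the data become bounds on the support of the belief,
  and properties that optimality yields almost surely under the belief become properties of the
  realized type.\<close>

lemma posterior_AE_iff:
  assumes "prob_space M" and Y[measurable]: "Y \<in> M \<rightarrow>\<^sub>M borel" and Z[measurable]: "Z \<in> M \<rightarrow>\<^sub>M borel"
    and post: "posterior M Y Z \<kappa>"
    and P[measurable]: "Measurable.pred (borel \<Otimes>\<^sub>M borel) (\<lambda>(y, t). P y t)"
  shows "(AE \<omega> in M. P (Y \<omega>) (Z \<omega>)) \<longleftrightarrow> (AE \<omega> in M. AE t in \<kappa> (Y \<omega>). P (Y \<omega>) t)"
proof -
  have \<kappa>[measurable]: "\<kappa> \<in> borel \<rightarrow>\<^sub>M prob_algebra borel" using post by (simp add: posterior_def)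
  have sets_\<kappa>: "sets (\<kappa> y) = sets borel" for y
    using measurable_space[OF \<kappa>, of y] by (simp add: space_prob_algebra)
  define f where "f = (\<lambda>p. indicator {p. \<not> P (fst p) (snd p)} p :: ennreal)"
  have f[measurable]: "f \<in> borel_measurable (borel \<Otimes>\<^sub>M borel)"
    using P unfolding f_def by (simp add: split_def)
  have fy: "(\<lambda>t. f (y, t)) \<in> borel_measurable (\<kappa> y)" for y
    unfolding measurable_cong_sets[OF sets_\<kappa> refl]
    by (rule measurable_compose[OF measurable_Pair1' f]) simp
  have "(AE \<omega> in M. P (Y \<omega>) (Z \<omega>)) \<longleftrightarrow> (\<integral>\<^sup>+\<omega>. f (Y \<omega>, Z \<omega>) \<partial>M) = 0"
    by (subst nn_integral_0_iff_AE) (simp_all, simp add: f_def indicator_def)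
  also have "\<dots> \<longleftrightarrow> (AE \<omega> in M. (\<integral>\<^sup>+t. f (Y \<omega>, t) \<partial>\<kappa> (Y \<omega>)) = 0)"
    unfolding posterior_nn_integral(1)[OF assms(1-4) f]
    using posterior_nn_integral(2)[OF assms(1-4) f]
    by (subst nn_integral_0_iff_AE) simp_all
  also have "\<dots> \<longleftrightarrow> (AE \<omega> in M. AE t in \<kappa> (Y \<omega>). P (Y \<omega>) t)"
    unfolding nn_integral_0_iff_AE[OF fy] by (simp add: f_def indicator_def)
  finally show ?thesis .
qed

lemma posterior_integral:
  fixes g :: "'y::topological_space \<Rightarrow> real" and h :: "consumer_type \<Rightarrow> real"
  assumes "prob_space M" and Y[measurable]: "Y \<in> M \<rightarrow>\<^sub>M borel" and Z[measurable]: "Z \<in> M \<rightarrow>\<^sub>M borel"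
    and post: "posterior M Y Z \<kappa>"
    and [measurable]: "g \<in> borel_measurable borel" "h \<in> borel_measurable borel"
    and int: "integrable M (\<lambda>\<omega>. g (Y \<omega>) * h (Z \<omega>))"
    and AE_int: "AE \<omega> in M. integrable (\<kappa> (Y \<omega>)) h"
  shows "(\<integral>\<omega>. g (Y \<omega>) * h (Z \<omega>) \<partial>M) = (\<integral>\<omega>. g (Y \<omega>) * (\<integral>t. h t \<partial>\<kappa> (Y \<omega>)) \<partial>M)"
proof -
  have \<kappa>[measurable]: "\<kappa> \<in> borel \<rightarrow>\<^sub>M prob_algebra borel" using post by (simp add: posterior_def)
  note \<kappa>_sub[measurable] = \<kappa>[THEN measurable_prob_algebraD]
  \<comment> \<open>The sign s = 1 or s = -1 selects the positive or the negative part, so that the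
    disintegration of nonnegative integrals applies to each.\<close>
  define f where "f s p = ennreal (s * (g (fst p) * h (snd p)))" for s :: real and p
  have f[measurable]: "f s \<in> borel_measurable (borel \<Otimes>\<^sub>M borel)" for s unfolding f_def by measurable
  define I where "I s y = (\<integral>\<^sup>+t. f s (y, t) \<partial>\<kappa> y)" for s y
  have [measurable]: "I s \<in> borel_measurable borel" for s
    unfolding I_def by (rule posterior_nn_integral(2)[OF assms(1-4) f])
  have I: "(\<integral>\<^sup>+\<omega>. f s (Y \<omega>, Z \<omega>) \<partial>M) = (\<integral>\<^sup>+\<omega>. I s (Y \<omega>) \<partial>M)" for s
    unfolding I_def by (rule posterior_nn_integral(1)[OF assms(1-4) f])
  have fin: "(\<integral>\<^sup>+\<omega>. I s (Y \<omega>) \<partial>M) < \<infinity>" if "\<bar>s\<bar> = 1" for s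
  proof -
    have "(\<integral>\<^sup>+\<omega>. f s (Y \<omega>, Z \<omega>) \<partial>M) \<le> (\<integral>\<^sup>+\<omega>. norm (g (Y \<omega>) * h (Z \<omega>)) \<partial>M)"
      using that unfolding f_def by (intro nn_integral_mono) (auto intro!: ennreal_leI simp: abs_if split: if_splits)
    also have "\<dots> < \<infinity>" using int by (simp add: integrable_iff_bounded)
    finally show ?thesis by (simp add: I)
  qed
  have fin_AE: "AE \<omega> in M. I s (Y \<omega>) \<noteq> \<infinity>" if "\<bar>s\<bar> = 1" for s
    using fin[OF that] by (intro nn_integral_PInf_AE) (simp_all add: less_top)
  have int_I: "integrable M (\<lambda>\<omega>. enn2real (I s (Y \<omega>)))"
    "(\<integral>\<omega>. enn2real (I s (Y \<omega>)) \<partial>M) = enn2real (\<integral>\<^sup>+\<omega>. I s (Y \<omega>) \<partial>M)" if "\<bar>s\<bar> = 1" for s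
  proof -
    have eq: "(\<integral>\<^sup>+\<omega>. ennreal (enn2real (I s (Y \<omega>))) \<partial>M) = (\<integral>\<^sup>+\<omega>. I s (Y \<omega>) \<partial>M)"
      using fin_AE[OF that] by (intro nn_integral_cong_AE) (auto simp: less_top)
    show "integrable M (\<lambda>\<omega>. enn2real (I s (Y \<omega>)))"
      using fin[OF that] by (intro integrableI_nonneg) (simp_all add: eq)
    show "(\<integral>\<omega>. enn2real (I s (Y \<omega>)) \<partial>M) = enn2real (\<integral>\<^sup>+\<omega>. I s (Y \<omega>) \<partial>M)"
      by (subst integral_eq_nn_integral) (simp_all add: eq)
  qed
  have "(\<integral>\<omega>. g (Y \<omega>) * h (Z \<omega>) \<partial>M)
      = enn2real (\<integral>\<^sup>+\<omega>. f 1 (Y \<omega>, Z \<omega>) \<partial>M) - enn2real (\<integral>\<^sup>+\<omega>. f (-1) (Y \<omega>, Z \<omega>) \<partial>M)"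
    by (subst real_lebesgue_integral_def[OF int]) (simp add: f_def)
  also have "\<dots> = (\<integral>\<omega>. enn2real (I 1 (Y \<omega>)) - enn2real (I (-1) (Y \<omega>)) \<partial>M)"
    by (simp add: I int_I)
  also have "\<dots> = (\<integral>\<omega>. g (Y \<omega>) * (\<integral>t. h t \<partial>\<kappa> (Y \<omega>)) \<partial>M)"
  proof (rule integral_cong_AE)
    have "AE \<omega> in M. enn2real (I 1 (Y \<omega>)) - enn2real (I (-1) (Y \<omega>)) = (\<integral>t. g (Y \<omega>) * h t \<partial>\<kappa> (Y \<omega>))"
      using AE_int
    proof eventually_elim
      case (elim \<omega>)
      then have "integrable (\<kappa> (Y \<omega>)) (\<lambda>t. g (Y \<omega>) * h t)" by simp
      then show ?case by (subst real_lebesgue_integral_def) (simp_all add: I_def f_def)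
    qed
    then show "AE \<omega> in M. enn2real (I 1 (Y \<omega>)) - enn2real (I (-1) (Y \<omega>)) = g (Y \<omega>) * (\<integral>t. h t \<partial>\<kappa> (Y \<omega>))"
      by simp
    show "(\<lambda>\<omega>. g (Y \<omega>) * (\<integral>t. h t \<partial>\<kappa> (Y \<omega>))) \<in> borel_measurable M"
      by (intro borel_measurable_times measurable_compose[OF Y] measurable_compose[OF \<kappa>_sub integral_measurable_subprob_algebra]) simp_all
  qed simp
  finally show ?thesis .
qed

lemma posterior_return:
  assumes "prob_space M" "Y \<in> M \<rightarrow>\<^sub>M borel" "Z \<in> M \<rightarrow>\<^sub>M borel" and post: "posterior M Y Z \<kappa>"
    and [measurable]: "\<phi> \<in> borel \<rightarrow>\<^sub>M borel" and Z: "AE \<omega> in M. Z \<omega> = \<phi> (Y \<omega>)"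
  shows "AE \<omega> in M. \<kappa> (Y \<omega>) = return borel (Z \<omega>)"
proof -
  have \<kappa>: "\<kappa> \<in> borel \<rightarrow>\<^sub>M prob_algebra borel" using post by (simp add: posterior_def)
  have "AE \<omega> in M. AE t in \<kappa> (Y \<omega>). t = \<phi> (Y \<omega>)"
    using Z by (subst posterior_AE_iff[OF assms(1-4), symmetric]) (simp_all add: split_def)
  with Z show ?thesis
  proof eventually_elim
    case (elim \<omega>)
    have "prob_space (\<kappa> (Y \<omega>))" "sets (\<kappa> (Y \<omega>)) = sets borel"
      using measurable_space[OF \<kappa>, of "Y \<omega>"] by (simp_all add: space_prob_algebra)
    with prob_space.AE_eq_constD(1)[OF _ elim(2)] elim(1) show ?case
      by (metis return_sets_cong)
  qed
qed

lemma posterior_cong_AE: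
  assumes "posterior M Y Z \<kappa>" "Y \<in> M \<rightarrow>\<^sub>M borel" "Y' \<in> M \<rightarrow>\<^sub>M borel" "Z \<in> M \<rightarrow>\<^sub>M borel" "AE \<omega> in M. Y \<omega> = Y' \<omega>"
  shows "posterior M Y' Z \<kappa>"
proof -
  note [measurable] = assms(2-4)
  have "distr M borel Y' = distr M borel Y"
    using assms(5) by (intro distr_cong_AE) auto
  moreover have "emeasure M {\<omega>\<in>space M. Y' \<omega> \<in> A \<and> Z \<omega> \<in> B} = emeasure M {\<omega>\<in>space M. Y \<omega> \<in> A \<and> Z \<omega> \<in> B}"
    if [measurable]: "A \<in> sets borel" "B \<in> sets borel" for A B
    using assms(5) by (intro emeasure_eq_AE) auto
  ultimately show ?thesis using assms(1) by (simp add: posterior_def)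
qed

section \<open>The producer's offer\<close>

lemma offer_profit_eq: "offer_profit (p, k) (w, l) = p * max 0 (w - (k - l)\<^sup>2 - p)"
  by (simp add: offer_profit_def demand_eq)

lemma offer_utility_eq: "offer_utility (p, k) (w, l) = (max 0 (w - (k - l)\<^sup>2 - p))\<^sup>2 / 2"
  by (simp add: offer_utility_def demand_eq max_def power2_eq_square)

lemma offer_profit_measurable[measurable]:
  "(\<lambda>p. offer_profit (fst p) (snd p)) \<in> borel_measurable borel"
proof -
  have "offer_profit (fst p) (snd p) = fst (fst p) *
      max 0 (fst (snd p) - (snd (fst p) - snd (snd p))\<^sup>2 - fst (fst p))" for p
    using offer_profit_eq[of "fst (fst p)" "snd (fst p)" "fst (snd p)" "snd (snd p)"] by simp
  then show ?thesis by simp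
qed

lemma offer_utility_measurable[measurable]:
  "(\<lambda>p. offer_utility (fst p) (snd p)) \<in> borel_measurable borel"
proof -
  have *: "offer_utility (fst p) (snd p) =
      (max 0 (fst (snd p) - (snd (fst p) - snd (snd p))\<^sup>2 - fst (fst p)))\<^sup>2 / 2" for p
    using offer_utility_eq[of "fst (fst p)" "snd (fst p)" "fst (snd p)" "snd (snd p)"] by simp
  show ?thesis unfolding * by measurable
qed

lemma offer_profit_measurable1[measurable]: "offer_profit a \<in> borel_measurable borel"
proof -
  have "Pair a \<in> borel \<rightarrow>\<^sub>M (borel :: (offer \<times> consumer_type) measure)"
    unfolding borel_prod[symmetric] by (rule measurable_Pair1') (simp add: space_pair_measure)
  from measurable_compose[OF this offer_profit_measurable] show ?thesis by simp
qed

lemma integrable_offer_profit: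
  assumes "prob_space \<beta>" and sets_\<beta>: "sets \<beta> = sets borel" and w: "AE t in \<beta>. \<bar>fst t\<bar> \<le> R"
  shows "integrable \<beta> (offer_profit a)"
proof -
  interpret prob_space \<beta> by fact
  note [measurable_cong] = sets_\<beta>
  obtain p k where a: "a = (p, k)" by fastforce
  show ?thesis
  proof (rule integrable_const_bound)
    show "AE t in \<beta>. norm (offer_profit a t) \<le> \<bar>p\<bar> * (R + \<bar>p\<bar>)"
      using w
    proof eventually_elim
      case (elim t)
      have "\<bar>max 0 (fst t - (k - snd t)\<^sup>2 - p)\<bar> \<le> R + \<bar>p\<bar>"
        using elim zero_le_power2[of "k - snd t"] by linarith
      then have "\<bar>p\<bar> * \<bar>max 0 (fst t - (k - snd t)\<^sup>2 - p)\<bar> \<le> \<bar>p\<bar> * (R + \<bar>p\<bar>)"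
        by (rule mult_left_mono) simp
      then show ?case by (cases t) (simp add: a offer_profit_eq abs_mult)
    qed
  qed simp
qed

text \<open>This controls the payoffs where the truncation of demand may bind. At a nonnegative
  price, a buyer has both price and quantity at most R. At a negative price no type yields positive
  profit, while the offer (0, 0) guarantees profit zero; so demand vanishes almost surely.\<close>

lemma optimal_offer_bounds:
  assumes "prob_space \<beta>" and sets_\<beta>: "sets \<beta> = sets borel" and w: "AE t in \<beta>. \<bar>fst t\<bar> \<le> R"
    and opt: "is_arg_max (\<lambda>a. \<integral>t. offer_profit a t \<partial>\<beta>) (\<lambda>_. True) a"
  shows "AE t in \<beta>. 0 \<le> offer_profit a t \<and> offer_profit a t \<le> R\<^sup>2 \<and>
    0 \<le> offer_utility a t \<and> offer_utility a t \<le> R\<^sup>2"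
proof -
  interpret prob_space \<beta> by fact
  note [measurable_cong] = sets_\<beta>
  obtain p k where a: "a = (p, k)" by fastforce
  have int: "integrable \<beta> (offer_profit a)" by (rule integrable_offer_profit[OF assms(1-3)])
  have "(\<integral>t. offer_profit (0, 0) t \<partial>\<beta>) \<le> (\<integral>t. offer_profit a t \<partial>\<beta>)"
    using opt by (simp add: is_arg_max_linorder)
  then have J: "0 \<le> (\<integral>t. offer_profit a t \<partial>\<beta>)" by (simp add: offer_profit_def)
  show ?thesis
  proof (cases "0 \<le> p")
    case True
    show ?thesis using w
    proof eventually_elim
      case (elim t)
      define c where "c = fst t - (k - snd t)\<^sup>2 - p"
      have "p * max 0 c \<le> R\<^sup>2 \<and> (max 0 c)\<^sup>2 / 2 \<le> R\<^sup>2"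
      proof (cases "0 < c")
        case c: True
        then have "p \<le> R" "c \<le> R"
          using True elim zero_le_power2[of "k - snd t"] unfolding c_def by linarith+
        moreover from this True c have "p * c \<le> R * R" "c * c \<le> R * R" by (intro mult_mono; simp)+
        ultimately show ?thesis using c
          by (simp add: power2_eq_square) (use zero_le_square[of R] in linarith)
      qed simp
      then show ?case using True by (cases t) (simp add: a offer_profit_eq offer_utility_eq c_def)
    qed
  next
    case False
    have np: "offer_profit a t \<le> 0" for t
      using False by (cases t) (simp add: a offer_profit_eq mult_nonpos_nonneg)
    have "(\<integral>t. - offer_profit a t \<partial>\<beta>) \<le> 0" using J by simp
    moreover have "0 \<le> (\<integral>t. - offer_profit a t \<partial>\<beta>)" using np by (intro integral_nonneg_AE) auto
    ultimately have "(\<integral>t. - offer_profit a t \<partial>\<beta>) = 0" by simp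
    then have "AE t in \<beta>. - offer_profit a t = 0"
      using np int by (subst integral_nonneg_eq_0_iff_AE[symmetric]) auto
    then show ?thesis
    proof eventually_elim
      case (elim t)
      then show ?case using False
        by (cases t) (auto simp: a offer_profit_eq offer_utility_eq)
    qed
  qed
qed

text \<open>
  When the uncertainty is small relative to the gains from trade, the nonnegativity of demand does
  not bind at the optimum and the producer solves the linear-quadratic problem.
\<close>

lemma optimal_offer_interior:
  assumes "prob_space \<beta>" and sets_\<beta>: "sets \<beta> = sets borel"
    and box: "AE t in \<beta>. \<bar>fst t - \<mu>\<bar> \<le> \<eta> \<and> (snd t)\<^sup>2 \<le> \<eta>"
    and \<eta>: "0 < \<eta>" "100 * \<eta> \<le> \<mu>"
    and opt: "is_arg_max (\<lambda>a. \<integral>t. offer_profit a t \<partial>\<beta>) (\<lambda>_. True) (p, k)"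
  defines "\<theta> \<equiv> \<integral>t. snd t \<partial>\<beta>"
  shows "k = \<theta>" "p = ((\<integral>t. fst t \<partial>\<beta>) - ((\<integral>t. (snd t)\<^sup>2 \<partial>\<beta>) - \<theta>\<^sup>2)) / 2"
    "AE t in \<beta>. p \<le> fst t - (k - snd t)\<^sup>2"
proof -
  interpret prob_space \<beta> by fact
  note [measurable_cong] = sets_\<beta>
  have "0 < \<mu>" using \<eta> by simp
  define m where "m = (\<integral>t. fst t \<partial>\<beta>)"
  define V where "V = (\<integral>t. (snd t)\<^sup>2 \<partial>\<beta>) - \<theta>\<^sup>2"
  have abs_snd: "\<bar>y\<bar> \<le> 1 + \<eta>" if "y\<^sup>2 \<le> \<eta>" for y :: real
    using that zero_le_power2[of "y - 1"] zero_le_power2[of "y + 1"] \<eta>(1)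
    by (auto simp: power2_eq_square algebra_simps abs_le_iff)
  have AE_fst: "AE t in \<beta>. \<bar>fst t\<bar> \<le> \<mu> + \<eta>" "AE t in \<beta>. \<mu> - \<eta> \<le> fst t" "AE t in \<beta>. fst t \<le> \<mu> + \<eta>"
    and AE_snd: "AE t in \<beta>. \<bar>snd t\<bar> \<le> 1 + \<eta>" "AE t in \<beta>. (snd t)\<^sup>2 \<le> \<eta>"
    by (rule AE_mp[OF box], rule AE_I2, use abs_snd \<eta> in \<open>force simp: abs_le_iff\<close>)+
  have int_fst: "integrable \<beta> fst"
    by (rule integrable_const_bound[where B="\<mu> + \<eta>"]) (use AE_fst in simp_all)
  have int_snd: "integrable \<beta> snd"
    by (rule integrable_const_bound[where B="1 + \<eta>"]) (use AE_snd in simp_all)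
  have int_snd2: "integrable \<beta> (\<lambda>t. (snd t)\<^sup>2)"
    by (rule integrable_const_bound[where B="\<eta>"]) (use AE_snd in simp_all)
  note ints = int_fst int_snd int_snd2
  have m: "\<mu> - \<eta> \<le> m" "m \<le> \<mu> + \<eta>"
    unfolding m_def using AE_fst by (simp_all add: integral_ge_const[OF int_fst] integral_le_const[OF int_fst])
  have quad: "(\<integral>t. (y - snd t)\<^sup>2 \<partial>\<beta>) = (y - \<theta>)\<^sup>2 + V" for y
    by (simp add: power2_diff ints prob_space V_def \<theta>_def algebra_simps)
  have int_quad: "integrable \<beta> (\<lambda>t. (y - snd t)\<^sup>2)" for y
    by (simp add: power2_diff ints)
  have "0 \<le> V"
  proof -
    have "0 \<le> (\<integral>t. (\<theta> - snd t)\<^sup>2 \<partial>\<beta>)" by (intro integral_nonneg_AE) simp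
    then show ?thesis by (simp add: quad)
  qed
  have E_snd2: "(\<integral>t. (snd t)\<^sup>2 \<partial>\<beta>) \<le> \<eta>"
    using AE_snd(2) by (rule integral_le_const[OF int_snd2])
  have "V \<le> \<eta>" using E_snd2 zero_le_power2[of \<theta>] unfolding V_def by linarith
  have "\<theta>\<^sup>2 \<le> \<eta>" using \<open>0 \<le> V\<close> E_snd2 by (simp add: V_def)
  have int_A: "(\<integral>t. y * (fst t - (z - snd t)\<^sup>2 - y) \<partial>\<beta>) = y * (m - (z - \<theta>)\<^sup>2 - V - y)" for y z
    by (simp add: ints int_quad quad prob_space m_def[symmetric])
  have sq2: "(y - z)\<^sup>2 \<le> 2 * y\<^sup>2 + 2 * z\<^sup>2" for y z :: real
    using zero_le_power2[of "y + z"] by (simp add: power2_sum power2_diff)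
  have untruncated: "(\<integral>t. offer_profit (y, z) t \<partial>\<beta>) = y * (m - (z - \<theta>)\<^sup>2 - V - y)"
    if "AE t in \<beta>. y \<le> fst t - (z - snd t)\<^sup>2" for y z
  proof -
    have "(\<integral>t. offer_profit (y, z) t \<partial>\<beta>) = (\<integral>t. y * (fst t - (z - snd t)\<^sup>2 - y) \<partial>\<beta>)"
      using that by (intro integral_cong_AE) (auto simp: offer_profit_eq split_beta elim!: AE_mp)
    then show ?thesis unfolding int_A .
  qed
  \<comment> \<open>Maximizer of the untruncated profit \<open>y * (m - V - y)\<close> at
    characteristic \<open>\<theta>\<close>. It lies near \<open>\<mu> / 2\<close>, so all types in
    the box buy, and its value \<open>p0\<^sup>2\<close> is a benchmark for the optimum.\<close>
  define p0 where "p0 = (m - V) / 2"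
  have p0: "(\<mu> - 2 * \<eta>) / 2 \<le> p0" "p0 \<le> (\<mu> + \<eta>) / 2"
    using m \<open>0 \<le> V\<close> \<open>V \<le> \<eta>\<close> by (simp_all add: p0_def)
  have "AE t in \<beta>. p0 \<le> fst t - (\<theta> - snd t)\<^sup>2"
    using box
  proof eventually_elim
    case (elim t)
    then show ?case using sq2[of \<theta> "snd t"] \<open>\<theta>\<^sup>2 \<le> \<eta>\<close> p0(2) \<eta> by (simp add: abs_le_iff)
  qed
  from untruncated[OF this] have "(\<integral>t. offer_profit (p0, \<theta>) t \<partial>\<beta>) = p0\<^sup>2"
    by (simp add: p0_def power2_eq_square field_simps)
  then have opt_p0: "p0\<^sup>2 \<le> (\<integral>t. offer_profit (p, k) t \<partial>\<beta>)"
    using opt unfolding is_arg_max_linorder by metis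
  have "0 < p0" using p0 \<eta> by simp
  have "0 < p"
  proof (rule ccontr)
    assume "\<not> 0 < p"
    then have "(\<integral>t. offer_profit (p, k) t \<partial>\<beta>) \<le> 0"
      using integrable_offer_profit[OF assms(1,2) AE_fst(1)]
      by (intro integral_le_const) (auto simp: offer_profit_eq split_beta mult_nonpos_nonneg)
    with opt_p0 \<open>0 < p0\<close> show False by (smt (verit) zero_less_power)
  qed
  \<comment> \<open>Since \<open>p0\<close> is at least \<open>(\<mu> - 2 * \<eta>) / 2\<close>, the
    constant 3 puts c strictly below the benchmark. The average profit then exceeds c, so some type
    t of the box yields more than c; this one type locates p and k.\<close>
  define c where "c = ((\<mu> - 3 * \<eta>) / 2)\<^sup>2"
  have "c < p0\<^sup>2" unfolding c_def using p0(1) \<eta> by (intro power_strict_mono) auto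
  obtain t where t: "\<bar>fst t - \<mu>\<bar> \<le> \<eta>" "(snd t)\<^sup>2 \<le> \<eta>" "c < offer_profit (p, k) t"
  proof (rule ccontr)
    assume "\<not> thesis"
    with that have "\<bar>fst t - \<mu>\<bar> \<le> \<eta> \<and> (snd t)\<^sup>2 \<le> \<eta> \<Longrightarrow> offer_profit (p, k) t \<le> c" for t
      by (meson not_le)
    with box have "AE t in \<beta>. offer_profit (p, k) t \<le> c" by (rule eventually_mono)
    then have "(\<integral>t. offer_profit (p, k) t \<partial>\<beta>) \<le> c"
      by (rule integral_le_const[OF integrable_offer_profit[OF assms(1,2) AE_fst(1)]])
    with opt_p0 \<open>c < p0\<^sup>2\<close> show False by simp
  qed
  define a where "a = fst t - (k - snd t)\<^sup>2"
  have "0 \<le> c" by (simp add: c_def)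
  have pa: "c < p * (a - p)" "p < a"
  proof -
    have "c < p * max 0 (a - p)" using t(3) by (cases t) (simp add: offer_profit_eq a_def)
    moreover from this have "0 < p * max 0 (a - p)" using \<open>0 \<le> c\<close> by linarith
    then have "0 < max 0 (a - p)" using \<open>0 < p\<close> by (rule zero_less_mult_pos)
    then show "p < a" by (simp add: less_max_iff_disj)
    ultimately show "c < p * (a - p)" by (simp add: max_absorb2)
  qed
  \<comment> \<open>Completing the square: profit above c at type t forces a to be close to its
    upper bound \<open>\<mu> + \<eta>\<close> and p to be close to a / 2.\<close>
  have c_less: "c < (a / 2)\<^sup>2 - (p - a / 2)\<^sup>2"
    using pa(1) by (simp add: power2_eq_square field_simps)
  then have "c < (a / 2)\<^sup>2" using zero_le_power2[of "p - a / 2"] by linarith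
  then have a_gt: "\<mu> - 3 * \<eta> < a"
    using power2_less_imp_less[of "(\<mu> - 3 * \<eta>) / 2" "a / 2"] pa(2) \<open>0 < p\<close> by (simp add: c_def)
  have a_le: "a \<le> \<mu> + \<eta>" using t(1) zero_le_power2[of "k - snd t"] unfolding a_def by linarith
  have "(a / 2)\<^sup>2 \<le> ((\<mu> + \<eta>) / 2)\<^sup>2" using a_le pa(2) \<open>0 < p\<close> by (intro power_mono) simp_all
  then have "(p - a / 2)\<^sup>2 < ((\<mu> + \<eta>) / 2)\<^sup>2 - c" using c_less by linarith
  also have "\<dots> \<le> 2 * \<mu> * \<eta>" using \<eta>(1) by (simp add: c_def power2_eq_square field_simps)
  also have "\<dots> \<le> (\<mu> / 4)\<^sup>2"
    using mult_left_mono[OF \<eta>(2), of \<mu>] \<open>0 < \<mu>\<close> by (simp add: power2_eq_square field_simps)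
  finally have "p - a / 2 < \<mu> / 4" using \<open>0 < \<mu>\<close> by (intro power2_less_imp_less[of "p - a / 2"]) simp_all
  \<comment> \<open>17 = 16 + 1. For any s in the box, \<open>(k - snd s)\<^sup>2\<close> is at most
    2 * 4 \<eta> + 2 * 4 \<eta> by \<open>k_near\<close> and the bound on locations, and
    \<open>fst s\<close> is at least \<open>\<mu> - \<eta>\<close>.\<close>
  then have p_le: "p \<le> \<mu> - 17 * \<eta>" using a_le \<eta> by simp
  have k_near: "(k - snd t)\<^sup>2 \<le> 4 * \<eta>" using a_gt t(1) unfolding a_def by linarith
  show A: "AE t in \<beta>. p \<le> fst t - (k - snd t)\<^sup>2"
    using box
  proof eventually_elim
    case (elim s)
    have "(k - snd s)\<^sup>2 \<le> 2 * (k - snd t)\<^sup>2 + 2 * (snd s - snd t)\<^sup>2"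
      using sq2[of "k - snd t" "snd s - snd t"] by simp
    with sq2[of "snd s" "snd t"] k_near t(2) elim p_le show ?case by linarith
  qed
  \<comment> \<open>Now that no type is truncated, the offer falls short of the benchmark by exactly
    (p - p0)^2 + p d. Optimality makes this nonpositive, and p > 0, so both terms vanish.\<close>
  define d where "d = (k - \<theta>)\<^sup>2"
  have "p0\<^sup>2 \<le> p * (2 * p0 - d - p)"
    using opt_p0 untruncated[OF A] by (simp add: p0_def d_def algebra_simps)
  then have le: "(p - p0)\<^sup>2 + p * d \<le> 0" by (simp add: power2_eq_square algebra_simps)
  moreover have "0 \<le> p * d" using \<open>0 < p\<close> by (simp add: d_def)
  ultimately have "(p - p0)\<^sup>2 = 0" "p * d = 0" using zero_le_power2[of "p - p0"] by linarith+
  then show "k = \<theta>" "p = ((\<integral>t. fst t \<partial>\<beta>) - ((\<integral>t. (snd t)\<^sup>2 \<partial>\<beta>) - \<theta>\<^sup>2)) / 2"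
    using \<open>0 < p\<close> by (simp_all add: p0_def d_def m_def V_def)
qed

section \<open>Data and beliefs in the market\<close>

lemma borel_measurable_vec_nth[measurable (raw)]:
  fixes f :: "'a \<Rightarrow> real ^ 'n"
  shows "f \<in> borel_measurable M \<Longrightarrow> (\<lambda>x. f x $ j) \<in> borel_measurable M"
  using borel_measurable_inner[of f M "\<lambda>_. axis j 1"] by (simp add: inner_axis)

lemma set_permutation_law:
  "set_pmf (permutation_law linked S) = (if linked then {(\<delta>, \<delta>) |\<delta>. \<delta> permutes S}
     else {\<delta>. \<delta> permutes S} \<times> {\<delta>. \<delta> permutes S})"
proof -
  have "finite {\<delta>. \<delta> permutes S}" "{\<delta>. \<delta> permutes S} \<noteq> {}"
    using permutes_id[of S] by (blast intro: finite_permutations finite)+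
  then show ?thesis by (auto simp: permutation_law_def Let_def)
qed

lemma permutation_law_permutes:
  "(\<delta>, \<epsilon>) \<in> set_pmf (permutation_law linked S) \<Longrightarrow> \<delta> permutes S \<and> \<epsilon> permutes S"
  by (auto simp: set_permutation_law split: if_splits)

text \<open>Each fixed permutation, applied to both components, has positive probability whether or
  not the shuffles are linked. The comparison of permuted data sets uses only such pairs and so
  covers both conventions.\<close>

lemma diagonal_in_permutation_law:
  "\<delta> permutes S \<Longrightarrow> (\<delta>, \<delta>) \<in> set_pmf (permutation_law linked S)"
  by (auto simp: set_permutation_law)

lemma signal_eq:
  "signal X S (x, d) = (dataset (fst X) S (fst d) (fst x), dataset (snd X) S (snd d) (snd x))"
  by (cases X, cases x, cases d) simp

lemma ctype_eq: "ctype i (x, d) = (fst x $ i, snd x $ i)"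
  by (cases x) simp

lemma linear_dataset: "linear (dataset c S \<delta>)"
  by (rule linearI) (simp_all add: dataset_def vec_eq_iff split: collection.split)

lemma producer_optimalD:
  assumes "producer_optimal linked F r \<kappa>"
  shows "optimal_rule r" "posterior (state_law linked F S) (signal X S) (ctype i) (\<kappa> X S i)"
    "\<kappa> X S i \<in> borel \<rightarrow>\<^sub>M prob_algebra borel"
  using assms unfolding producer_optimal_def posterior_def by blast+

lemma measurable_offer_belief:
  assumes "optimal_rule r" and "\<kappa> \<in> borel \<rightarrow>\<^sub>M prob_algebra borel"
  shows "(\<lambda>y. r (\<kappa> y)) \<in> borel \<rightarrow>\<^sub>M borel"
  using assms by (intro measurable_compose[OF assms(2)]) (simp add: optimal_rule_def)

context
  fixes F :: "'n::finite fundamentals measure"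
  assumes F: "prob_space F" and sets_F: "sets F = sets borel"
begin

lemma sets_state_law: "sets (state_law linked F S) = sets (borel \<Otimes>\<^sub>M count_space UNIV)"
  unfolding state_law_def by (intro sets_pair_measure_cong) (simp_all add: sets_F)

lemma space_state_law: "space (state_law linked F S) = UNIV"
  using sets_eq_imp_space_eq[OF sets_F] by (simp add: state_law_def space_pair_measure)

lemma prob_space_state_law: "prob_space (state_law linked F S)"
  unfolding state_law_def by (intro prob_space_pair F prob_space_measure_pmf)

text \<open>There are only finitely many permutations, so measurability can be checked with the pair
  of permutations held fixed.\<close>

lemma measurable_state_lawI:
  assumes "\<And>d. (\<lambda>x. f (x, d)) \<in> borel \<rightarrow>\<^sub>M N"
  shows "f \<in> state_law linked F S \<rightarrow>\<^sub>M N"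
proof -
  have "(\<lambda>p. f (snd p, fst p)) \<in> count_space UNIV \<Otimes>\<^sub>M borel \<rightarrow>\<^sub>M N"
    by (rule measurable_pair_measure_countable1) (simp_all add: assms countable_finite)
  from measurable_compose[OF measurable_pair_swap' this]
  show ?thesis by (simp add: measurable_cong_sets[OF sets_state_law refl] split_def)
qed

lemma measurable_signal: "signal X S \<in> state_law linked F S' \<rightarrow>\<^sub>M borel"
proof (rule measurable_state_lawI)
  fix d :: "('n \<Rightarrow> 'n) \<times> ('n \<Rightarrow> 'n)"
  have [measurable]: "dataset c S \<delta> \<in> borel_measurable borel" for c and \<delta> :: "'n \<Rightarrow> 'n"
    by (rule borel_measurable_linear[OF linear_dataset])
  show "(\<lambda>x. signal X S (x, d)) \<in> borel \<rightarrow>\<^sub>M borel"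
    unfolding signal_eq by measurable
qed

lemma measurable_ctype: "ctype i \<in> state_law linked F S \<rightarrow>\<^sub>M borel"
  by (rule measurable_state_lawI) (simp add: ctype_eq)

lemma measurable_fst_state_law: "fst \<in> state_law linked F S \<rightarrow>\<^sub>M borel"
  by (rule measurable_state_lawI) simp

lemma AE_state_lawD:
  assumes "AE \<omega> in state_law linked F S. P \<omega>" and "d \<in> set_pmf (permutation_law linked S)"
  shows "AE x in F. P (x, d)"
proof -
  interpret F: prob_space F by (rule F)
  interpret pair_sigma_finite F "measure_pmf (permutation_law linked S)" ..
  have "AE x in F. AE d in measure_pmf (permutation_law linked S). P (x, d)"
    using assms(1) unfolding state_law_def by (rule AE_pair)
  then show ?thesis by eventually_elim (use assms(2) in \<open>simp add: AE_measure_pmf_iff\<close>)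
qed

lemma AE_state_law_fst:
  assumes "AE x in F. P x" shows "AE \<omega> in state_law linked F S. P (fst \<omega>)"
proof -
  have "AE x in distr (state_law linked F S) F fst. P x"
    using assms unfolding state_law_def prob_space.distr_pair_fst[OF prob_space_measure_pmf] .
  then show ?thesis by (rule AE_distrD[rotated]) (simp add: state_law_def)
qed

lemma AE_state_law_snd: "AE \<omega> in state_law linked F S. snd \<omega> \<in> set_pmf (permutation_law linked S)"
proof -
  interpret F: prob_space F by (rule F)
  interpret pair_sigma_finite F "measure_pmf (permutation_law linked S)" ..
  show ?thesis unfolding state_law_def
    by (rule AE_pair_measure) (auto simp: AE_measure_pmf_iff split_def)
qed

lemma nn_integral_state_law:
  assumes "f \<in> borel_measurable (state_law linked F S)"
  shows "(\<integral>\<^sup>+\<omega>. f \<omega> \<partial>state_law linked F S) = (\<integral>\<^sup>+d. \<integral>\<^sup>+x. f (x, d) \<partial>F \<partial>measure_pmf (permutation_law linked S))"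
proof -
  interpret F: prob_space F by (rule F)
  interpret pair_sigma_finite F "measure_pmf (permutation_law linked S)" ..
  show ?thesis using assms unfolding state_law_def by (rule nn_integral_snd[symmetric])
qed

text \<open>With the permutations held fixed, an event about the signal is a test function of the
  others' data, to which the conditional-law identity applies. The permutations move only the
  others, so their sums can be computed from the signal.\<close>

lemma posterior_others:
  fixes X :: policy
  assumes K[measurable]: "K \<in> borel \<rightarrow>\<^sub>M prob_algebra borel"
    and cond: "\<forall>(g :: _ \<Rightarrow> ennreal) B. g \<in> borel_measurable borel \<longrightarrow>
      (\<forall>x y. (\<forall>j. j \<noteq> i \<longrightarrow> fst x $ j = fst y $ j \<and> snd x $ j = snd y $ j) \<longrightarrow> g x = g y) \<longrightarrow>
      B \<in> sets borel \<longrightarrow>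
      (\<integral>\<^sup>+x. g x * indicator B (fst x $ i, snd x $ i) \<partial>F) =
      (\<integral>\<^sup>+x. g x * emeasure (K (\<Sum>j\<in>- {i}. fst x $ j, \<Sum>j\<in>- {i}. snd x $ j)) B \<partial>F)"
  defines "s \<equiv> \<lambda>x :: 'n fundamentals. (\<Sum>j\<in>- {i}. fst x $ j, \<Sum>j\<in>- {i}. snd x $ j)"
  shows "posterior (state_law linked F (UNIV - {i})) (signal X (UNIV - {i})) (ctype i) (\<lambda>y. K (s y))"
    and "AE \<omega> in state_law linked F (UNIV - {i}). s (signal X (UNIV - {i}) \<omega>) = s (fst \<omega>)"
proof -
  let ?S = "UNIV - {i}"
  let ?M = "state_law linked F ?S"
  note Y[measurable] = measurable_signal[of X ?S linked ?S]
  note Z[measurable] = measurable_ctype[of i linked ?S]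
  have [measurable]: "s \<in> borel_measurable borel" unfolding s_def by measurable
  note [measurable] = K[THEN measurable_prob_algebraD]
  have s_signal: "s (signal X ?S (x, d)) = s x" if "d \<in> set_pmf (permutation_law linked ?S)" for x d
  proof -
    have perm: "fst d permutes - {i}" "snd d permutes - {i}"
      using permutation_law_permutes[of "fst d" "snd d" linked ?S] that by (simp_all add: Compl_eq_Diff_UNIV)
    have "(\<Sum>j\<in>- {i}. dataset c ?S \<delta> v $ j) = (\<Sum>j\<in>- {i}. v $ j)" if "\<delta> permutes - {i}" for c \<delta> and v :: "real ^ 'n"
    proof (cases c)
      case Anonymized
      then show ?thesis using sum.permute[OF that, of "\<lambda>j. v $ j"] by (simp add: dataset_def comp_def)
    qed (simp add: dataset_def)
    with perm show ?thesis by (simp add: s_def signal_eq)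
  qed
  show "AE \<omega> in ?M. s (signal X ?S \<omega>) = s (fst \<omega>)"
    using AE_state_law_snd[of linked ?S] by eventually_elim (metis prod.collapse s_signal)
  show "posterior ?M (signal X ?S) (ctype i) (\<lambda>y. K (s y))"
    unfolding posterior_def
  proof (intro conjI ballI)
    fix A :: "'n fundamentals set" and B :: "consumer_type set"
    assume [measurable]: "A \<in> sets borel" and B[measurable]: "B \<in> sets borel"
    have "emeasure ?M {\<omega>\<in>space ?M. signal X ?S \<omega> \<in> A \<and> ctype i \<omega> \<in> B}
        = (\<integral>\<^sup>+\<omega>. indicator A (signal X ?S \<omega>) * indicator B (ctype i \<omega>) \<partial>?M)"
    proof -
      let ?E = "{\<omega>\<in>space ?M. signal X ?S \<omega> \<in> A \<and> ctype i \<omega> \<in> B}"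
      have "(\<integral>\<^sup>+\<omega>. indicator A (signal X ?S \<omega>) * indicator B (ctype i \<omega>) \<partial>?M) = (\<integral>\<^sup>+\<omega>. indicator ?E \<omega> \<partial>?M)"
        by (intro nn_integral_cong) (simp add: space_state_law indicator_def)
      also have "\<dots> = emeasure ?M ?E" by (rule nn_integral_indicator) measurable
      finally show ?thesis by (rule sym)
    qed
    also have "\<dots> = (\<integral>\<^sup>+d. \<integral>\<^sup>+x. indicator A (signal X ?S (x, d)) * indicator B (ctype i (x, d)) \<partial>F
        \<partial>measure_pmf (permutation_law linked ?S))"
      by (rule nn_integral_state_law) simp
    also have "\<dots> = (\<integral>\<^sup>+d. \<integral>\<^sup>+x. indicator A (signal X ?S (x, d)) * emeasure (K (s (signal X ?S (x, d)))) B \<partial>F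
        \<partial>measure_pmf (permutation_law linked ?S))"
    proof (intro nn_integral_cong_AE, unfold AE_measure_pmf_iff, intro ballI)
      fix d assume d: "d \<in> set_pmf (permutation_law linked ?S)"
      have perm: "fst d permutes ?S" "snd d permutes ?S"
        using permutation_law_permutes[of "fst d" "snd d" linked ?S] d by simp_all
      define g where "g x = (indicator A (signal X ?S (x, d)) :: ennreal)" for x
      have [measurable]: "dataset c ?S \<delta> \<in> borel_measurable borel" for c and \<delta> :: "'n \<Rightarrow> 'n"
        by (rule borel_measurable_linear[OF linear_dataset])
      have "g \<in> borel_measurable borel" unfolding g_def signal_eq by measurable
      moreover have "g x = g y" if "\<forall>j. j \<noteq> i \<longrightarrow> fst x $ j = fst y $ j \<and> snd x $ j = snd y $ j" for x y
      proof -
        have ds: "dataset c ?S \<delta> v = dataset c ?S \<delta> v'"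
          if "\<delta> permutes ?S" "\<forall>j. j \<noteq> i \<longrightarrow> v $ j = v' $ j" for c \<delta> and v v' :: "real ^ 'n"
          using that permutes_in_image[OF that(1)] by (auto simp: dataset_def vec_eq_iff split: collection.split)
        have "dataset (fst X) ?S (fst d) (fst x) = dataset (fst X) ?S (fst d) (fst y)"
          "dataset (snd X) ?S (snd d) (snd x) = dataset (snd X) ?S (snd d) (snd y)"
          by (rule ds; use perm that in simp)+
        then show ?thesis by (simp add: g_def signal_eq)
      qed
      ultimately have "(\<integral>\<^sup>+x. g x * indicator B (fst x $ i, snd x $ i) \<partial>F) = (\<integral>\<^sup>+x. g x * emeasure (K (s x)) B \<partial>F)"
        using cond[rule_format, of g B] B by (simp add: s_def)
      then show "(\<integral>\<^sup>+x. indicator A (signal X ?S (x, d)) * indicator B (ctype i (x, d)) \<partial>F) =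
          (\<integral>\<^sup>+x. indicator A (signal X ?S (x, d)) * emeasure (K (s (signal X ?S (x, d)))) B \<partial>F)"
        by (simp add: g_def s_signal[OF d] ctype_eq)
    qed
    also have "\<dots> = (\<integral>\<^sup>+\<omega>. indicator A (signal X ?S \<omega>) * emeasure (K (s (signal X ?S \<omega>))) B \<partial>?M)"
      by (rule nn_integral_state_law[symmetric]) simp
    also have "\<dots> = (\<integral>\<^sup>+y. emeasure (K (s y)) B * indicator A y \<partial>distr ?M borel (signal X ?S))"
      by (subst nn_integral_distr) (simp_all add: mult.commute)
    finally show "emeasure ?M {\<omega>\<in>space ?M. signal X ?S \<omega> \<in> A \<and> ctype i \<omega> \<in> B} =
      (\<integral>\<^sup>+y. emeasure (K (s y)) B * indicator A y \<partial>distr ?M borel (signal X ?S))" .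
  qed simp
qed

text \<open>The rule breaks ties as a function of the belief alone, so equal beliefs give equal
  offers even where the optimum is not unique.\<close>

lemma payoffs_cong_belief:
  assumes "producer_optimal linked F r \<kappa>"
    and eq: "AE \<omega> in state_law linked F S. \<kappa> X S i (signal X S \<omega>) = \<kappa> X' S i (signal X' S \<omega>)"
  shows "consumer_utility linked F r \<kappa> X S i = consumer_utility linked F r \<kappa> X' S i"
    and "producer_profit linked F r \<kappa> X S i = producer_profit linked F r \<kappa> X' S i"
proof -
  have meas: "(\<lambda>\<omega>. (r (\<kappa> X S i (signal X S \<omega>)), ctype i \<omega>)) \<in> state_law linked F S \<rightarrow>\<^sub>M borel" for X
  proof -
    have "(\<lambda>y. r (\<kappa> X S i y)) \<in> borel \<rightarrow>\<^sub>M borel"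
      by (intro measurable_offer_belief producer_optimalD[OF assms(1)])
    from measurable_compose[OF measurable_signal this] measurable_ctype
    show ?thesis by (rule borel_measurable_Pair)
  qed
  show "consumer_utility linked F r \<kappa> X S i = consumer_utility linked F r \<kappa> X' S i"
    unfolding consumer_utility_def
    using measurable_compose[OF meas offer_utility_measurable] eq
    by (intro integral_cong_AE) (auto elim!: AE_mp)
  show "producer_profit linked F r \<kappa> X S i = producer_profit linked F r \<kappa> X' S i"
    unfolding producer_profit_def
    using measurable_compose[OF meas offer_profit_measurable] eq
    by (intro integral_cong_AE) (auto elim!: AE_mp)
qed

text \<open>The empty data sets coincide, but \<kappa> may use different versions of the posterior
  for different policies; hence the appeal to uniqueness up to null sets.\<close>

lemma producer_profit_no_information:
  assumes opt: "producer_optimal linked F r \<kappa>"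
  shows "producer_profit linked F r \<kappa> X {} i = producer_profit linked F r \<kappa> X' {} i"
proof (rule payoffs_cong_belief[OF opt])
  have eq: "signal X {} = signal X' {}"
    by (auto simp: fun_eq_iff signal_eq dataset_def)
  have "posterior (state_law linked F {}) (signal X {}) (ctype i) (\<kappa> X {} i)"
    "posterior (state_law linked F {}) (signal X {}) (ctype i) (\<kappa> X' {} i)"
    using producer_optimalD(2)[OF opt] by (simp, metis eq)
  from posterior_unique[OF prob_space_state_law measurable_signal this]
  show "AE \<omega> in state_law linked F {}. \<kappa> X {} i (signal X {} \<omega>) = \<kappa> X' {} i (signal X' {} \<omega>)"
    by (simp add: eq)
qed

end

text \<open>
  The belief about consumer \<open>i\<close> formed from the data of the others depends on these data only
  through their sums, which anonymization preserves.
\<close>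

lemma consumer_utility_others:
  assumes "gaussian F" "symmetric_consumers F" and opt: "producer_optimal linked F r \<kappa>"
  shows "consumer_utility linked F r \<kappa> X (UNIV - {i}) i = consumer_utility linked F r \<kappa> X' (UNIV - {i}) i"
proof -
  note F = prob_space_gaussian[OF assms(1)] sets_gaussian[OF assms(1)]
  let ?S = "UNIV - {i}"
  let ?M = "state_law linked F ?S"
  obtain K where K: "K \<in> borel \<rightarrow>\<^sub>M prob_algebra borel"
    and cond: "\<forall>(g :: _ \<Rightarrow> ennreal) B. g \<in> borel_measurable borel \<longrightarrow>
      (\<forall>x y. (\<forall>j. j \<noteq> i \<longrightarrow> fst x $ j = fst y $ j \<and> snd x $ j = snd y $ j) \<longrightarrow> g x = g y) \<longrightarrow>
      B \<in> sets borel \<longrightarrow>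
      (\<integral>\<^sup>+x. g x * indicator B (fst x $ i, snd x $ i) \<partial>F) =
      (\<integral>\<^sup>+x. g x * emeasure (K (\<Sum>j\<in>- {i}. fst x $ j, \<Sum>j\<in>- {i}. snd x $ j)) B \<partial>F)"
    by (rule symmetric_gaussian_conditional[OF assms(1,2), of i])
  define s where "s x = (\<Sum>j\<in>- {i}. fst x $ j, \<Sum>j\<in>- {i}. snd x $ j)" for x :: "'a fundamentals"
  have bel: "AE \<omega> in ?M. \<kappa> X ?S i (signal X ?S \<omega>) = K (s (fst \<omega>))" for X
  proof -
    have "posterior ?M (signal X ?S) (ctype i) (\<kappa> X ?S i)"
      by (rule producer_optimalD(2)[OF opt])
    from posterior_unique[OF prob_space_state_law[OF F] measurable_signal[OF F] this
        posterior_others(1)[OF F K cond, folded s_def]]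
      posterior_others(2)[OF F K cond, folded s_def, where X=X and linked=linked]
    show ?thesis by eventually_elim simp
  qed
  show ?thesis
  proof (rule payoffs_cong_belief(1)[OF F opt])
    show "AE \<omega> in ?M. \<kappa> X ?S i (signal X ?S \<omega>) = \<kappa> X' ?S i (signal X' ?S \<omega>)"
      using bel[of X] bel[of X'] by eventually_elim simp
  qed
qed

section \<open>Translation of the mean willingness to pay\<close>

definition raise_belief :: "real \<Rightarrow> belief \<Rightarrow> belief" where
  "raise_belief \<mu> \<beta> = distr \<beta> borel (\<lambda>t. (\<mu> + fst t, snd t))"

lemma raise_belief_measurable[measurable]: "raise_belief \<mu> \<in> prob_algebra borel \<rightarrow>\<^sub>M prob_algebra borel"
  unfolding raise_belief_def[abs_def] by (rule measurable_distr_prob_space) simp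

lemma raise_belief_raise_belief:
  assumes "sets \<beta> = sets borel" shows "raise_belief \<mu> (raise_belief \<nu> \<beta>) = raise_belief (\<mu> + \<nu>) \<beta>"
proof -
  note [measurable_cong] = assms
  show ?thesis unfolding raise_belief_def by (subst distr_distr) (simp_all add: comp_def add.assoc)
qed

lemma raise_belief_0: "sets \<beta> = sets borel \<Longrightarrow> raise_belief 0 \<beta> = \<beta>"
  by (simp add: raise_belief_def distr_id2)

lemma AE_raise_belief:
  assumes "sets \<beta> = sets borel" and [measurable]: "Measurable.pred borel P"
  shows "(AE t in raise_belief \<mu> \<beta>. P t) \<longleftrightarrow> (AE t in \<beta>. P (\<mu> + fst t, snd t))"
proof -
  note [measurable_cong] = assms(1)
  show ?thesis unfolding raise_belief_def by (subst AE_distr_iff) simp_all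
qed

lemma integral_raise_belief:
  fixes f :: "consumer_type \<Rightarrow> real"
  assumes "sets \<beta> = sets borel" and [measurable]: "f \<in> borel_measurable borel"
  shows "(\<integral>t. f t \<partial>raise_belief \<mu> \<beta>) = (\<integral>t. f (\<mu> + fst t, snd t) \<partial>\<beta>)"
proof -
  note [measurable_cong] = assms(1)
  show ?thesis unfolding raise_belief_def by (subst integral_distr) simp_all
qed

lemma prob_space_raise_belief:
  assumes "sets \<beta> = sets borel" "prob_space \<beta>"
  shows "prob_space (raise_belief \<mu> \<beta>)" "sets (raise_belief \<mu> \<beta>) = sets borel"
proof -
  note [measurable_cong] = assms(1)
  show "prob_space (raise_belief \<mu> \<beta>)" unfolding raise_belief_def
    by (rule prob_space.prob_space_distr[OF assms(2)]) simp
qed (simp add: raise_belief_def)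

lemma raise_wtp_inverse: "raise_wtp (- \<mu>) (raise_wtp \<mu> x) = x" "raise_wtp \<mu> (raise_wtp (- \<mu>) x) = x"
  by (simp_all add: raise_wtp_def)

lemma raise_wtp_nth: "fst (raise_wtp \<mu> x) $ i = \<mu> + fst x $ i" "snd (raise_wtp \<mu> x) = snd x"
  by (simp_all add: raise_wtp_def)

text \<open>The full set \<open>UNIV\<close> matters here: entries outside the set of observed
  consumers would stay zero under the shift.\<close>

lemma signal_raise_wtp: "signal X UNIV (raise_wtp \<mu> x, d) = raise_wtp \<mu> (signal X UNIV (x, d))"
  by (simp add: signal_eq raise_wtp_def dataset_def vec_eq_iff split: collection.split)

lemma state_law_shift_wtp:
  fixes F :: "'n::finite fundamentals measure"
  assumes "prob_space F" and sets_F: "sets F = sets borel"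
  shows "state_law linked (shift_wtp \<mu> F) S =
    distr (state_law linked F S) (state_law linked F S) (\<lambda>(x, d). (raise_wtp \<mu> x, d))"
proof -
  let ?p = "measure_pmf (permutation_law linked S)"
  note [measurable_cong] = sets_F
  have "distr F borel (raise_wtp \<mu>) \<Otimes>\<^sub>M distr ?p ?p (\<lambda>d. d)
      = distr (F \<Otimes>\<^sub>M ?p) (borel \<Otimes>\<^sub>M ?p) (\<lambda>(x, d). (raise_wtp \<mu> x, d))"
    by (rule pair_measure_distr) (simp_all add: prob_space_measure_pmf prob_space_imp_sigma_finite)
  also have "\<dots> = distr (F \<Otimes>\<^sub>M ?p) (F \<Otimes>\<^sub>M ?p) (\<lambda>(x, d). (raise_wtp \<mu> x, d))"
    by (intro distr_cong refl sets_pair_measure_cong) (simp_all add: sets_F)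
  finally show ?thesis by (simp add: state_law_def shift_wtp_raise)
qed

lemma raise_state_measurable:
  fixes F :: "'n::finite fundamentals measure"
  assumes "prob_space F" "sets F = sets borel"
  shows "(\<lambda>(x, d). (raise_wtp \<mu> x, d)) \<in> state_law linked F S \<rightarrow>\<^sub>M state_law linked F S"
proof -
  note [measurable_cong] = assms(2)
  show ?thesis unfolding state_law_def by measurable
qed

text \<open>A shift translates data and type by the same amount, so conditioning commutes with it.
  In this direction the lemma also supplies a posterior for the unshifted law out of one for any
  shifted law.\<close>

lemma posterior_unshift:
  fixes F :: "'n::finite fundamentals measure"
  assumes F: "prob_space F" "sets F = sets borel"
    and post: "posterior (state_law linked (shift_wtp \<mu> F) UNIV) (signal X UNIV) (ctype i) \<kappa>"
  shows "posterior (state_law linked F UNIV) (signal X UNIV) (ctype i)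
    (\<lambda>y. raise_belief (- \<mu>) (\<kappa> (raise_wtp \<mu> y)))"
  unfolding posterior_def
proof (intro conjI ballI)
  let ?M = "state_law linked F UNIV"
  let ?N = "state_law linked (shift_wtp \<mu> F) UNIV"
  let ?sh = "\<lambda>(x, d). (raise_wtp \<mu> x, d)"
  have \<kappa>[measurable]: "\<kappa> \<in> borel \<rightarrow>\<^sub>M prob_algebra borel" using post by (simp add: posterior_def)
  note [measurable] = \<kappa>[THEN measurable_prob_algebraD]
  have sets_\<kappa>: "sets (\<kappa> y) = sets borel" for y
    using measurable_space[OF \<kappa>, of y] by (simp add: space_prob_algebra)
  show kernel: "(\<lambda>y. raise_belief (- \<mu>) (\<kappa> (raise_wtp \<mu> y))) \<in> borel \<rightarrow>\<^sub>M prob_algebra borel" by measurable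
  note [measurable] = kernel[THEN measurable_prob_algebraD]
  fix A :: "'n fundamentals set" and B :: "consumer_type set"
  assume [measurable]: "A \<in> sets borel" "B \<in> sets borel"
  define A' where "A' = raise_wtp (- \<mu>) -` A"
  define B' where "B' = (\<lambda>t. (fst t - \<mu>, snd t)) -` B"
  have A'[measurable]: "A' \<in> sets borel"
    using measurable_sets[OF raise_wtp_measurable \<open>A \<in> sets borel\<close>] by (simp add: A'_def)
  have "(\<lambda>t. (fst t - \<mu>, snd t)) \<in> (borel :: consumer_type measure) \<rightarrow>\<^sub>M borel" by measurable
  from measurable_sets[OF this \<open>B \<in> sets borel\<close>]
  have B'[measurable]: "B' \<in> sets borel" by (simp add: B'_def)
  note sh[measurable] = raise_state_measurable[OF F, of \<mu> linked UNIV]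
  note Y[measurable] = measurable_signal[OF F, of X UNIV linked UNIV]
  note Z[measurable] = measurable_ctype[OF F, of i linked UNIV]
  have N: "?N = distr ?M ?M ?sh" by (rule state_law_shift_wtp[OF F])
  have "emeasure ?M {\<omega> \<in> space ?M. signal X UNIV \<omega> \<in> A \<and> ctype i \<omega> \<in> B}
      = emeasure ?N {\<omega> \<in> space ?N. signal X UNIV \<omega> \<in> A' \<and> ctype i \<omega> \<in> B'}"
  proof -
    let ?E = "{\<omega> \<in> space ?M. signal X UNIV \<omega> \<in> A' \<and> ctype i \<omega> \<in> B'}"
    have E: "?E \<in> sets ?M" by measurable
    have "?sh -` ?E \<inter> space ?M = {\<omega> \<in> space ?M. signal X UNIV \<omega> \<in> A \<and> ctype i \<omega> \<in> B}"
      by (auto simp: space_state_law[OF F] signal_raise_wtp A'_def B'_def raise_wtp_inverse ctype_eq raise_wtp_nth)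
    with emeasure_distr[OF sh E] show ?thesis by (simp add: N)
  qed
  also have "\<dots> = (\<integral>\<^sup>+y. emeasure (\<kappa> y) B' * indicator A' y \<partial>distr ?N borel (signal X UNIV))"
    using post by (simp add: posterior_def)
  also have "\<dots> = (\<integral>\<^sup>+\<omega>. emeasure (\<kappa> (raise_wtp \<mu> (signal X UNIV \<omega>))) B' * indicator A' (raise_wtp \<mu> (signal X UNIV \<omega>)) \<partial>?M)"
    unfolding N
    by (subst nn_integral_distr, simp, simp, subst nn_integral_distr[OF sh])
       (simp_all add: split_def signal_raise_wtp)
  also have "\<dots> = (\<integral>\<^sup>+\<omega>. emeasure (raise_belief (- \<mu>) (\<kappa> (raise_wtp \<mu> (signal X UNIV \<omega>)))) B * indicator A (signal X UNIV \<omega>) \<partial>?M)"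
  proof (rule nn_integral_cong)
    fix \<omega>
    have "emeasure (raise_belief (- \<mu>) \<beta>) B = emeasure \<beta> B'" if "sets \<beta> = sets borel" for \<beta>
    proof -
      note [measurable_cong] = that
      show ?thesis unfolding raise_belief_def
        using sets_eq_imp_space_eq[OF that] by (subst emeasure_distr) (simp_all add: B'_def)
    qed
    then show "emeasure (\<kappa> (raise_wtp \<mu> (signal X UNIV \<omega>))) B' * indicator A' (raise_wtp \<mu> (signal X UNIV \<omega>))
      = emeasure (raise_belief (- \<mu>) (\<kappa> (raise_wtp \<mu> (signal X UNIV \<omega>)))) B * indicator A (signal X UNIV \<omega>)"
      by (simp add: sets_\<kappa> A'_def raise_wtp_inverse indicator_def)
  qed
  also have "\<dots> = (\<integral>\<^sup>+y. emeasure (raise_belief (- \<mu>) (\<kappa> (raise_wtp \<mu> y))) B * indicator A y \<partial>distr ?M borel (signal X UNIV))"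
    by (subst nn_integral_distr) simp_all
  finally show "emeasure ?M {\<omega> \<in> space ?M. signal X UNIV \<omega> \<in> A \<and> ctype i \<omega> \<in> B} =
    (\<integral>\<^sup>+y. emeasure (raise_belief (- \<mu>) (\<kappa> (raise_wtp \<mu> y))) B * indicator A y \<partial>distr ?M borel (signal X UNIV))" .
qed

lemma signal_UNIV:
  "signal X UNIV (x, d) = relabel (if fst X = Complete then id else fst d) (if snd X = Complete then id else snd d) x"
  by (auto simp: signal_eq relabel_def dataset_def split: collection.split)

lemma norm_signal_UNIV:
  assumes "d \<in> set_pmf (permutation_law linked UNIV)" shows "norm (signal X UNIV (x, d)) = norm x"
proof -
  have "fst d permutes UNIV" "snd d permutes UNIV"
    using permutation_law_permutes[of "fst d" "snd d"] assms by simp_all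
  then show ?thesis unfolding signal_UNIV by (intro norm_relabel) (auto intro: permutes_id)
qed

lemma box_moments:
  fixes \<beta> :: belief
  assumes "prob_space \<beta>" and sets_\<beta>: "sets \<beta> = sets borel"
    and box: "AE t in \<beta>. \<bar>fst t\<bar> \<le> \<rho> \<and> (snd t)\<^sup>2 \<le> \<rho>"
  shows "integrable \<beta> fst" "integrable \<beta> snd" "integrable \<beta> (\<lambda>t. (snd t)\<^sup>2)"
    "\<bar>\<integral>t. fst t \<partial>\<beta>\<bar> \<le> \<rho>" "(\<integral>t. snd t \<partial>\<beta>)\<^sup>2 \<le> (\<integral>t. (snd t)\<^sup>2 \<partial>\<beta>)" "(\<integral>t. (snd t)\<^sup>2 \<partial>\<beta>) \<le> \<rho>"
proof -
  interpret prob_space \<beta> by fact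
  note [measurable_cong] = sets_\<beta>
  have AE: "AE t in \<beta>. \<bar>fst t\<bar> \<le> \<rho>" "AE t in \<beta>. fst t \<le> \<rho>" "AE t in \<beta>. - \<rho> \<le> fst t" "AE t in \<beta>. (snd t)\<^sup>2 \<le> \<rho>"
    by - (rule eventually_mono[OF box], erule conjE, linarith)+
  have "\<bar>y\<bar> \<le> 1 + \<rho>" if "y\<^sup>2 \<le> \<rho>" for y :: real
    using that zero_le_power2[of "y - 1"] zero_le_power2[of "y + 1"] zero_le_power2[of y]
    by (auto simp: power2_sum power2_diff abs_le_iff)
  with AE(4) have AE_snd: "AE t in \<beta>. \<bar>snd t\<bar> \<le> 1 + \<rho>" by (auto elim!: AE_mp)
  show int_fst: "integrable \<beta> fst" by (rule integrable_const_bound[where B=\<rho>]) (use AE in simp_all)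
  show int_snd: "integrable \<beta> snd" by (rule integrable_const_bound[where B="1 + \<rho>"]) (use AE_snd in simp_all)
  show int_sq: "integrable \<beta> (\<lambda>t. (snd t)\<^sup>2)"
    by (rule integrable_const_bound[where B=\<rho>]) (use AE in simp_all)
  note int = int_fst int_snd int_sq
  show "\<bar>\<integral>t. fst t \<partial>\<beta>\<bar> \<le> \<rho>"
    using integral_ge_const[OF int(1) AE(3)] integral_le_const[OF int(1) AE(2)] by simp
  show "(\<integral>t. (snd t)\<^sup>2 \<partial>\<beta>) \<le> \<rho>" using AE(4) by (rule integral_le_const[OF int(3)])
  have "0 \<le> variance snd" by (rule variance_positive)
  then show "(\<integral>t. snd t \<partial>\<beta>)\<^sup>2 \<le> (\<integral>t. (snd t)\<^sup>2 \<partial>\<beta>)" using int by (simp add: variance_eq)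
qed

section \<open>Welfare when gains from trade are large\<close>

text \<open>The belief system belongs to the unshifted law. The losses, \<open>base_welfare\<close>
  and \<open>tail\<close> are therefore fixed before \<mu>, the rule and the belief system of a
  shifted market are chosen, which gives a uniform threshold.\<close>

locale market =
  fixes F :: "'n::finite fundamentals measure" and linked :: bool
    and \<kappa> :: "policy \<Rightarrow> 'n \<Rightarrow> 'n fundamentals \<Rightarrow> belief"
  assumes gauss: "gaussian F" and mean0: "\<And>i. (\<integral>x. fst x $ i \<partial>F) = 0"
    and post: "\<And>X i. posterior (state_law linked F UNIV) (signal X UNIV) (ctype i) (\<kappa> X i)"
begin

abbreviation M :: "'n state measure" where "M \<equiv> state_law linked F UNIV"

definition bel :: "policy \<Rightarrow> 'n \<Rightarrow> 'n state \<Rightarrow> belief" where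
  "bel X i \<omega> = \<kappa> X i (signal X UNIV \<omega>)"

text \<open>One number that dominates both |w| and l^2, is at least 1, and can be recovered from the
  signal because permutations preserve the norm.\<close>

definition spread :: "'n state \<Rightarrow> real" where "spread \<omega> = 1 + (norm (fst \<omega>))\<^sup>2"

abbreviation wtp :: "'n \<Rightarrow> 'n state \<Rightarrow> real" where "wtp i \<omega> \<equiv> fst (fst \<omega>) $ i"
abbreviation loc :: "'n \<Rightarrow> 'n state \<Rightarrow> real" where "loc i \<omega> \<equiv> snd (fst \<omega>) $ i"

definition E_wtp :: "policy \<Rightarrow> 'n \<Rightarrow> 'n state \<Rightarrow> real" where
  "E_wtp X i \<omega> = (\<integral>t. fst t \<partial>bel X i \<omega>)"
definition E_loc :: "policy \<Rightarrow> 'n \<Rightarrow> 'n state \<Rightarrow> real" where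
  "E_loc X i \<omega> = (\<integral>t. snd t \<partial>bel X i \<omega>)"
definition V_loc :: "policy \<Rightarrow> 'n \<Rightarrow> 'n state \<Rightarrow> real" where
  "V_loc X i \<omega> = (\<integral>t. (snd t)\<^sup>2 \<partial>bel X i \<omega>) - (E_loc X i \<omega>)\<^sup>2"
definition mismatch :: "policy \<Rightarrow> 'n \<Rightarrow> 'n state \<Rightarrow> real" where
  "mismatch X i \<omega> = (E_loc X i \<omega> - loc i \<omega>)\<^sup>2"

lemmas F = prob_space_gaussian[OF gauss] sets_gaussian[OF gauss]

sublocale prob_space M by (rule prob_space_state_law[OF F])

lemma spread_ge_1: "1 \<le> spread \<omega>"
  by (simp add: spread_def)

lemma measurable_fundamentals[measurable]: "fst \<in> M \<rightarrow>\<^sub>M borel"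
  by (rule measurable_fst_state_law[OF F])

lemma wtp_measurable[measurable]: "wtp i \<in> borel_measurable M"
  by measurable

lemma loc_measurable[measurable]: "loc i \<in> borel_measurable M"
  by measurable

lemma spread_measurable[measurable]: "spread \<in> borel_measurable M"
  unfolding spread_def[abs_def] by measurable

lemma measurable_signal'[measurable]: "signal X UNIV \<in> M \<rightarrow>\<^sub>M borel"
  by (rule measurable_signal[OF F])

lemma measurable_ctype'[measurable]: "ctype i \<in> M \<rightarrow>\<^sub>M borel"
  by (rule measurable_ctype[OF F])

lemma ctype_wtp_loc: "ctype i \<omega> = (wtp i \<omega>, loc i \<omega>)"
  using ctype_eq[of i "fst \<omega>" "snd \<omega>"] by simp

lemma kernel[measurable]: "\<kappa> X i \<in> borel \<rightarrow>\<^sub>M prob_algebra borel"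
  using post by (simp add: posterior_def)

lemma bel_measurable[measurable]: "bel X i \<in> M \<rightarrow>\<^sub>M prob_algebra borel"
  unfolding bel_def[abs_def] by measurable

lemma prob_space_bel: "prob_space (bel X i \<omega>)" and sets_bel: "sets (bel X i \<omega>) = sets borel"
  using measurable_space[OF kernel, of "signal X UNIV \<omega>" X i] by (simp_all add: space_prob_algebra bel_def)

lemma moments_measurable:
  fixes f :: "consumer_type \<Rightarrow> real"
  assumes "f \<in> borel_measurable borel"
  shows "(\<lambda>y. \<integral>t. f t \<partial>\<kappa> X i y) \<in> borel_measurable borel"
  by (rule measurable_compose[OF kernel[THEN measurable_prob_algebraD] integral_measurable_subprob_algebra[OF assms]])

lemma E_wtp_eq: "E_wtp X i = (\<lambda>\<omega>. (\<lambda>y. \<integral>t. fst t \<partial>\<kappa> X i y) (signal X UNIV \<omega>))"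
  by (simp add: E_wtp_def bel_def fun_eq_iff)

lemma E_loc_eq: "E_loc X i = (\<lambda>\<omega>. (\<lambda>y. \<integral>t. snd t \<partial>\<kappa> X i y) (signal X UNIV \<omega>))"
  by (simp add: E_loc_def bel_def fun_eq_iff)

lemma E_wtp_measurable[measurable]: "E_wtp X i \<in> borel_measurable M"
  unfolding E_wtp_eq by (rule measurable_compose[OF measurable_signal' moments_measurable]) simp

lemma E_loc_measurable[measurable]: "E_loc X i \<in> borel_measurable M"
  unfolding E_loc_eq by (rule measurable_compose[OF measurable_signal' moments_measurable]) simp

lemma V_loc_measurable[measurable]: "V_loc X i \<in> borel_measurable M"
proof -
  have "(\<lambda>\<omega>. (\<lambda>y. \<integral>t. (snd t)\<^sup>2 \<partial>\<kappa> X i y) (signal X UNIV \<omega>)) \<in> borel_measurable M"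
    by (rule measurable_compose[OF measurable_signal' moments_measurable]) simp
  then have [measurable]: "(\<lambda>\<omega>. \<integral>t. (snd t)\<^sup>2 \<partial>bel X i \<omega>) \<in> borel_measurable M" by (simp add: bel_def)
  show ?thesis unfolding V_loc_def[abs_def] by measurable
qed

lemma mismatch_measurable[measurable]: "mismatch X i \<in> borel_measurable M"
  unfolding mismatch_def[abs_def] by measurable

lemma coord_bounds: "\<bar>wtp i \<omega>\<bar> \<le> spread \<omega>" "(loc i \<omega>)\<^sup>2 \<le> spread \<omega>"
proof -
  have le: "norm (fst (fst \<omega>)) \<le> norm (fst \<omega>)" "norm (snd (fst \<omega>)) \<le> norm (fst \<omega>)"
    by (metis norm_fst_le prod.collapse, metis norm_snd_le prod.collapse)
  have "norm (fst \<omega>) \<le> spread \<omega>"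
  proof -
    have "2 * norm (fst \<omega>) \<le> (norm (fst \<omega>))\<^sup>2 + 1"
      using zero_le_power2[of "norm (fst \<omega>) - 1"] by (simp add: power2_diff)
    then show ?thesis using norm_ge_zero[of "fst \<omega>"] unfolding spread_def by linarith
  qed
  then show "\<bar>wtp i \<omega>\<bar> \<le> spread \<omega>"
    using component_le_norm_cart[of "fst (fst \<omega>)" i] le(1) by linarith
  have "\<bar>loc i \<omega>\<bar> \<le> norm (fst \<omega>)"
    using component_le_norm_cart[of "snd (fst \<omega>)" i] le(2) by linarith
  then have "(loc i \<omega>)\<^sup>2 \<le> (norm (fst \<omega>))\<^sup>2" using power_mono[of "\<bar>loc i \<omega>\<bar>" "norm (fst \<omega>)" 2] by simp
  then show "(loc i \<omega>)\<^sup>2 \<le> spread \<omega>" by (simp add: spread_def)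
qed

lemma AE_norm_signal: "AE \<omega> in M. norm (signal X UNIV \<omega>) = norm (fst \<omega>)"
  using AE_state_law_snd[OF F, where linked=linked and S=UNIV]
  by eventually_elim (metis norm_signal_UNIV prod.collapse)

lemma AE_bel_iff:
  assumes "Measurable.pred (borel \<Otimes>\<^sub>M borel) (\<lambda>(y, t). P y t)"
  shows "(AE \<omega> in M. P (signal X UNIV \<omega>) (ctype i \<omega>)) \<longleftrightarrow> (AE \<omega> in M. AE t in bel X i \<omega>. P (signal X UNIV \<omega>) t)"
  unfolding bel_def
  by (rule posterior_AE_iff[OF prob_space_axioms measurable_signal' measurable_ctype' post assms])

text \<open>Almost surely the signal has the same norm as the fundamentals, so the bound on the
  realized type can be written in terms of the signal, and then it passes to the belief.\<close>

lemma AE_bel_box: "AE \<omega> in M. AE t in bel X i \<omega>. \<bar>fst t\<bar> \<le> spread \<omega> \<and> (snd t)\<^sup>2 \<le> spread \<omega>"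
proof -
  define P where "P y t \<longleftrightarrow> \<bar>fst t\<bar> \<le> 1 + (norm y)\<^sup>2 \<and> (snd t)\<^sup>2 \<le> 1 + (norm y)\<^sup>2"
    for y :: "'n fundamentals" and t :: consumer_type
  have "AE \<omega> in M. P (signal X UNIV \<omega>) (ctype i \<omega>)"
    using AE_norm_signal[of X]
    by eventually_elim (use coord_bounds in \<open>simp add: P_def ctype_wtp_loc spread_def\<close>)
  then have "AE \<omega> in M. AE t in bel X i \<omega>. P (signal X UNIV \<omega>) t"
    by (subst (asm) AE_bel_iff) (unfold P_def, measurable)
  with AE_norm_signal[of X] show ?thesis
    by eventually_elim (simp add: P_def spread_def)
qed

lemma AE_moment_bounds:
  "AE \<omega> in M. integrable (bel X i \<omega>) fst \<and> integrable (bel X i \<omega>) snd \<and> integrable (bel X i \<omega>) (\<lambda>t. (snd t)\<^sup>2) \<and>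
    \<bar>E_wtp X i \<omega>\<bar> \<le> spread \<omega> \<and> (E_loc X i \<omega>)\<^sup>2 \<le> spread \<omega> \<and> 0 \<le> V_loc X i \<omega> \<and> V_loc X i \<omega> \<le> spread \<omega> \<and>
    0 \<le> mismatch X i \<omega> \<and> mismatch X i \<omega> \<le> 4 * spread \<omega>"
  using AE_bel_box[of X i]
proof eventually_elim
  case (elim \<omega>)
  note m = box_moments[OF prob_space_bel sets_bel elim]
  have E: "(E_loc X i \<omega>)\<^sup>2 \<le> spread \<omega>" using m(5,6) by (simp add: E_loc_def)
  have "mismatch X i \<omega> \<le> 2 * (E_loc X i \<omega>)\<^sup>2 + 2 * (loc i \<omega>)\<^sup>2"
    using zero_le_power2[of "E_loc X i \<omega> + loc i \<omega>"] by (simp add: mismatch_def power2_sum power2_diff)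
  also have "\<dots> \<le> 4 * spread \<omega>" using E coord_bounds(2)[of \<omega> i] by simp
  finally have "mismatch X i \<omega> \<le> 4 * spread \<omega>" .
  moreover have "V_loc X i \<omega> \<le> spread \<omega>"
    using m(6) zero_le_power2[of "E_loc X i \<omega>"] unfolding V_loc_def by linarith
  ultimately show ?case using m E by (simp add: E_wtp_def V_loc_def E_loc_def mismatch_def)
qed

lemma integrable_spread: "integrable M (\<lambda>\<omega>. (spread \<omega>)\<^sup>2)"
proof -
  have "distr M F fst = F"
    unfolding state_law_def by (rule prob_space.distr_pair_fst[OF prob_space_measure_pmf])
  moreover have "integrable F (\<lambda>x. (1 + (norm x)\<^sup>2)\<^sup>2)" by (rule integrable_gaussian_norm[OF gauss])
  ultimately have "integrable (distr M F fst) (\<lambda>x. (1 + (norm x)\<^sup>2)\<^sup>2)" by simp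
  then show ?thesis unfolding spread_def by (rule integrable_distr[rotated]) (simp add: state_law_def)
qed

lemma integrable_spread_bound:
  fixes f :: "'n state \<Rightarrow> real"
  assumes "f \<in> borel_measurable M" "AE \<omega> in M. \<bar>f \<omega>\<bar> \<le> C * (spread \<omega>)\<^sup>2"
  shows "integrable M f"
  by (rule Bochner_Integration.integrable_bound[OF integrable_mult_right[OF integrable_spread, of C] assms(1)])
     (use assms(2) in eventually_elim, simp)

lemma spread_le_sq: "spread \<omega> \<le> (spread \<omega>)\<^sup>2"
  using spread_ge_1[of \<omega>] by (simp add: power2_eq_square)

lemma integral_bel:
  fixes g :: "'n fundamentals \<Rightarrow> real" and h :: "consumer_type \<Rightarrow> real"
  assumes [measurable]: "g \<in> borel_measurable borel" "h \<in> borel_measurable borel"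
    and "integrable M (\<lambda>\<omega>. g (signal X UNIV \<omega>) * h (ctype i \<omega>))"
    and "AE \<omega> in M. integrable (bel X i \<omega>) h"
  shows "(\<integral>\<omega>. g (signal X UNIV \<omega>) * h (ctype i \<omega>) \<partial>M) = (\<integral>\<omega>. g (signal X UNIV \<omega>) * (\<integral>t. h t \<partial>bel X i \<omega>) \<partial>M)"
  using posterior_integral[OF prob_space_axioms measurable_signal' measurable_ctype' post[of X i] assms(1-3)]
    assms(4) unfolding bel_def .

lemma AE_E_eq:
  assumes \<phi>[measurable]: "\<phi> \<in> borel_measurable borel" and h[measurable]: "h \<in> borel_measurable borel"
    and eq: "AE \<omega> in M. h (ctype i \<omega>) = \<phi> (signal X UNIV \<omega>)"
  shows "AE \<omega> in M. (\<integral>t. h t \<partial>bel X i \<omega>) = (h (ctype i \<omega>) :: real)"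
    and "AE \<omega> in M. AE t in bel X i \<omega>. h t = h (ctype i \<omega>)"
proof -
  have "AE \<omega> in M. AE t in bel X i \<omega>. h t = \<phi> (signal X UNIV \<omega>)"
    using eq by (subst (asm) AE_bel_iff[where P="\<lambda>y t. h t = \<phi> y"]) (simp_all add: split_def)
  with eq show *: "AE \<omega> in M. AE t in bel X i \<omega>. h t = h (ctype i \<omega>)"
    by eventually_elim simp
  show "AE \<omega> in M. (\<integral>t. h t \<partial>bel X i \<omega>) = h (ctype i \<omega>)"
    using *
  proof eventually_elim
    case (elim \<omega>)
    interpret \<beta>: prob_space "bel X i \<omega>" by (rule prob_space_bel)
    note [measurable_cong] = sets_bel[of X i \<omega>]
    have "(\<integral>t. h t \<partial>bel X i \<omega>) = (\<integral>t. h (ctype i \<omega>) \<partial>bel X i \<omega>)"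
      using elim by (intro integral_cong_AE) simp_all
    then show ?case by (simp add: \<beta>.prob_space)
  qed
qed

lemma AE_int: "AE \<omega> in M. integrable (bel X i \<omega>) fst" "AE \<omega> in M. integrable (bel X i \<omega>) snd"
  "AE \<omega> in M. integrable (bel X i \<omega>) (\<lambda>t. (snd t)\<^sup>2)"
  using AE_moment_bounds[of X i] by (auto elim!: eventually_mono)

lemma sq_le_spread: "\<bar>a\<bar> \<le> c * spread \<omega> \<Longrightarrow> \<bar>b\<bar> \<le> d * spread \<omega> \<Longrightarrow> \<bar>a * b\<bar> \<le> c * d * (spread \<omega>)\<^sup>2"
  using mult_mono[of "\<bar>a\<bar>" "c * spread \<omega>" "\<bar>b\<bar>" "d * spread \<omega>"]
  by (auto simp: abs_mult power2_eq_square mult_ac dest: order_trans[OF abs_ge_zero])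

lemma abs_le_spread: "y\<^sup>2 \<le> spread \<omega> \<Longrightarrow> \<bar>y\<bar> \<le> spread \<omega>"
proof -
  assume "y\<^sup>2 \<le> spread \<omega>"
  then have "\<bar>y\<bar>\<^sup>2 \<le> (spread \<omega>)\<^sup>2" using spread_le_sq[of \<omega>] by simp
  then show ?thesis using spread_ge_1[of \<omega>] by (intro power2_le_imp_le[of "\<bar>y\<bar>"]) simp_all
qed

lemma integrable_spread_linear:
  assumes "f \<in> borel_measurable M" "AE \<omega> in M. \<bar>f \<omega>\<bar> \<le> c * spread \<omega>" "0 \<le> c"
  shows "integrable M f"
proof (rule integrable_spread_bound[OF assms(1)])
  show "AE \<omega> in M. \<bar>f \<omega>\<bar> \<le> c * (spread \<omega>)\<^sup>2"
    using assms(2) by eventually_elim (meson assms(3) mult_left_mono order_trans spread_le_sq)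
qed

lemma integrable_spread_mult:
  assumes "f \<in> borel_measurable M" "g \<in> borel_measurable M"
    and "AE \<omega> in M. \<bar>f \<omega>\<bar> \<le> c * spread \<omega>" "AE \<omega> in M. \<bar>g \<omega>\<bar> \<le> d * spread \<omega>"
  shows "integrable M (\<lambda>\<omega>. f \<omega> * g \<omega> :: real)"
proof (rule integrable_spread_bound)
  show "AE \<omega> in M. \<bar>f \<omega> * g \<omega>\<bar> \<le> c * d * (spread \<omega>)\<^sup>2"
    using assms(3,4) by eventually_elim (rule sq_le_spread)
qed (use assms(1,2) in simp)

lemma integrable_basic:
  shows integrable_wtp: "integrable M (wtp i)" and integrable_E_wtp: "integrable M (E_wtp X i)"
    and integrable_mismatch: "integrable M (mismatch X i)" and integrable_V_loc: "integrable M (V_loc X i)"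
    and integrable_wtp_sq: "integrable M (\<lambda>\<omega>. (wtp i \<omega>)\<^sup>2)"
    and integrable_E_wtp_sq: "integrable M (\<lambda>\<omega>. (E_wtp X i \<omega>)\<^sup>2)"
    and integrable_E_wtp_wtp: "integrable M (\<lambda>\<omega>. E_wtp X i \<omega> * wtp i \<omega>)"
    and integrable_E_loc_sq: "integrable M (\<lambda>\<omega>. E_loc X i \<omega> * E_loc X i \<omega>)"
    and integrable_E_loc_loc: "integrable M (\<lambda>\<omega>. E_loc X i \<omega> * loc i \<omega>)"
    and integrable_loc_sq: "integrable M (\<lambda>\<omega>. (loc i \<omega>)\<^sup>2)"
    and integrable_K: "integrable M (\<lambda>\<omega>. (wtp i \<omega> - mismatch X i \<omega>)\<^sup>2 / 2 - (E_wtp X i \<omega> - V_loc X i \<omega>)\<^sup>2 / 8)"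
proof -
  have b: "AE \<omega> in M. \<bar>wtp i \<omega>\<bar> \<le> 1 * spread \<omega>" "AE \<omega> in M. \<bar>loc i \<omega>\<bar> \<le> 1 * spread \<omega>"
    "AE \<omega> in M. \<bar>E_wtp X i \<omega>\<bar> \<le> 1 * spread \<omega>" "AE \<omega> in M. \<bar>E_loc X i \<omega>\<bar> \<le> 1 * spread \<omega>"
    "AE \<omega> in M. \<bar>V_loc X i \<omega>\<bar> \<le> 1 * spread \<omega>" "AE \<omega> in M. \<bar>mismatch X i \<omega>\<bar> \<le> 4 * spread \<omega>"
    by - (rule eventually_mono[OF AE_moment_bounds[of X i]], use coord_bounds abs_le_spread in simp)+
  show "integrable M (wtp i)" "integrable M (E_wtp X i)" "integrable M (mismatch X i)" "integrable M (V_loc X i)"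
    using b(1,3,5,6)[THEN integrable_spread_linear[rotated]] by simp_all
  show "integrable M (\<lambda>\<omega>. (wtp i \<omega>)\<^sup>2)" "integrable M (\<lambda>\<omega>. (E_wtp X i \<omega>)\<^sup>2)"
    "integrable M (\<lambda>\<omega>. E_wtp X i \<omega> * wtp i \<omega>)" "integrable M (\<lambda>\<omega>. E_loc X i \<omega> * E_loc X i \<omega>)"
    "integrable M (\<lambda>\<omega>. E_loc X i \<omega> * loc i \<omega>)" "integrable M (\<lambda>\<omega>. (loc i \<omega>)\<^sup>2)"
    unfolding power2_eq_square
    by (simp_all add: integrable_spread_mult[OF _ _ b(1) b(1)] integrable_spread_mult[OF _ _ b(2) b(2)]
        integrable_spread_mult[OF _ _ b(3) b(1)] integrable_spread_mult[OF _ _ b(3) b(3)]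
        integrable_spread_mult[OF _ _ b(4) b(2)] integrable_spread_mult[OF _ _ b(4) b(4)])
  have b': "AE \<omega> in M. \<bar>wtp i \<omega> - mismatch X i \<omega>\<bar> \<le> 5 * spread \<omega>"
    "AE \<omega> in M. \<bar>E_wtp X i \<omega> - V_loc X i \<omega>\<bar> \<le> 2 * spread \<omega>"
    using b(1,6) by (eventually_elim, linarith) (use b(3,5) in \<open>eventually_elim, linarith\<close>)
  show "integrable M (\<lambda>\<omega>. (wtp i \<omega> - mismatch X i \<omega>)\<^sup>2 / 2 - (E_wtp X i \<omega> - V_loc X i \<omega>)\<^sup>2 / 8)"
    unfolding power2_eq_square
    by (intro Bochner_Integration.integrable_diff integrable_divide
        integrable_spread_mult[OF _ _ b'(1) b'(1)] integrable_spread_mult[OF _ _ b'(2) b'(2)]) simp_all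
qed

lemma integral_wtp: "(\<integral>\<omega>. wtp i \<omega> \<partial>M) = 0"
proof -
  note [measurable_cong] = F(2)
  have "distr M F fst = F"
    unfolding state_law_def by (rule prob_space.distr_pair_fst[OF prob_space_measure_pmf])
  then have "(\<integral>x. fst x $ i \<partial>F) = (\<integral>x. fst x $ i \<partial>distr M F fst)" by simp
  also have "\<dots> = (\<integral>\<omega>. wtp i \<omega> \<partial>M)" by (rule integral_distr) (simp_all add: state_law_def)
  finally show ?thesis using mean0 by simp
qed

lemma integral_E_wtp: "(\<integral>\<omega>. E_wtp X i \<omega> \<partial>M) = 0"
  using integral_bel[of "\<lambda>_. 1" fst X i] integrable_wtp[of i] AE_int(1)[of X i] integral_wtp[of i]
  by (simp add: ctype_wtp_loc E_wtp_def)

lemma integral_E_wtp_wtp: "(\<integral>\<omega>. E_wtp X i \<omega> * wtp i \<omega> \<partial>M) = (\<integral>\<omega>. (E_wtp X i \<omega>)\<^sup>2 \<partial>M)"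
  using integral_bel[of "\<lambda>y. \<integral>t. fst t \<partial>\<kappa> X i y" fst X i] integrable_E_wtp_wtp[of X i] AE_int(1)[of X i]
  by (simp add: ctype_wtp_loc E_wtp_def bel_def moments_measurable power2_eq_square)

text \<open>By the tower property. The identity merges the terms - \<mu> \<open>mismatch\<close> and
  + (\<mu> / 4) \<open>V_loc\<close> of the expansion into one loss with coefficient 3/4.\<close>

lemma integral_mismatch: "(\<integral>\<omega>. mismatch X i \<omega> \<partial>M) = (\<integral>\<omega>. V_loc X i \<omega> \<partial>M)"
proof -
  have 1: "(\<integral>\<omega>. E_loc X i \<omega> * loc i \<omega> \<partial>M) = (\<integral>\<omega>. E_loc X i \<omega> * E_loc X i \<omega> \<partial>M)"
    using integral_bel[of "\<lambda>y. \<integral>t. snd t \<partial>\<kappa> X i y" snd X i] integrable_E_loc_loc[of X i] AE_int(2)[of X i]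
    by (simp add: ctype_wtp_loc E_loc_def bel_def moments_measurable)
  have 2: "(\<integral>\<omega>. (loc i \<omega>)\<^sup>2 \<partial>M) = (\<integral>\<omega>. \<integral>t. (snd t)\<^sup>2 \<partial>bel X i \<omega> \<partial>M)"
    using integral_bel[of "\<lambda>_. 1" "\<lambda>t. (snd t)\<^sup>2" X i] integrable_loc_sq[of i] AE_int(3)[of X i]
    by (simp add: ctype_wtp_loc)
  have "integrable M (\<lambda>\<omega>. V_loc X i \<omega> + E_loc X i \<omega> * E_loc X i \<omega>)"
    by (intro Bochner_Integration.integrable_add integrable_basic)
  then have int: "integrable M (\<lambda>\<omega>. \<integral>t. (snd t)\<^sup>2 \<partial>bel X i \<omega>)"
    by (simp add: V_loc_def power2_eq_square)
  have "(\<integral>\<omega>. mismatch X i \<omega> \<partial>M) = (\<integral>\<omega>. E_loc X i \<omega> * E_loc X i \<omega> - 2 * (E_loc X i \<omega> * loc i \<omega>) + (loc i \<omega>)\<^sup>2 \<partial>M)"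
    by (simp add: mismatch_def power2_diff power2_eq_square algebra_simps)
  also have "\<dots> = (\<integral>\<omega>. E_loc X i \<omega> * E_loc X i \<omega> \<partial>M) - 2 * (\<integral>\<omega>. E_loc X i \<omega> * loc i \<omega> \<partial>M) + (\<integral>\<omega>. (loc i \<omega>)\<^sup>2 \<partial>M)"
    by (simp add: integrable_E_loc_sq integrable_E_loc_loc integrable_loc_sq)
  also have "\<dots> = (\<integral>\<omega>. \<integral>t. (snd t)\<^sup>2 \<partial>bel X i \<omega> \<partial>M) - (\<integral>\<omega>. E_loc X i \<omega> * E_loc X i \<omega> \<partial>M)"
    by (simp add: 1 2)
  also have "\<dots> = (\<integral>\<omega>. V_loc X i \<omega> \<partial>M)"
    unfolding V_loc_def power2_eq_square[of "E_loc X i _"]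
    by (rule Bochner_Integration.integral_diff[symmetric]) (simp_all add: int integrable_E_loc_sq)
  finally show ?thesis .
qed

end

lemma offer_profit_measurable'[measurable (raw)]:
  assumes "f \<in> M \<rightarrow>\<^sub>M borel" "g \<in> M \<rightarrow>\<^sub>M borel"
  shows "(\<lambda>x. offer_profit (f x) (g x)) \<in> borel_measurable M"
  using measurable_compose[OF borel_measurable_Pair[OF assms] offer_profit_measurable] by simp

lemma offer_utility_measurable'[measurable (raw)]:
  assumes "f \<in> M \<rightarrow>\<^sub>M borel" "g \<in> M \<rightarrow>\<^sub>M borel"
  shows "(\<lambda>x. offer_utility (f x) (g x)) \<in> borel_measurable M"
  using measurable_compose[OF borel_measurable_Pair[OF assms] offer_utility_measurable] by simp

section \<open>Welfare at mean \<mu> and its expansion\<close>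

context market
begin

text \<open>Payoffs of the market with mean \<mu>, transported to the state space with mean
  zero.\<close>

definition welfare :: "real \<Rightarrow> (belief \<Rightarrow> offer) \<Rightarrow> policy \<Rightarrow> 'n \<Rightarrow> real" where
  "welfare \<mu> r X i =
     (\<integral>\<omega>. offer_profit (r (raise_belief \<mu> (bel X i \<omega>))) (\<mu> + wtp i \<omega>, loc i \<omega>) \<partial>M) +
     (\<integral>\<omega>. offer_utility (r (raise_belief \<mu> (bel X i \<omega>))) (\<mu> + wtp i \<omega>, loc i \<omega>) \<partial>M)"

lemma offer_measurable:
  assumes "optimal_rule r"
  shows "(\<lambda>y. r (raise_belief \<mu> (\<kappa> X i y))) \<in> borel_measurable borel"
    "(\<lambda>\<omega>. r (raise_belief \<mu> (bel X i \<omega>))) \<in> borel_measurable M"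
proof -
  have [measurable]: "r \<in> prob_algebra borel \<rightarrow>\<^sub>M borel" using assms by (simp add: optimal_rule_def)
  show "(\<lambda>y. r (raise_belief \<mu> (\<kappa> X i y))) \<in> borel_measurable borel" by measurable
  show "(\<lambda>\<omega>. r (raise_belief \<mu> (bel X i \<omega>))) \<in> borel_measurable M" by measurable
qed

lemma welfare_cong:
  assumes "optimal_rule r" and eq: "AE \<omega> in M. bel X i \<omega> = bel X' i \<omega>"
  shows "welfare \<mu> r X i = welfare \<mu> r X' i"
proof -
  note [measurable] = offer_measurable(2)[OF assms(1)]
  show ?thesis unfolding welfare_def
    by (intro arg_cong2[where f="(+)"] integral_cong_AE) (use eq in \<open>auto elim!: AE_mp\<close>)
qed

text \<open>After translation, the posteriors in \<kappa>' agree almost surely with the fixed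
  beliefs \<open>bel\<close>, so the choice of \<kappa>' leaves no trace on the right-hand
  side.\<close>

lemma welfare_eq:
  assumes opt: "producer_optimal linked (shift_wtp \<mu> F) r \<kappa>'"
  shows "producer_profit linked (shift_wtp \<mu> F) r \<kappa>' X UNIV i +
    consumer_utility linked (shift_wtp \<mu> F) r \<kappa>' X UNIV i = welfare \<mu> r X i"
proof -
  note opt' = producer_optimalD[OF opt]
  note [measurable] = offer_measurable(2)[OF opt'(1)]
  let ?\<kappa> = "\<kappa>' X UNIV i"
  have sets_\<kappa>: "sets (?\<kappa> y) = sets borel" for y
    using measurable_space[OF opt'(3), of y X UNIV i] by (simp add: space_prob_algebra)
  let ?sh = "\<lambda>(x, d). (raise_wtp \<mu> x, d)"
  note sh = raise_state_measurable[OF F, of \<mu> linked UNIV]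
  have bel: "AE \<omega> in M. ?\<kappa> (raise_wtp \<mu> (signal X UNIV \<omega>)) = raise_belief \<mu> (bel X i \<omega>)"
    using posterior_unique[OF prob_space_axioms measurable_signal' posterior_unshift[OF F opt'(2)] post[of X i]]
  proof eventually_elim
    case (elim \<omega>)
    have "raise_belief \<mu> (bel X i \<omega>) = raise_belief (\<mu> + - \<mu>) (?\<kappa> (raise_wtp \<mu> (signal X UNIV \<omega>)))"
      unfolding bel_def elim[symmetric] by (rule raise_belief_raise_belief[OF sets_\<kappa>])
    then show ?case by (simp add: raise_belief_0 sets_\<kappa>)
  qed
  have [measurable]: "(\<lambda>y. r (?\<kappa> y)) \<in> borel_measurable borel"
    by (rule measurable_offer_belief[OF opt'(1,3)])
  have sh_eq: "signal X UNIV (?sh \<omega>) = raise_wtp \<mu> (signal X UNIV \<omega>)" "ctype i (?sh \<omega>) = (\<mu> + wtp i \<omega>, loc i \<omega>)" for \<omega>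
    by (cases \<omega>; simp add: signal_raise_wtp ctype_eq raise_wtp_nth)+
  have eq: "(\<integral>\<omega>. f (r (?\<kappa> (signal X UNIV \<omega>))) (ctype i \<omega>) \<partial>state_law linked (shift_wtp \<mu> F) UNIV) =
      (\<integral>\<omega>. f (r (raise_belief \<mu> (bel X i \<omega>))) (\<mu> + wtp i \<omega>, loc i \<omega>) \<partial>M)"
    if f: "\<And>g h (N :: 'n state measure). g \<in> N \<rightarrow>\<^sub>M borel \<Longrightarrow> h \<in> N \<rightarrow>\<^sub>M borel \<Longrightarrow> (\<lambda>x. f (g x) (h x)) \<in> borel_measurable N"
    for f :: "offer \<Rightarrow> consumer_type \<Rightarrow> real"
  proof -
    have "(\<integral>\<omega>. f (r (?\<kappa> (signal X UNIV \<omega>))) (ctype i \<omega>) \<partial>state_law linked (shift_wtp \<mu> F) UNIV) =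
        (\<integral>\<omega>. f (r (?\<kappa> (signal X UNIV (?sh \<omega>)))) (ctype i (?sh \<omega>)) \<partial>M)"
      unfolding state_law_shift_wtp[OF F] by (rule integral_distr[OF sh], rule f) measurable
    also have "\<dots> = (\<integral>\<omega>. f (r (?\<kappa> (raise_wtp \<mu> (signal X UNIV \<omega>)))) (\<mu> + wtp i \<omega>, loc i \<omega>) \<partial>M)"
      by (simp add: sh_eq)
    also have "\<dots> = (\<integral>\<omega>. f (r (raise_belief \<mu> (bel X i \<omega>))) (\<mu> + wtp i \<omega>, loc i \<omega>) \<partial>M)"
    proof (rule integral_cong_AE)
      show "(\<lambda>\<omega>. f (r (?\<kappa> (raise_wtp \<mu> (signal X UNIV \<omega>)))) (\<mu> + wtp i \<omega>, loc i \<omega>)) \<in> borel_measurable M"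
        by (rule f) measurable
      show "(\<lambda>\<omega>. f (r (raise_belief \<mu> (bel X i \<omega>))) (\<mu> + wtp i \<omega>, loc i \<omega>)) \<in> borel_measurable M"
        by (rule f) measurable
      show "AE \<omega> in M. f (r (?\<kappa> (raise_wtp \<mu> (signal X UNIV \<omega>)))) (\<mu> + wtp i \<omega>, loc i \<omega>) =
          f (r (raise_belief \<mu> (bel X i \<omega>))) (\<mu> + wtp i \<omega>, loc i \<omega>)"
        using bel by eventually_elim simp
    qed
    finally show ?thesis .
  qed
  show ?thesis unfolding welfare_def producer_profit_def consumer_utility_def
    by (intro arg_cong2[where f="(+)"] eq offer_profit_measurable' offer_utility_measurable')
qed

lemma AE_offer:
  assumes r: "optimal_rule r" and "0 \<le> \<mu>"
  shows "AE \<omega> in M. is_arg_max (\<lambda>a. \<integral>t. offer_profit a t \<partial>raise_belief \<mu> (bel X i \<omega>)) (\<lambda>_. True)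
      (r (raise_belief \<mu> (bel X i \<omega>))) \<and>
    (AE t in raise_belief \<mu> (bel X i \<omega>). \<bar>fst t - \<mu>\<bar> \<le> spread \<omega> \<and> (snd t)\<^sup>2 \<le> spread \<omega>)"
  using AE_bel_box[of X i]
proof eventually_elim
  case (elim \<omega>)
  let ?\<beta> = "raise_belief \<mu> (bel X i \<omega>)"
  note \<beta> = prob_space_raise_belief[OF sets_bel[of X i \<omega>] prob_space_bel, of \<mu>]
  interpret \<beta>: prob_space ?\<beta> by (rule \<beta>)
  note [measurable_cong] = \<beta>(2)
  have box: "AE t in ?\<beta>. \<bar>fst t - \<mu>\<bar> \<le> spread \<omega> \<and> (snd t)\<^sup>2 \<le> spread \<omega>"
    using elim by (subst AE_raise_belief[OF sets_bel]) simp_all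
  have "AE t in ?\<beta>. \<bar>fst t\<bar> \<le> \<mu> + spread \<omega>"
    by (rule eventually_mono[OF box], erule conjE) (use \<open>0 \<le> \<mu>\<close> in linarith)
  then have "AE t in ?\<beta>. norm ((fst t)\<^sup>2) \<le> (\<mu> + spread \<omega>)\<^sup>2"
    by (rule eventually_mono) (metis abs_le_square_iff abs_ge_self norm_power order_trans real_norm_def abs_of_nonneg zero_le_power2 power2_abs)
  then have "integrable ?\<beta> (\<lambda>t. (fst t)\<^sup>2)"
    by (rule \<beta>.integrable_const_bound) simp
  then have "is_arg_max (\<lambda>a. \<integral>t. offer_profit a t \<partial>?\<beta>) (\<lambda>_. True) (r ?\<beta>)"
    using r \<beta> by (simp add: optimal_rule_def space_prob_algebra)
  with box show ?case by blast
qed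

text \<open>Optimality bounds the surplus almost surely under the belief; \<open>AE_bel_iff\<close>
  carries the bounds over to the realized type.\<close>

lemma AE_surplus_bounds:
  assumes r: "optimal_rule r" and "0 \<le> \<mu>"
  shows "AE \<omega> in M.
    0 \<le> offer_profit (r (raise_belief \<mu> (bel X i \<omega>))) (\<mu> + wtp i \<omega>, loc i \<omega>) \<and>
    offer_profit (r (raise_belief \<mu> (bel X i \<omega>))) (\<mu> + wtp i \<omega>, loc i \<omega>) \<le> (\<mu> + spread \<omega>)\<^sup>2 \<and>
    0 \<le> offer_utility (r (raise_belief \<mu> (bel X i \<omega>))) (\<mu> + wtp i \<omega>, loc i \<omega>) \<and>
    offer_utility (r (raise_belief \<mu> (bel X i \<omega>))) (\<mu> + wtp i \<omega>, loc i \<omega>) \<le> (\<mu> + spread \<omega>)\<^sup>2"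
proof -
  note [measurable] = offer_measurable(1)[OF r]
  define a where "a y = r (raise_belief \<mu> (\<kappa> X i y))" for y
  \<comment> \<open>The transfer concerns predicates of signal and type, so \<open>spread\<close> is
    expressed through the norm of the signal.\<close>
  define R where "R y = (\<mu> + (1 + (norm y)\<^sup>2))\<^sup>2" for y :: "'n fundamentals"
  define P where "P y t \<longleftrightarrow> 0 \<le> offer_profit (a y) (\<mu> + fst t, snd t) \<and> offer_profit (a y) (\<mu> + fst t, snd t) \<le> R y \<and>
      0 \<le> offer_utility (a y) (\<mu> + fst t, snd t) \<and> offer_utility (a y) (\<mu> + fst t, snd t) \<le> R y" for y t
  have P: "Measurable.pred (borel \<Otimes>\<^sub>M borel) (\<lambda>(y, t). P y t)"
    unfolding P_def a_def R_def by measurable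
  have "AE \<omega> in M. AE t in bel X i \<omega>. P (signal X UNIV \<omega>) t"
    using AE_offer[OF assms, of X i] AE_norm_signal[of X]
  proof eventually_elim
    case (elim \<omega>)
    let ?\<beta> = "raise_belief \<mu> (bel X i \<omega>)"
    have "AE t in ?\<beta>. \<bar>fst t\<bar> \<le> \<mu> + spread \<omega>"
      by (rule eventually_mono[OF elim(1)[THEN conjunct2]], erule conjE) (use \<open>0 \<le> \<mu>\<close> in linarith)
    from optimal_offer_bounds[OF prob_space_raise_belief[OF sets_bel prob_space_bel] this elim(1)[THEN conjunct1]]
    show ?case
      unfolding P_def by (subst (asm) AE_raise_belief[OF sets_bel]) (simp_all add: a_def R_def bel_def elim(2) spread_def)
  qed
  then have "AE \<omega> in M. P (signal X UNIV \<omega>) (ctype i \<omega>)" by (subst AE_bel_iff[OF P])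
  with AE_norm_signal[of X] show ?thesis
    by eventually_elim (simp add: P_def a_def R_def bel_def spread_def ctype_wtp_loc)
qed

lemma AE_offer_interior:
  assumes r: "optimal_rule r"
  shows "AE \<omega> in M. 100 * spread \<omega> \<le> \<mu> \<longrightarrow>
    r (raise_belief \<mu> (bel X i \<omega>)) = ((\<mu> + E_wtp X i \<omega> - V_loc X i \<omega>) / 2, E_loc X i \<omega>) \<and>
    (\<mu> + E_wtp X i \<omega> - V_loc X i \<omega>) / 2 \<le> \<mu> + wtp i \<omega> - mismatch X i \<omega>"
proof (cases "0 \<le> \<mu>")
  case True
  note [measurable] = offer_measurable(1)[OF r]
  define a where "a y = r (raise_belief \<mu> (\<kappa> X i y))" for y
  have a_meas[measurable]: "a \<in> borel_measurable borel" unfolding a_def by measurable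
  define P where "P y t \<longleftrightarrow> (100 * (1 + (norm y)\<^sup>2) \<le> \<mu> \<longrightarrow> fst (a y) \<le> \<mu> + fst t - (snd (a y) - snd t)\<^sup>2)" for y t
  have P: "Measurable.pred (borel \<Otimes>\<^sub>M borel) (\<lambda>(y, t). P y t)"
    unfolding P_def by measurable
  have "AE \<omega> in M. (100 * spread \<omega> \<le> \<mu> \<longrightarrow>
      a (signal X UNIV \<omega>) = ((\<mu> + E_wtp X i \<omega> - V_loc X i \<omega>) / 2, E_loc X i \<omega>)) \<and>
      (AE t in bel X i \<omega>. P (signal X UNIV \<omega>) t)"
    using AE_offer[OF r True, of X i] AE_norm_signal[of X] AE_moment_bounds[of X i]
  proof eventually_elim
    case (elim \<omega>)
    let ?\<beta> = "raise_belief \<mu> (bel X i \<omega>)"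
    obtain p k where pk: "r ?\<beta> = (p, k)" by fastforce
    interpret \<beta>: prob_space "bel X i \<omega>" by (rule prob_space_bel)
    show ?case
    proof (cases "100 * spread \<omega> \<le> \<mu>")
      case good: True
      note int = optimal_offer_interior[OF prob_space_raise_belief[OF sets_bel prob_space_bel]
          elim(1)[THEN conjunct2] _ good elim(1)[THEN conjunct1, unfolded pk]]
      have k: "k = E_loc X i \<omega>"
        using int(1) spread_ge_1[of \<omega>] by (simp add: integral_raise_belief[OF sets_bel] E_loc_def)
      have p: "p = (\<mu> + E_wtp X i \<omega> - V_loc X i \<omega>) / 2"
        using int(2) spread_ge_1[of \<omega>] elim(3) \<beta>.prob_space
        by (simp add: integral_raise_belief[OF sets_bel] E_loc_def E_wtp_def V_loc_def)
      have "AE t in ?\<beta>. p \<le> fst t - (k - snd t)\<^sup>2"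
        using int(3) spread_ge_1[of \<omega>] by simp
      then have "AE t in bel X i \<omega>. p \<le> \<mu> + fst t - (k - snd t)\<^sup>2"
        by (subst (asm) AE_raise_belief[OF sets_bel]) simp_all
      moreover have a: "a (signal X UNIV \<omega>) = (p, k)" by (simp add: a_def bel_def[symmetric] pk)
      ultimately show ?thesis unfolding P_def a by (auto simp: k p elim!: eventually_mono)
    qed (simp add: P_def elim(2) spread_def)
  qed
  then have eq: "AE \<omega> in M. 100 * spread \<omega> \<le> \<mu> \<longrightarrow>
      a (signal X UNIV \<omega>) = ((\<mu> + E_wtp X i \<omega> - V_loc X i \<omega>) / 2, E_loc X i \<omega>)"
    and "AE \<omega> in M. AE t in bel X i \<omega>. P (signal X UNIV \<omega>) t"
    by (auto elim!: eventually_mono)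
  then have "AE \<omega> in M. P (signal X UNIV \<omega>) (ctype i \<omega>)" by (subst AE_bel_iff[OF P])
  with AE_norm_signal[of X] eq show ?thesis
    by eventually_elim (simp add: P_def a_def[symmetric] bel_def spread_def ctype_wtp_loc mismatch_def)
next
  case False
  \<comment> \<open>For negative \<mu> the premise fails, because \<open>spread\<close> is at least
    1.\<close>
  then show ?thesis using spread_ge_1 by (intro AE_I2) (smt (verit))
qed

text \<open>
  Bounds the deviation of welfare from its expansion in \<open>\<mu>\<close>: the two agree where
  \<open>100 * spread \<omega> \<le> \<mu>\<close>, and elsewhere each is at most a multiple of \<open>(spread \<omega>)\<^sup>2\<close>, the factors adding
  up to less than \<open>40000\<close>.
\<close>

definition tail :: "real \<Rightarrow> real" where
  "tail \<mu> = (\<integral>\<omega>. 40000 * (spread \<omega>)\<^sup>2 * indicator {\<omega>. \<mu> < 100 * spread \<omega>} \<omega> \<partial>M)"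

lemma tail_tendsto_0: "(tail \<longlongrightarrow> 0) at_top"
proof -
  have "((\<lambda>\<mu>. \<integral>\<omega>. 40000 * (spread \<omega>)\<^sup>2 * indicator {\<omega>. \<mu> < 100 * spread \<omega>} \<omega> \<partial>M) \<longlongrightarrow> (\<integral>\<omega>. 0 \<partial>M)) at_top"
  proof (rule integral_dominated_convergence_at_top[where w="\<lambda>\<omega>. 40000 * (spread \<omega>)\<^sup>2"])
    show "integrable M (\<lambda>\<omega>. 40000 * (spread \<omega>)\<^sup>2)" by (intro integrable_mult_right integrable_spread)
    have "((\<lambda>\<mu>. 40000 * (spread \<omega>)\<^sup>2 * indicator {\<omega>. \<mu> < 100 * spread \<omega>} \<omega>) \<longlongrightarrow> (0::real)) at_top" for \<omega>
      by (rule tendsto_eventually, rule eventually_mono[OF eventually_ge_at_top[of "100 * spread \<omega>"]])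
         (simp add: indicator_def)
    then show "AE \<omega> in M. ((\<lambda>\<mu>. 40000 * (spread \<omega>)\<^sup>2 * indicator {\<omega>. \<mu> < 100 * spread \<omega>} \<omega>) \<longlongrightarrow> (0::real)) at_top"
      by simp
    show "\<forall>\<^sub>F \<mu> in at_top. AE \<omega> in M. norm (40000 * (spread \<omega>)\<^sup>2 * indicator {\<omega>. \<mu> < 100 * spread \<omega>} \<omega>) \<le> 40000 * (spread \<omega>)\<^sup>2"
      by (intro always_eventually allI AE_I2) (simp add: indicator_def)
  qed simp_all
  then show ?thesis by (simp add: tail_def[abs_def])
qed

definition loc_loss :: "policy \<Rightarrow> 'n \<Rightarrow> real" where
  "loc_loss X i = (\<integral>\<omega>. mismatch X i \<omega> \<partial>M)"

text \<open>The part of (A^2 - p^2) / 2 that is free of \<mu>, where A = \<mu> + w - mismatch is the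
  realized value and p = (\<mu> + E w - Var l) / 2 the interior price.\<close>

definition base_welfare :: "policy \<Rightarrow> 'n \<Rightarrow> real" where
  "base_welfare X i = (\<integral>\<omega>. (wtp i \<omega> - mismatch X i \<omega>)\<^sup>2 / 2 - (E_wtp X i \<omega> - V_loc X i \<omega>)\<^sup>2 / 8 \<partial>M)"

text \<open>Where demand is interior, surplus equals the polynomial (A^2 - p^2) / 2 exactly; the
  remaining states contribute at most \<open>tail \<mu>\<close>, which depends neither on the rule
  nor on the policy.\<close>

lemma welfare_asymptotic:
  assumes r: "optimal_rule r" and "0 \<le> \<mu>"
  shows "\<bar>welfare \<mu> r X i - (3 / 8 * \<mu>\<^sup>2 - 3 / 4 * \<mu> * loc_loss X i + base_welfare X i)\<bar> \<le> tail \<mu>"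
proof -
  note [measurable] = offer_measurable(2)[OF r]
  define \<pi> where "\<pi> \<omega> = offer_profit (r (raise_belief \<mu> (bel X i \<omega>))) (\<mu> + wtp i \<omega>, loc i \<omega>)" for \<omega>
  define u where "u \<omega> = offer_utility (r (raise_belief \<mu> (bel X i \<omega>))) (\<mu> + wtp i \<omega>, loc i \<omega>)" for \<omega>
  have [measurable]: "\<pi> \<in> borel_measurable M" "u \<in> borel_measurable M"
    unfolding \<pi>_def u_def by measurable
  have bounds: "AE \<omega> in M. 0 \<le> \<pi> \<omega> \<and> \<pi> \<omega> \<le> (\<mu> + spread \<omega>)\<^sup>2 \<and> 0 \<le> u \<omega> \<and> u \<omega> \<le> (\<mu> + spread \<omega>)\<^sup>2"
    unfolding \<pi>_def u_def by (rule AE_surplus_bounds[OF assms])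
  have le: "(\<mu> + spread \<omega>)\<^sup>2 \<le> (\<mu> + 1)\<^sup>2 * (spread \<omega>)\<^sup>2" for \<omega>
    using spread_ge_1[of \<omega>] \<open>0 \<le> \<mu>\<close> mult_left_mono[of 1 "spread \<omega>" \<mu>]
    unfolding power_mult_distrib[symmetric] by (intro power_mono) (simp_all add: distrib_right)
  have int: "integrable M \<pi>" "integrable M u"
    by (rule integrable_spread_bound[of _ "(\<mu> + 1)\<^sup>2"], simp, rule eventually_mono[OF bounds], use le order_trans in fastforce)+
  define Q where "Q \<omega> = 3 / 8 * \<mu>\<^sup>2 + \<mu> * (wtp i \<omega> - mismatch X i \<omega>) - \<mu> / 4 * (E_wtp X i \<omega> - V_loc X i \<omega>)
      + ((wtp i \<omega> - mismatch X i \<omega>)\<^sup>2 / 2 - (E_wtp X i \<omega> - V_loc X i \<omega>)\<^sup>2 / 8)" for \<omega>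
  have int_Q: "integrable M Q"
    unfolding Q_def
    by (intro Bochner_Integration.integrable_add Bochner_Integration.integrable_diff integrable_mult_right
        integrable_const integrable_basic integrable_K)
  have Q: "(\<integral>\<omega>. Q \<omega> \<partial>M) = 3 / 8 * \<mu>\<^sup>2 - 3 / 4 * \<mu> * loc_loss X i + base_welfare X i"
    unfolding Q_def base_welfare_def
    using integral_mismatch[of X i]
    by (simp add: integrable_basic integrable_K integral_wtp integral_E_wtp prob_space loc_loss_def
        del: Bochner_Integration.integral_divide_zero)
  have "AE \<omega> in M. \<bar>\<pi> \<omega> + u \<omega> - Q \<omega>\<bar> \<le> 40000 * (spread \<omega>)\<^sup>2 * indicator {\<omega>. \<mu> < 100 * spread \<omega>} \<omega>"
    using bounds AE_offer_interior[OF r, of \<mu> X i] AE_moment_bounds[of X i]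
  proof eventually_elim
    case (elim \<omega>)
    define A where "A = \<mu> + wtp i \<omega> - mismatch X i \<omega>"
    define p where "p = (\<mu> + E_wtp X i \<omega> - V_loc X i \<omega>) / 2"
    have Q_eq: "Q \<omega> = (A\<^sup>2 - p\<^sup>2) / 2"
      by (simp add: Q_def A_def p_def power2_eq_square field_simps)
    show ?case
    proof (cases "100 * spread \<omega> \<le> \<mu>")
      case True
      then have "r (raise_belief \<mu> (bel X i \<omega>)) = (p, E_loc X i \<omega>)" "p \<le> A"
        using elim(2) by (simp_all add: p_def A_def)
      then have "\<pi> \<omega> + u \<omega> = p * (A - p) + (A - p)\<^sup>2 / 2"
        by (simp add: \<pi>_def u_def offer_profit_eq offer_utility_eq mismatch_def[symmetric] A_def)
      also have "\<dots> = Q \<omega>" by (simp add: Q_eq power2_eq_square field_simps)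
      finally show ?thesis using True by simp
    next
      case False
      define s where "s = spread \<omega>"
      have \<mu>: "\<mu> \<le> 100 * s" using False by (simp add: s_def)
      have s: "1 \<le> s" using spread_ge_1 by (simp add: s_def)
      have "\<bar>E_wtp X i \<omega>\<bar> \<le> s" "0 \<le> V_loc X i \<omega>" "V_loc X i \<omega> \<le> s" "0 \<le> mismatch X i \<omega>" "mismatch X i \<omega> \<le> 4 * s" "\<bar>wtp i \<omega>\<bar> \<le> s"
        using elim(3) coord_bounds(1)[of \<omega> i] by (simp_all add: s_def)
      \<comment> \<open>With \<mu> at most 100 s: 105 = 100 + 1 + 4 from the mean,
        \<open>wtp\<close> and \<open>mismatch\<close>, and 51 = (100 + 1 + 1) / 2.\<close>
      then have "\<bar>A\<bar> \<le> 105 * s" "\<bar>p\<bar> \<le> 51 * s"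
        using \<mu> s \<open>0 \<le> \<mu>\<close> by (simp_all add: A_def p_def abs_le_iff)
      then have "A\<^sup>2 \<le> (105 * s)\<^sup>2" "p\<^sup>2 \<le> (51 * s)\<^sup>2"
        using s by (intro power2_le_iff_abs_le[THEN iffD2]; simp)+
      then have "A\<^sup>2 \<le> 11025 * s\<^sup>2" "p\<^sup>2 \<le> 2601 * s\<^sup>2" by (simp_all add: power_mult_distrib)
      then have "\<bar>A\<^sup>2 / 2 - p\<^sup>2 / 2\<bar> \<le> 13626 * s\<^sup>2"
        using zero_le_power2[of A] zero_le_power2[of p] by linarith
      then have "\<bar>Q \<omega>\<bar> \<le> 13626 * s\<^sup>2" by (simp add: Q_eq diff_divide_distrib)
      moreover have "(\<mu> + s)\<^sup>2 \<le> (101 * s)\<^sup>2" using \<mu> s \<open>0 \<le> \<mu>\<close> by (intro power_mono) simp_all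
      then have "(\<mu> + s)\<^sup>2 \<le> 10201 * s\<^sup>2" by (simp add: power_mult_distrib)
      \<comment> \<open>Profit and utility lie between 0 and 10201 s^2 each, and 2 * 10201 + 13626 =
        34028.\<close>
      ultimately have "\<bar>\<pi> \<omega> + u \<omega> - Q \<omega>\<bar> \<le> 40000 * s\<^sup>2"
        using elim(1) zero_le_power2[of s] unfolding s_def[symmetric] by linarith
      then show ?thesis using False by (simp add: s_def)
    qed
  qed
  moreover have "integrable M (\<lambda>\<omega>. 40000 * (spread \<omega>)\<^sup>2 * indicator {\<omega>. \<mu> < 100 * spread \<omega>} \<omega>)"
  proof (rule integrable_real_mult_indicator)
    have "{\<omega> \<in> space M. \<mu> < 100 * spread \<omega>} \<in> events" by measurable
    then show "{\<omega>. \<mu> < 100 * spread \<omega>} \<in> events" by (simp add: space_state_law[OF F])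
  qed (intro integrable_mult_right integrable_spread)
  ultimately have "(\<integral>\<omega>. \<bar>\<pi> \<omega> + u \<omega> - Q \<omega>\<bar> \<partial>M) \<le> tail \<mu>"
    unfolding tail_def using int int_Q by (intro integral_mono_AE) simp_all
  then have "\<bar>\<integral>\<omega>. \<pi> \<omega> + u \<omega> - Q \<omega> \<partial>M\<bar> \<le> tail \<mu>"
    by (rule order_trans[OF integral_abs_bound])
  also have "(\<integral>\<omega>. \<pi> \<omega> + u \<omega> - Q \<omega> \<partial>M) = welfare \<mu> r X i - (\<integral>\<omega>. Q \<omega> \<partial>M)"
    unfolding welfare_def \<pi>_def[symmetric] u_def[symmetric] using int int_Q by simp
  finally show ?thesis by (simp add: Q)
qed

section \<open>Losses from anonymization\<close>

definition wtp_loss :: "policy \<Rightarrow> 'n \<Rightarrow> real" where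
  "wtp_loss X i = (\<integral>\<omega>. (wtp i \<omega> - E_wtp X i \<omega>)\<^sup>2 \<partial>M)"

lemma integrable_wtp_loss: "integrable M (\<lambda>\<omega>. (wtp i \<omega> - E_wtp X i \<omega>)\<^sup>2)"
  using integrable_wtp_sq[of i] integrable_E_wtp_sq[of X i] integrable_E_wtp_wtp[of X i]
  by (simp add: power2_diff mult.commute[of "wtp i _"] mult.assoc)

lemma loc_loss_nonneg: "0 \<le> loc_loss X i"
  unfolding loc_loss_def by (intro integral_nonneg_AE) (simp add: mismatch_def)

lemma wtp_loss_nonneg: "0 \<le> wtp_loss X i"
  unfolding wtp_loss_def by (intro integral_nonneg_AE) simp

lemma loc_loss_eq_0_iff: "loc_loss X i = 0 \<longleftrightarrow> (AE \<omega> in M. loc i \<omega> = E_loc X i \<omega>)"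
proof -
  have "loc_loss X i = 0 \<longleftrightarrow> (AE \<omega> in M. mismatch X i \<omega> = 0)"
    unfolding loc_loss_def
    by (rule integral_nonneg_eq_0_iff_AE[OF integrable_mismatch]) (simp add: mismatch_def)
  also have "\<dots> \<longleftrightarrow> (AE \<omega> in M. loc i \<omega> = E_loc X i \<omega>)"
    by (rule AE_cong) (auto simp: mismatch_def)
  finally show ?thesis .
qed

lemma wtp_loss_eq_0_iff: "wtp_loss X i = 0 \<longleftrightarrow> (AE \<omega> in M. wtp i \<omega> = E_wtp X i \<omega>)"
proof -
  have "wtp_loss X i = 0 \<longleftrightarrow> (AE \<omega> in M. (wtp i \<omega> - E_wtp X i \<omega>)\<^sup>2 = 0)"
    unfolding wtp_loss_def by (rule integral_nonneg_eq_0_iff_AE[OF integrable_wtp_loss]) simp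
  then show ?thesis by simp
qed

text \<open>Only E[w^2] / 2 - E[(E w)^2] / 8 remains. The prediction and its error are orthogonal,
  so E[(E w)^2] is E[w^2] minus the loss: the less precisely the producer predicts w, the less
  surplus his pricing destroys.\<close>

lemma base_welfare_no_loc_loss:
  assumes "loc_loss X i = 0"
  shows "base_welfare X i = 3 / 8 * (\<integral>\<omega>. (wtp i \<omega>)\<^sup>2 \<partial>M) + wtp_loss X i / 8"
proof -
  have "(\<integral>\<omega>. V_loc X i \<omega> \<partial>M) = 0" using assms integral_mismatch by (simp add: loc_loss_def)
  moreover have "AE \<omega> in M. 0 \<le> V_loc X i \<omega>" using AE_moment_bounds[of X i] by (auto elim!: eventually_mono)
  ultimately have V: "AE \<omega> in M. V_loc X i \<omega> = 0"
    using integral_nonneg_eq_0_iff_AE[OF integrable_V_loc] by blast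
  have "AE \<omega> in M. mismatch X i \<omega> = 0"
    using assms unfolding loc_loss_eq_0_iff by eventually_elim (simp add: mismatch_def)
  with V have "base_welfare X i = (\<integral>\<omega>. (wtp i \<omega>)\<^sup>2 / 2 - (E_wtp X i \<omega>)\<^sup>2 / 8 \<partial>M)"
    unfolding base_welfare_def by (intro integral_cong_AE) auto
  also have "\<dots> = (\<integral>\<omega>. (wtp i \<omega>)\<^sup>2 \<partial>M) / 2 - (\<integral>\<omega>. (E_wtp X i \<omega>)\<^sup>2 \<partial>M) / 8"
    by (simp add: integrable_wtp_sq integrable_E_wtp_sq)
  also have "wtp_loss X i = (\<integral>\<omega>. (wtp i \<omega>)\<^sup>2 - 2 * (E_wtp X i \<omega> * wtp i \<omega>) + (E_wtp X i \<omega>)\<^sup>2 \<partial>M)"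
    unfolding wtp_loss_def by (intro Bochner_Integration.integral_cong) (simp_all add: power2_diff)
  then have "wtp_loss X i = (\<integral>\<omega>. (wtp i \<omega>)\<^sup>2 \<partial>M) - (\<integral>\<omega>. (E_wtp X i \<omega>)\<^sup>2 \<partial>M)"
    by (simp add: integrable_wtp_sq integrable_E_wtp_sq integrable_E_wtp_wtp integral_E_wtp_wtp)
  then have "(\<integral>\<omega>. (E_wtp X i \<omega>)\<^sup>2 \<partial>M) = (\<integral>\<omega>. (wtp i \<omega>)\<^sup>2 \<partial>M) - wtp_loss X i" by simp
  finally show ?thesis by (simp add: field_simps)
qed

lemma signal_Complete:
  "fst X = Complete \<Longrightarrow> fst (signal X UNIV \<omega>) $ i = wtp i \<omega>"
  "snd X = Complete \<Longrightarrow> snd (signal X UNIV \<omega>) $ i = loc i \<omega>"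
  by (cases \<omega>, simp add: signal_eq dataset_def)+

lemma loc_loss_Complete:
  assumes "snd X = Complete" shows "loc_loss X i = 0"
proof -
  have "AE \<omega> in M. (\<integral>t. snd t \<partial>bel X i \<omega>) = snd (ctype i \<omega>)"
    by (rule AE_E_eq(1)[of "\<lambda>y. snd y $ i"]) (simp_all add: signal_Complete assms ctype_wtp_loc)
  then show ?thesis
    unfolding loc_loss_eq_0_iff by eventually_elim (simp add: ctype_wtp_loc E_loc_def)
qed

lemma wtp_loss_Complete:
  assumes "fst X = Complete" shows "wtp_loss X i = 0"
proof -
  have "AE \<omega> in M. (\<integral>t. fst t \<partial>bel X i \<omega>) = fst (ctype i \<omega>)"
    by (rule AE_E_eq(1)[of "\<lambda>y. fst y $ i"]) (simp_all add: signal_Complete assms ctype_wtp_loc)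
  then show ?thesis
    unfolding wtp_loss_eq_0_iff by eventually_elim (simp add: ctype_wtp_loc E_wtp_def)
qed

text \<open>Two policies that both reveal the type lead to the same point mass as belief, hence to
  an exact tie.\<close>

lemma bel_no_loss:
  assumes "loc_loss X i = 0" "wtp_loss X i = 0"
  shows "AE \<omega> in M. bel X i \<omega> = return borel (ctype i \<omega>)"
  unfolding bel_def
proof (rule posterior_return[OF prob_space_axioms measurable_signal' measurable_ctype' post])
  note [measurable] = moments_measurable
  show "(\<lambda>y. (\<integral>t. fst t \<partial>\<kappa> X i y, \<integral>t. snd t \<partial>\<kappa> X i y)) \<in> borel \<rightarrow>\<^sub>M borel"
    by (intro borel_measurable_Pair moments_measurable) simp_all
  show "AE \<omega> in M. ctype i \<omega> = (\<integral>t. fst t \<partial>\<kappa> X i (signal X UNIV \<omega>), \<integral>t. snd t \<partial>\<kappa> X i (signal X UNIV \<omega>))"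
    using assms unfolding loc_loss_eq_0_iff wtp_loss_eq_0_iff
    by eventually_elim (simp add: ctype_wtp_loc E_loc_def E_wtp_def bel_def)
qed

lemma AE_relabel_signal:
  assumes "AE \<omega> in M. f (fst \<omega>) = g (signal X UNIV \<omega>)" and \<tau>: "\<tau> permutes UNIV"
  shows "AE x in F. f x = g (relabel (if fst X = Complete then id else \<tau>) (if snd X = Complete then id else \<tau>) x)"
  using AE_state_lawD[OF F assms(1) diagonal_in_permutation_law[OF \<tau>]]
  unfolding signal_UNIV fst_conv snd_conv .

lemma relabel_id: "relabel id id x = x"
  by (simp add: relabel_def)

text \<open>Zero loss makes a coordinate f of consumer i a function g of the signal under every
  permutation of positive probability. The identity gives f x = g x, also at the relabeled x since
  null sets are preserved; the transposition of i and j gives f x = g (relabeled x). So f is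
  invariant, the anonymized coordinates of i and j agree almost surely, and their difference has
  variance zero.\<close>

lemma nondegenerate_loss:
  assumes "nondegenerate F" and "j \<noteq> i"
  shows "fst X = Anonymized \<Longrightarrow> wtp_loss X i \<noteq> 0" "snd X = Anonymized \<Longrightarrow> loc_loss X i \<noteq> 0"
proof -
  define \<tau> where "\<tau> = Transposition.transpose i j"
  have \<tau>: "\<tau> permutes UNIV" "\<tau> i = j" by (auto simp: \<tau>_def permutes_swap_id)
  let ?a = "if fst X = Complete then id else \<tau>"
  let ?b = "if snd X = Complete then id else \<tau>"
  have perm: "?a permutes UNIV" "?b permutes UNIV" using \<tau>(1) by (simp_all add: permutes_id)
  have same: "AE x in F. f x = f (relabel ?a ?b x)"
    if "AE \<omega> in M. f (fst \<omega>) = g (signal X UNIV \<omega>)" for f g :: "'n fundamentals \<Rightarrow> real"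
  proof -
    have "AE x in F. f x = g x"
      using AE_relabel_signal[OF that permutes_id] by (simp add: relabel_id)
    then have "AE x in F. f (relabel ?a ?b x) = g (relabel ?a ?b x)"
      by (subst AE_nondegenerate_gaussian_linear[OF gauss assms(1) linear_relabel inj_relabel[OF perm]])
    with AE_relabel_signal[OF that \<tau>(1)] show ?thesis by eventually_elim simp
  qed
  have contra: False if "AE x in F. v \<bullet> x = 0" "v \<noteq> 0" for v
  proof -
    have "(\<integral>x. v \<bullet> x \<partial>F) = (\<integral>x. 0 \<partial>F)"
      using that(1) F(2) by (intro integral_cong_AE) (auto simp: measurable_cong_sets[OF F(2) refl])
    then have "(\<integral>x. (v \<bullet> x - (\<integral>x. v \<bullet> x \<partial>F))\<^sup>2 \<partial>F) = (\<integral>x. 0 \<partial>F)"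
      using that(1) by (intro integral_cong_AE) (auto simp: measurable_cong_sets[OF F(2) refl])
    then show False using assms(1)[unfolded nondegenerate_def, rule_format, OF that(2)] by simp
  qed
  have coord_neq: "coord c i - coord c j \<noteq> 0" for c
    using \<open>j \<noteq> i\<close> by (cases c) (auto simp: coord_def axis_eq_axis zero_prod_def)
  show "wtp_loss X i \<noteq> 0" if "fst X = Anonymized"
  proof
    assume "wtp_loss X i = 0"
    then have "AE x in F. fst x $ i = fst (relabel ?a ?b x) $ i"
      unfolding wtp_loss_eq_0_iff E_wtp_def bel_def
      by (rule same[of "\<lambda>x. fst x $ i" "\<lambda>y. \<integral>t. fst t \<partial>\<kappa> X i y"])
    then have "AE x in F. (coord True i - coord True j) \<bullet> x = 0"
      by eventually_elim (simp add: inner_diff_left inner_coord relabel_def that \<tau>(2))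
    then show False by (rule contra[OF _ coord_neq])
  qed
  show "loc_loss X i \<noteq> 0" if "snd X = Anonymized"
  proof
    assume "loc_loss X i = 0"
    then have "AE x in F. snd x $ i = snd (relabel ?a ?b x) $ i"
      unfolding loc_loss_eq_0_iff E_loc_def bel_def
      by (rule same[of "\<lambda>x. snd x $ i" "\<lambda>y. \<integral>t. snd t \<partial>\<kappa> X i y"])
    then have "AE x in F. (coord False i - coord False j) \<bullet> x = 0"
      by eventually_elim (simp add: inner_diff_left inner_coord relabel_def that \<tau>(2))
    then show False by (rule contra[OF _ coord_neq])
  qed
qed

text \<open>The law may be singular here, so invariance comes from symmetry instead of null sets.
  Symmetry requires the same permutation on both components, which this policy applies in the
  comparison. All locations then coincide almost surely, and shuffling them has no effect on the
  signal.\<close>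

lemma bel_anonymized_no_loss:
  assumes sym: "symmetric_consumers F" and loss: "\<And>i. loc_loss (Anonymized, Anonymized) i = 0"
  shows "AE \<omega> in M. bel (Anonymized, Anonymized) i \<omega> = bel (Anonymized, Complete) i \<omega>"
proof -
  have "AE x in F. snd x $ i = snd x $ j" for i j
  proof -
    define \<tau> where "\<tau> = Transposition.transpose i j"
    have \<tau>: "\<tau> permutes UNIV" "\<tau> i = j" by (auto simp: \<tau>_def permutes_swap_id)
    define g where "g y = (\<integral>t. snd t \<partial>\<kappa> (Anonymized, Anonymized) i y)" for y
    have "AE \<omega> in M. snd (fst \<omega>) $ i = g (signal (Anonymized, Anonymized) UNIV \<omega>)"
      using loss[of i] unfolding loc_loss_eq_0_iff g_def E_loc_def bel_def .
    note * = AE_relabel_signal[OF this]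
    have "AE x in F. snd x $ i = g x" using *[OF permutes_id] by (simp add: relabel_id)
    then have "AE x in distr F borel (relabel \<tau> \<tau>). snd x $ i = g x"
      unfolding symmetric_consumers_relabel[OF sym \<tau>(1)] .
    then have "AE x in F. snd (relabel \<tau> \<tau> x) $ i = g (relabel \<tau> \<tau> x)"
      by (rule AE_distrD[rotated]) (simp add: measurable_cong_sets[OF F(2) refl])
    with *[OF \<tau>(1)] show ?thesis by eventually_elim (simp add: relabel_def \<tau>(2))
  qed
  then have "AE x in F. \<forall>i j. snd x $ i = snd x $ j" by (simp add: AE_all_countable)
  from AE_state_law_fst[OF F this, of linked UNIV]
  have "AE \<omega> in M. signal (Anonymized, Anonymized) UNIV \<omega> = signal (Anonymized, Complete) UNIV \<omega>"
  proof eventually_elim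
    case (elim \<omega>)
    obtain x d where \<omega>: "\<omega> = (x, d)" by (cases \<omega>)
    have "snd x $ snd d j = snd x $ j" for j using elim by (simp add: \<omega>)
    then show ?case by (simp add: \<omega> signal_eq dataset_def vec_eq_iff)
  qed
  then have *: "AE \<omega> in M. signal (Anonymized, Complete) UNIV \<omega> = signal (Anonymized, Anonymized) UNIV \<omega>"
    by eventually_elim simp
  from posterior_unique[OF prob_space_axioms measurable_signal' post
      posterior_cong_AE[OF post measurable_signal' measurable_signal' measurable_ctype' *]] *
  show ?thesis unfolding bel_def by eventually_elim simp
qed

section \<open>Comparison of policies for large \<mu>\<close>

lemma sum_welfare_asymptotic:
  assumes "optimal_rule r" "0 \<le> \<mu>"
  shows "\<bar>(\<Sum>i\<in>UNIV. welfare \<mu> r X i) - (real CARD('n) * (3 / 8 * \<mu>\<^sup>2) - 3 / 4 * \<mu> * (\<Sum>i\<in>UNIV. loc_loss X i)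
    + (\<Sum>i\<in>UNIV. base_welfare X i))\<bar> \<le> real CARD('n) * tail \<mu>"
proof -
  let ?Q = "\<lambda>i. 3 / 8 * \<mu>\<^sup>2 - 3 / 4 * \<mu> * loc_loss X i + base_welfare X i"
  have "(\<Sum>i\<in>UNIV. welfare \<mu> r X i) - (real CARD('n) * (3 / 8 * \<mu>\<^sup>2) - 3 / 4 * \<mu> * (\<Sum>i\<in>UNIV. loc_loss X i)
    + (\<Sum>i\<in>UNIV. base_welfare X i)) = (\<Sum>i\<in>UNIV. welfare \<mu> r X i - ?Q i)"
    by (simp add: sum.distrib sum_subtractf sum_distrib_left)
  also have "\<bar>\<dots>\<bar> \<le> (\<Sum>i\<in>(UNIV :: 'n set). tail \<mu>)"
    by (intro order_trans[OF sum_abs] sum_mono welfare_asymptotic assms)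
  finally show ?thesis by simp
qed

text \<open>Both policies incur an error of at most \<open>CARD('n) * tail \<mu>\<close>. It is
  outweighed by the linear term if the location loss L is positive, and by the difference B of the
  constants if L = 0.\<close>

lemma eventually_welfare_less:
  assumes "0 < (\<Sum>i\<in>UNIV. loc_loss X i) \<or>
      (\<Sum>i\<in>UNIV. loc_loss X i) = 0 \<and> (\<Sum>i\<in>UNIV. base_welfare X i) < (\<Sum>i\<in>UNIV. base_welfare X' i)"
    and X': "(\<Sum>i\<in>UNIV. loc_loss X' i) = 0"
  shows "\<forall>\<^sub>F \<mu> in at_top. \<forall>r. optimal_rule r \<longrightarrow> (\<Sum>i\<in>UNIV. welfare \<mu> r X i) < (\<Sum>i\<in>UNIV. welfare \<mu> r X' i)"
proof -
  define L where "L = (\<Sum>i\<in>UNIV. loc_loss X i)"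
  define B where "B = (\<Sum>i\<in>UNIV. base_welfare X' i) - (\<Sum>i\<in>UNIV. base_welfare X i)"
  have tail: "((\<lambda>\<mu>. 2 * (real CARD('n) * tail \<mu>)) \<longlongrightarrow> 0) at_top"
    by (intro tendsto_mult_right_zero tail_tendsto_0)
  have "\<forall>\<^sub>F \<mu> in at_top. 2 * (real CARD('n) * tail \<mu>) < 3 / 4 * \<mu> * L + B"
  proof (cases "0 < L")
    case True
    have "\<forall>\<^sub>F \<mu> in at_top. 2 * (real CARD('n) * tail \<mu>) < 1" by (rule order_tendstoD(2)[OF tail]) simp
    \<comment> \<open>From this threshold on, the gain \<open>3 / 4 * \<mu> * L + B\<close> is at
      least 1, whatever the sign of B.\<close>
    with eventually_ge_at_top[of "(1 - B) / (3 / 4 * L)"] show ?thesis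
    proof eventually_elim
      case (elim \<mu>)
      then have "1 - B \<le> \<mu> * (3 / 4 * L)" using True by (subst (asm) pos_divide_le_eq) simp_all
      with elim(2) show ?case by (simp add: mult_ac)
    qed
  next
    case False
    then have "L = 0" "0 < B" using assms(1) by (simp_all add: L_def B_def)
    then show ?thesis using order_tendstoD(2)[OF tail, of B] by simp
  qed
  with eventually_ge_at_top[of 0] show ?thesis
  proof eventually_elim
    case (elim \<mu>)
    show ?case
    proof (intro allI impI)
      fix r assume r: "optimal_rule r"
      show "(\<Sum>i\<in>UNIV. welfare \<mu> r X i) < (\<Sum>i\<in>UNIV. welfare \<mu> r X' i)"
        using sum_welfare_asymptotic[OF r elim(1), of X] sum_welfare_asymptotic[OF r elim(1), of X'] elim(2)
        unfolding X' L_def[symmetric] B_def by linarith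
    qed
  qed
qed

text \<open>The expansion with its error bound can only decide strict comparisons. Where its
  coefficients tie, the posteriors are shown to coincide, which makes welfare equal for every \<mu>;
  nondegeneracy rules these cases out, since then anonymization always leaves a positive
  loss.\<close>

lemma eventually_anonymized_complete_best:
  assumes sym: "symmetric_consumers F" and n: "2 \<le> CARD('n)" and X: "X \<noteq> (Anonymized, Complete)"
  shows "\<forall>\<^sub>F \<mu> in at_top. \<forall>r. optimal_rule r \<longrightarrow>
    (\<Sum>i\<in>UNIV. welfare \<mu> r X i) \<le> (\<Sum>i\<in>UNIV. welfare \<mu> r (Anonymized, Complete) i) \<and>
    (nondegenerate F \<longrightarrow> (\<Sum>i\<in>UNIV. welfare \<mu> r X i) < (\<Sum>i\<in>UNIV. welfare \<mu> r (Anonymized, Complete) i))"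
proof -
  let ?AC = "(Anonymized, Complete)"
  obtain i j :: 'n where ij: "j \<noteq> i"
    using n by (metis card_2_iff' card_le_Suc0_iff_eq finite UNIV_I not_less_eq_eq numeral_2_eq_2)
  have sum_0_iff: "(\<Sum>i\<in>UNIV. loc_loss X i) = 0 \<longleftrightarrow> (\<forall>i. loc_loss X i = 0)"
    "(\<Sum>i\<in>UNIV. wtp_loss X i) = 0 \<longleftrightarrow> (\<forall>i. wtp_loss X i = 0)" for X
    by (simp_all add: sum_nonneg_eq_0_iff loc_loss_nonneg wtp_loss_nonneg)
  have AC: "loc_loss ?AC i = 0" for i by (rule loc_loss_Complete) simp
  have strict: ?thesis if "0 < (\<Sum>i\<in>UNIV. loc_loss X i) \<or>
      (\<Sum>i\<in>UNIV. loc_loss X i) = 0 \<and> (\<Sum>i\<in>UNIV. base_welfare X i) < (\<Sum>i\<in>UNIV. base_welfare ?AC i)"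
    using eventually_welfare_less[OF that] AC
    by (auto elim!: eventually_mono simp: less_imp_le)
  have tie: ?thesis if "\<not> nondegenerate F" "\<And>i. AE \<omega> in M. bel X i \<omega> = bel ?AC i \<omega>"
    using welfare_cong[OF _ that(2)] that(1) by (intro always_eventually) (simp cong: sum.cong)
  show ?thesis
  proof (cases "(\<Sum>i\<in>UNIV. loc_loss X i) = 0")
    case False
    moreover have "0 \<le> (\<Sum>i\<in>UNIV. loc_loss X i)" by (intro sum_nonneg loc_loss_nonneg)
    ultimately show ?thesis using strict by simp
  next
    case True
    then have loc: "loc_loss X i = 0" for i by (simp add: sum_0_iff)
    have degenerate_if: "\<not> nondegenerate F" if "snd X = Anonymized"
      using nondegenerate_loss(2)[OF _ ij that] loc by blast
    show ?thesis
    proof (cases "fst X")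
      case Complete
      then have wtp: "wtp_loss X i = 0" for i by (rule wtp_loss_Complete)
      show ?thesis
      proof (cases "\<forall>i. wtp_loss ?AC i = 0")
        case all0: True
        show ?thesis
        proof (rule tie)
          show "\<not> nondegenerate F" using nondegenerate_loss(1)[OF _ ij, of ?AC] all0 by auto
          show "AE \<omega> in M. bel X i \<omega> = bel ?AC i \<omega>" for i
            using bel_no_loss[OF loc wtp, of i] bel_no_loss[OF AC all0[rule_format], of i]
            by eventually_elim simp
        qed
      next
        case some: False
        then have "0 < (\<Sum>i\<in>UNIV. wtp_loss ?AC i)"
          using sum_0_iff(2)[of ?AC] sum_nonneg[of UNIV "wtp_loss ?AC", OF wtp_loss_nonneg] by (simp add: less_le)
        then have "(\<Sum>i\<in>UNIV. base_welfare X i) < (\<Sum>i\<in>UNIV. base_welfare ?AC i)"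
          by (simp add: base_welfare_no_loc_loss loc AC wtp sum.distrib sum_divide_distrib[symmetric])
        with True show ?thesis using strict by simp
      qed
    next
      case Anonymized
      with X have X_eq: "X = (Anonymized, Anonymized)" by (cases X; cases "snd X") auto
      show ?thesis
        using degenerate_if bel_anonymized_no_loss[OF sym] loc unfolding X_eq by (intro tie[unfolded X_eq]) auto
    qed
  qed
qed

end

section \<open>From welfare to the intermediary's profit\<close>

lemma intermediary_profit_diff:
  fixes F :: "'n::finite fundamentals measure"
  assumes "gaussian F" "symmetric_consumers F" and opt: "producer_optimal linked F r \<kappa>"
  shows "intermediary_profit linked F r \<kappa> X - intermediary_profit linked F r \<kappa> X' =
    (\<Sum>i\<in>UNIV. producer_profit linked F r \<kappa> X UNIV i + consumer_utility linked F r \<kappa> X UNIV i) -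
    (\<Sum>i\<in>UNIV. producer_profit linked F r \<kappa> X' UNIV i + consumer_utility linked F r \<kappa> X' UNIV i)"
proof -
  note F = prob_space_gaussian[OF assms(1)] sets_gaussian[OF assms(1)]
  have "producer_profit linked F r \<kappa> X {} i = producer_profit linked F r \<kappa> X' {} i"
    "consumer_utility linked F r \<kappa> X (UNIV - {i}) i = consumer_utility linked F r \<kappa> X' (UNIV - {i}) i" for i
    by (rule producer_profit_no_information[OF F opt], rule consumer_utility_others[OF assms])
  then show ?thesis
    by (simp add: intermediary_profit_def producer_payment_def consumer_payment_def sum.distrib sum_subtractf)
qed

theorem proposition10:
  fixes F :: "'n::finite fundamentals measure" and linked :: bool
  assumes "2 \<le> CARD('n)"
    and "gaussian F"
    and "symmetric_consumers F"
    and "\<And>i. (\<integral>x. fst x $ i \<partial>F) = 0"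
  shows "\<exists>\<mu>\<^sub>0. \<forall>\<mu>\<ge>\<mu>\<^sub>0. \<forall>r \<kappa>. producer_optimal linked (shift_wtp \<mu> F) r \<kappa> \<longrightarrow>
           optimal_policy linked (shift_wtp \<mu> F) r \<kappa> (Anonymized, Complete) \<and>
           (nondegenerate F \<longrightarrow>
             (\<forall>X. optimal_policy linked (shift_wtp \<mu> F) r \<kappa> X \<longrightarrow> X = (Anonymized, Complete)))"
proof (cases "\<exists>\<mu> r \<kappa>. producer_optimal linked (shift_wtp \<mu> F) r \<kappa>")
  case False
  then show ?thesis by blast
next
  case True
  \<comment> \<open>Without any producer-optimal pair the claim is vacuous. Otherwise one pair, at
    an arbitrary mean \<open>\<nu>\<close>, supplies by translation the mean-zero posteriors that
    serve all other means.\<close>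
  then obtain \<nu> r\<^sub>0 \<kappa>\<^sub>0 where opt0: "producer_optimal linked (shift_wtp \<nu> F) r\<^sub>0 \<kappa>\<^sub>0" by blast
  note F = prob_space_gaussian[OF assms(2)] sets_gaussian[OF assms(2)]
  interpret market F linked "\<lambda>X i y. raise_belief (- \<nu>) (\<kappa>\<^sub>0 X UNIV i (raise_wtp \<nu> y))"
    by unfold_locales (fact assms(2), fact assms(4), rule posterior_unshift[OF F producer_optimalD(2)[OF opt0]])
  let ?AC = "(Anonymized, Complete)"
  let ?W = "\<lambda>\<mu> r X. \<Sum>i\<in>UNIV. welfare \<mu> r X i"
  have "\<forall>\<^sub>F \<mu> in at_top. \<forall>X\<in>- {?AC}. \<forall>r. optimal_rule r \<longrightarrow>
      ?W \<mu> r X \<le> ?W \<mu> r ?AC \<and> (nondegenerate F \<longrightarrow> ?W \<mu> r X < ?W \<mu> r ?AC)"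
  proof (rule eventually_ball_finite)
    have "(UNIV :: collection set) = {Complete, Anonymized}" using collection.exhaust by auto
    then have "finite (UNIV :: collection set)" by (metis finite.intros)
    then have "finite (UNIV :: policy set)" by (simp add: finite_prod)
    then show "finite (- {?AC})" by (rule finite_subset[rotated]) simp
  qed (use eventually_anonymized_complete_best[OF assms(3,1)] in auto)
  then obtain \<mu>\<^sub>0 where \<mu>\<^sub>0: "\<And>\<mu> X r. \<mu>\<^sub>0 \<le> \<mu> \<Longrightarrow> X \<noteq> ?AC \<Longrightarrow> optimal_rule r \<Longrightarrow>
      ?W \<mu> r X \<le> ?W \<mu> r ?AC \<and> (nondegenerate F \<longrightarrow> ?W \<mu> r X < ?W \<mu> r ?AC)"
    unfolding eventually_at_top_linorder by (metis ComplI singletonD)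
  show ?thesis
  proof (intro exI[of _ \<mu>\<^sub>0] allI impI)
    fix \<mu> r \<kappa> assume "\<mu>\<^sub>0 \<le> \<mu>" and opt: "producer_optimal linked (shift_wtp \<mu> F) r \<kappa>"
    let ?I = "intermediary_profit linked (shift_wtp \<mu> F) r \<kappa>"
    have "?I X - ?I ?AC = ?W \<mu> r X - ?W \<mu> r ?AC" for X
      by (simp add: intermediary_profit_diff[OF gaussian_shift_wtp[OF assms(2)]
            symmetric_consumers_shift_wtp[OF assms(3) F(2)] opt, of X ?AC] welfare_eq[OF opt])
    then have I: "?I X \<le> ?I ?AC \<longleftrightarrow> ?W \<mu> r X \<le> ?W \<mu> r ?AC" "?I X < ?I ?AC \<longleftrightarrow> ?W \<mu> r X < ?W \<mu> r ?AC" for X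
      by (metis diff_le_0_iff_le, metis diff_less_0_iff_less)
    note best = \<mu>\<^sub>0[OF \<open>\<mu>\<^sub>0 \<le> \<mu>\<close> _ producer_optimalD(1)[OF opt]]
    have "?I X \<le> ?I ?AC" for X using best[of X] I(1)[of X] by (cases "X = ?AC") simp_all
    then have "optimal_policy linked (shift_wtp \<mu> F) r \<kappa> ?AC"
      by (simp add: optimal_policy_def is_arg_max_linorder)
    moreover have "X = ?AC" if "nondegenerate F" "optimal_policy linked (shift_wtp \<mu> F) r \<kappa> X" for X
    proof (rule ccontr)
      assume "X \<noteq> ?AC"
      then have "?I X < ?I ?AC" using best[of X] that(1) I(2) by blast
      then show False using that(2) unfolding optimal_policy_def is_arg_max_def by blast
    qed
    ultimately show "optimal_policy linked (shift_wtp \<mu> F) r \<kappa> ?AC \<and>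
        (nondegenerate F \<longrightarrow> (\<forall>X. optimal_policy linked (shift_wtp \<mu> F) r \<kappa> X \<longrightarrow> X = ?AC))" by blast
  qed
qed

end
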